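(* Let $S=\{1,2,\dots,n\}$ be a static set of keys, and let $x_1, x_2, \dots$ be a sequence of accesses to elements of $S$. There exists a binary search tree on $S$ (in the binary search tree model) that performs the access to $x_i$ in $O(\lg n)$ worst-case time and in $O(\mathrm{UB}(x_i) + \lg\lg n)$ amortized time.
   Context: $\lg x := \log_2(x+2)$. The working-set number $w_i(y)$ of $y$ at time $i$ is the number of distinct elements accessed since the last access to $y$, or $n$ if $y$ has not yet been accessed by time $i$. For $x,y\in S$, $d(x,y)$ denotes the rank distance between $x$ and $y$. The unified bound is $$\mathrm{UB}(x) = \min_{y\in S} \lg\bigl(w_i(y) + d(x,y)\bigr)$$ for an access to $x$ at time $i$. Binary search tree model: each node stores a key, parent and child pointers, and $O(1)$ fields of $O(\lg n)$ bits. An access starts at the root, moves along tree pointers and may update visited nodes. Its cost is the number of visited nodes. *)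

theory Defs
  imports Complex_Main "HOL-Library.Tree"
begin

definition lg :: "real \<Rightarrow> real" where
  "lg x = log 2 (x + 2)"

text \<open>A node of the search tree stores a key together with a list of auxiliary fields.\<close>
type_synonym node = "nat \<times> nat list"

text \<open>The part of the tree seen by an access so far.  Hole marks a non-null child pointer
  of a visited node whose target has not been visited; PLeaf is a null pointer.\<close>
datatype 'a ptree = Hole | PLeaf | PNode "'a ptree" 'a "'a ptree"

fun stub :: "'a tree \<Rightarrow> 'a ptree" where
  "stub Leaf = PLeaf"
| "stub (Node l a r) = Hole"

fun expand :: "'a tree \<Rightarrow> 'a ptree \<Rightarrow> bool list \<Rightarrow> 'a ptree option" where
  "expand (Node l a r) Hole [] = Some (PNode (stub l) a (stub r))"
| "expand (Node l a r) (PNode vl b vr) (False # p) = map_option (\<lambda>v. PNode v b vr) (expand l vl p)"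
| "expand (Node l a r) (PNode vl b vr) (True # p) = map_option (\<lambda>v. PNode vl b v) (expand r vr p)"
| "expand _ _ _ = None"

text \<open>Decision procedure of an access: given the accessed key and the current view,
  either visit a further node (Inl path) or stop and output the new shape/content of the
  visited part (Inr top).\<close>
type_synonym decider = "nat \<Rightarrow> node ptree \<Rightarrow> bool list + node ptree"

fun walk :: "decider \<Rightarrow> node tree \<Rightarrow> nat \<Rightarrow> nat \<Rightarrow> node ptree \<Rightarrow> (node ptree \<times> node ptree) option" where
  "walk dec t x 0 v = None"
| "walk dec t x (Suc k) v =
     (case dec x v of
        Inl p \<Rightarrow> (case expand t v p of None \<Rightarrow> None | Some v' \<Rightarrow> walk dec t x k v')
      | Inr out \<Rightarrow> Some (v, out))"

text \<open>An access starts at the root. Result: (final view = visited part, new top part).\<close>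
definition access :: "decider \<Rightarrow> nat \<Rightarrow> node tree \<Rightarrow> nat \<Rightarrow> (node ptree \<times> node ptree) option" where
  "access dec n t x = (case expand t Hole [] of None \<Rightarrow> None | Some v0 \<Rightarrow> walk dec t x (Suc n) v0)"

fun vnodes :: "'a ptree \<Rightarrow> 'a list" where
  "vnodes Hole = []"
| "vnodes PLeaf = []"
| "vnodes (PNode l a r) = vnodes l @ [a] @ vnodes r"

fun nholes :: "'a ptree \<Rightarrow> nat" where
  "nholes Hole = 1"
| "nholes PLeaf = 0"
| "nholes (PNode l a r) = nholes l + nholes r"

fun holes :: "'a tree \<Rightarrow> 'a ptree \<Rightarrow> 'a tree list" where
  "holes t Hole = [t]"
| "holes t PLeaf = []"
| "holes (Node l a r) (PNode vl b vr) = holes l vl @ holes r vr"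
| "holes Leaf (PNode vl b vr) = []"

fun fill :: "'a ptree \<Rightarrow> 'a tree list \<Rightarrow> 'a tree \<times> 'a tree list" where
  "fill Hole [] = (Leaf, [])"
| "fill Hole (s # ss) = (s, ss)"
| "fill PLeaf ss = (Leaf, ss)"
| "fill (PNode l a r) ss =
     (let (l', ss1) = fill l ss; (r', ss2) = fill r ss1 in (Node l' a r', ss2))"

definition new_tree :: "node tree \<Rightarrow> node ptree \<Rightarrow> node ptree \<Rightarrow> node tree" where
  "new_tree t v out = fst (fill out (holes t v))"

definition bst_on :: "nat \<Rightarrow> node tree \<Rightarrow> bool" where
  "bst_on n t \<longleftrightarrow> map fst (inorder t) = [1..<n+1]"

text \<open>Each node has c fields of at most c * lg n bits, i.e. values below (n+2)^c.\<close>
definition fields_ok :: "nat \<Rightarrow> nat \<Rightarrow> node tree \<Rightarrow> bool" where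
  "fields_ok c n t \<longleftrightarrow> (\<forall>a\<in>set_tree t. length (snd a) = c \<and> (\<forall>f\<in>set (snd a). f < (n+2)^c))"

definition legal_access :: "nat \<Rightarrow> nat \<Rightarrow> decider \<Rightarrow> node tree \<Rightarrow> nat \<Rightarrow> bool" where
  "legal_access c n dec t x \<longleftrightarrow>
     (\<exists>v out. access dec n t x = Some (v, out) \<and> x \<in> fst ` set (vnodes v)
        \<and> nholes out = nholes v \<and> bst_on n (new_tree t v out) \<and> fields_ok c n (new_tree t v out))"

fun run :: "decider \<Rightarrow> node tree \<Rightarrow> nat \<Rightarrow> (nat \<Rightarrow> nat) \<Rightarrow> nat \<Rightarrow> node tree" where
  "run dec t0 n xs 0 = t0"
| "run dec t0 n xs (Suc i) =
     (case access dec n (run dec t0 n xs i) (xs i) of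
        Some (v, out) \<Rightarrow> new_tree (run dec t0 n xs i) v out
      | None \<Rightarrow> run dec t0 n xs i)"

definition cost :: "decider \<Rightarrow> node tree \<Rightarrow> nat \<Rightarrow> (nat \<Rightarrow> nat) \<Rightarrow> nat \<Rightarrow> nat" where
  "cost dec t0 n xs i =
     (case access dec n (run dec t0 n xs i) (xs i) of Some (v, out) \<Rightarrow> length (vnodes v) | None \<Rightarrow> 0)"

definition wset :: "nat \<Rightarrow> (nat \<Rightarrow> nat) \<Rightarrow> nat \<Rightarrow> nat \<Rightarrow> nat" where
  "wset n xs i y =
     (if \<exists>j<i. xs j = y then card (xs ` {(GREATEST j. j < i \<and> xs j = y)<..<i}) else n)"

text \<open>Unified bound for the access at time i, with S = {1..n} and rank distance |x - y|.\<close>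
definition UB :: "nat \<Rightarrow> (nat \<Rightarrow> nat) \<Rightarrow> nat \<Rightarrow> real" where
  "UB n xs i = Min ((\<lambda>y. lg (real (wset n xs i y) + \<bar>real (xs i) - real y\<bar>)) ` {1..n})"

end

theory Submission
  imports Defs "HOL-Library.FuncSet"
begin

text \<open>Put \<open>NN k = 2 ^ (2 ^ k)\<close> and call the keys congruent to \<open>k\<close> modulo \<open>NN k\<close> the separators of level \<open>k\<close>.
  A key in whose neighbourhood of radius \<open>NN k\<close> all separators of level \<open>k\<close> lie in layer \<open>k\<close> of a layered AVL tree
  (layers increase downwards) is found in time \<open>O(2 ^ k)\<close>: below layer \<open>k\<close> its search path is confined to an interval
  of length \<open>O(NN k)\<close>, which contains at most one separator of each higher level. An access to \<open>x\<close> finds the least \<open>k\<close>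
  for which layer \<open>k\<close> holds all separators near \<open>x\<close>, and inserts the separators near \<open>x\<close> into every lower layer.
  Each layer ages in phases of \<open>NN k\<close> insertions; three age classes rotate, and an access that inserts into
  a layer (at most five items) evicts ten items of its oldest class, so that layer \<open>k\<close> always has \<open>O(NN k)\<close> items.

  Levels start at about \<open>log log log n\<close>, which costs the additive \<open>O(lg lg n)\<close>. For the amortised bound, the separators
  inserted in a phase of layer \<open>k\<close> are spaced by \<open>NN k\<close> and lie near accesses. The union of the windows of radius \<open>3 * NN k\<close>
  around the accesses grows by at most \<open>6 * NN k + 1\<close> when the unified bound is at least \<open>2 ^ (k - 1)\<close>, and otherwise, since
  some recently accessed key is within distance \<open>NN (k - 1)\<close>, by at most \<open>NN (k - 1)\<close>. So the insertions into layer \<open>k\<close>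
  number \<open>O(e + m / 2 ^ k)\<close> for \<open>e\<close> expensive accesses among \<open>m\<close>; each costs \<open>O(2 ^ k)\<close>, and the sum over
  the levels is \<open>O(UB + lg lg n)\<close> per access.\<close>

section \<open>Adaptive programs on partially visited trees\<close>

text \<open>Moving a key costs time proportional to its search path, so items of layer
  \<open>k\<close> can be moved cheaply only while the separators of level \<open>k + 1\<close>
  around them are cached. This dictates the order of work, from the highest layer touched down to
  \<open>kap\<close>, and the third age class: when a phase of layer \<open>k + 1\<close> ends,
  items inserted just before must not become evictable at once. It works because a phase there lasts
  \<open>NN k ^ 2\<close> insertions, long compared with the three phases that an item of layer
  \<open>k\<close> may live through. The residue is \<open>k\<close>, not \<open>0\<close>, to make
  separators of different levels disjoint: a key then has one status, and work in one layer leaves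
  the others intact. A search path meets layers up to \<open>k\<close> with heights in geometric
  progression, while every cached layer above \<open>k\<close> still adds a constant. There are
  fewer than \<open>top\<close> of these, and \<open>top < 2 ^ k\<close> for
  \<open>kap \<le> k\<close>; this is the reason for the lower cutoff. Accesses have no memory
  besides the node fields. As the \<open>NN k\<close> grow doubly exponentially, the counters of all
  layers take polynomially many values together and fit into one field.\<close>

text \<open>The status \<open>st\<close> of a node is its layer together with its age class; \<open>ht\<close> is its height within the layer, \<open>sm\<close> the set
  of statuses in its subtree, and \<open>gl\<close> gives the current class and the insertion counter of every layer
  (up to date only at the root).\<close>
datatype nd = ND (ky: nat) (st: "nat \<times> nat") (ht: nat) (sm: "(nat \<times> nat) set")
  (gl: "nat \<Rightarrow> nat \<times> nat")

text \<open>A partially known tree; \<open>VH p\<close> stands for the unvisited subtree at path \<open>p\<close> of the tree that is being accessed.\<close>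
datatype vt = VH "bool list" | VL | VN vt nd vt

text \<open>Decision trees: \<open>Ask p f\<close> visits the node at path \<open>p\<close> and continues with its contents and the information which of its
  children are null. An access procedure must depend on the view only, so it reruns the program on the
  visited part until an unvisited node is asked for.\<close>
datatype 'r dt = Ret 'r | Ask "bool list" "nd \<times> bool \<times> bool \<Rightarrow> 'r dt"

fun subt :: "'a tree \<Rightarrow> bool list \<Rightarrow> 'a tree" where
  "subt t [] = t"
| "subt (Node l a r) (b # p) = subt (if b then r else l) p"
| "subt Leaf (b # p) = Leaf"

definition info :: "nd tree \<Rightarrow> bool list \<Rightarrow> nd \<times> bool \<times> bool" where
  "info t p = (case subt t p of Node l a r \<Rightarrow> (a, l = Leaf, r = Leaf) | Leaf \<Rightarrow> undefined)"

primrec bnd :: "'r dt \<Rightarrow> ('r \<Rightarrow> 's dt) \<Rightarrow> 's dt" where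
  "bnd (Ret r) f = f r"
| "bnd (Ask p g) f = Ask p (\<lambda>z. bnd (g z) f)"

primrec asks :: "'r dt \<Rightarrow> nd tree \<Rightarrow> bool list list" where
  "asks (Ret r) t = []"
| "asks (Ask p g) t = p # asks (g (info t p)) t"

primrec res :: "'r dt \<Rightarrow> nd tree \<Rightarrow> 'r" where
  "res (Ret r) t = r"
| "res (Ask p g) t = res (g (info t p)) t"

definition reach :: "bool list set \<Rightarrow> bool list \<Rightarrow> bool" where
  "reach A p \<longleftrightarrow> p = [] \<or> butlast p \<in> A"

primrec vasks :: "'r dt \<Rightarrow> nd tree \<Rightarrow> bool list set \<Rightarrow> bool" where
  "vasks (Ret r) t A = True"
| "vasks (Ask p g) t A = (reach A p \<and> subt t p \<noteq> Leaf \<and> vasks (g (info t p)) t (insert p A))"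

text \<open>A Hoare triple for programs: \<open>Q\<close> receives all paths visited so far, the
  number of questions of \<open>M\<close> and its result. Repeated questions count again, so the
  number bounds the visited nodes from above.\<close>

definition wp :: "nd tree \<Rightarrow> bool list set \<Rightarrow> 'r dt \<Rightarrow> (bool list set \<Rightarrow> nat \<Rightarrow> 'r \<Rightarrow> bool) \<Rightarrow> bool" where
  "wp t A M Q \<longleftrightarrow> vasks M t A \<and> Q (A \<union> set (asks M t)) (length (asks M t)) (res M t)"

lemma asks_bnd [simp]: "asks (bnd M f) t = asks M t @ asks (f (res M t)) t"
  by (induction M) auto

lemma res_bnd [simp]: "res (bnd M f) t = res (f (res M t)) t"
  by (induction M) auto

lemma vasks_bnd [simp]: "vasks (bnd M f) t A \<longleftrightarrow> vasks M t A \<and> vasks (f (res M t)) t (A \<union> set (asks M t))"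
  by (induction M arbitrary: A) (auto simp: Un_assoc)

lemma wp_Ret [simp]: "wp t A (Ret r) Q \<longleftrightarrow> Q A 0 r"
  by (simp add: wp_def)

lemma wp_bnd:
  assumes "wp t A M P"
    and "\<And>B m r. A \<subseteq> B \<Longrightarrow> P B m r \<Longrightarrow> wp t B (f r) (\<lambda>C k s. Q C (m + k) s)"
  shows "wp t A (bnd M f) Q"
  using assms(1) assms(2)[of "A \<union> set (asks M t)" "length (asks M t)" "res M t"]
  unfolding wp_def by (auto simp: Un_assoc)

lemma wp_mono:
  assumes "wp t A M P" and "\<And>B m r. A \<subseteq> B \<Longrightarrow> P B m r \<Longrightarrow> Q B m r"
  shows "wp t A M Q"
  using assms unfolding wp_def by blast

lemma wp_Ask:
  "wp t A (Ask p g) Q \<longleftrightarrow> reach A p \<and> subt t p \<noteq> Leaf \<and>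
     wp t (insert p A) (g (info t p)) (\<lambda>B m r. Q B (Suc m) r)"
  by (auto simp: wp_def)

definition vis :: "nd tree \<Rightarrow> bool list set \<Rightarrow> nat set" where
  "vis t A = (\<lambda>p. ky (fst (info t p))) ` A"

fun denote :: "nd tree \<Rightarrow> vt \<Rightarrow> nd tree" where
  "denote t (VH p) = subt t p"
| "denote t VL = Leaf"
| "denote t (VN l a r) = Node (denote t l) a (denote t r)"

text \<open>Only the key of a new node has to come from a visited node; its other fields are free.
  Together with equal in-order keys this makes the result a legal rearrangement of the visited
  part.\<close>

fun known :: "nd tree \<Rightarrow> bool list set \<Rightarrow> vt \<Rightarrow> bool" where
  "known t A (VH p) = (reach A p \<and> subt t p \<noteq> Leaf)"
| "known t A VL = True"
| "known t A (VN l a r) = (known t A l \<and> known t A r \<and> ky a \<in> vis t A)"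

definition rep :: "nd tree \<Rightarrow> bool list set \<Rightarrow> vt \<Rightarrow> nd tree \<Rightarrow> bool" where
  "rep t A u T \<longleftrightarrow> known t A u \<and> denote t u = T"

lemma vis_mono: "A \<subseteq> B \<Longrightarrow> vis t A \<subseteq> vis t B"
  by (auto simp: vis_def)

lemma known_mono: "known t A u \<Longrightarrow> A \<subseteq> B \<Longrightarrow> known t B u"
  by (induction u) (auto simp: reach_def dest: subsetD[OF vis_mono])

lemma rep_mono: "rep t A u T \<Longrightarrow> A \<subseteq> B \<Longrightarrow> rep t B u T"
  using known_mono by (auto simp: rep_def)

lemma rep_VL [simp]: "rep t A VL T \<longleftrightarrow> T = Leaf"
  by (auto simp: rep_def)

lemma rep_VN: "rep t A (VN l a r) T \<longleftrightarrow> (\<exists>L R. T = Node L a R \<and> rep t A l L \<and> rep t A r R \<and> ky a \<in> vis t A)"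
  by (auto simp: rep_def)

definition opn :: "vt \<Rightarrow> vt dt" where
  "opn u = (case u of VH p \<Rightarrow>
       Ask p (\<lambda>(a, bl, br). Ret (VN (if bl then VL else VH (p @ [False])) a (if br then VL else VH (p @ [True]))))
     | _ \<Rightarrow> Ret u)"

definition rep1 :: "nd tree \<Rightarrow> bool list set \<Rightarrow> vt \<Rightarrow> nd tree \<Rightarrow> bool" where
  "rep1 t A u T \<longleftrightarrow> rep t A u T \<and> (\<forall>p. u \<noteq> VH p)"

lemma rep1_Leaf [simp]: "rep1 t A u Leaf \<longleftrightarrow> u = VL"
  by (cases u) (auto simp: rep1_def rep_def)

lemma rep1_Node: "rep1 t A u (Node L a R) \<longleftrightarrow> (\<exists>l r. u = VN l a r \<and> rep t A l L \<and> rep t A r R \<and> ky a \<in> vis t A)"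
  by (cases u) (auto simp: rep1_def rep_def)

lemma subt_append: "subt t (p @ q) = subt (subt t p) q"
  by (induction t p rule: subt.induct) (auto, metis subt.simps(1,3) list.exhaust)

lemma wp_opn:
  assumes "rep t A u T" and "\<And>B m v. A \<subseteq> B \<Longrightarrow> rep1 t B v T \<Longrightarrow> m \<le> 1 \<Longrightarrow> Q B m v"
  shows "wp t A (opn u) Q"
proof (cases u)
  case (VH p)
  then have s': "subt t p = T" and re: "reach A p" and "T \<noteq> Leaf"
    using assms(1) by (auto simp: rep_def VH)
  then obtain L a R where T: "T = Node L a R" by (cases T) auto
  have s: "subt t p = Node L a R" using s' T by simp
  have "rep1 t (insert p A) (VN (if L = Leaf then VL else VH (p @ [False])) a
           (if R = Leaf then VL else VH (p @ [True]))) T"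
    using s by (auto simp: T rep1_Node rep_def subt_append reach_def vis_def info_def)
  then show ?thesis
    using s re assms(2)[of "insert p A" _ "Suc 0", OF subset_insertI] by (auto simp: opn_def VH wp_Ask info_def)
qed (use assms in \<open>auto simp: opn_def rep1_def\<close>)

section \<open>Realising programs by access procedures\<close>

definition prefix_closed :: "bool list set \<Rightarrow> bool" where
  "prefix_closed A \<longleftrightarrow> (\<forall>p q. p @ q \<in> A \<longrightarrow> p \<in> A)"

definition explored :: "'a tree \<Rightarrow> bool list set \<Rightarrow> bool" where
  "explored t A \<longleftrightarrow> prefix_closed A \<and> finite A \<and> (\<forall>p\<in>A. subt t p \<noteq> Leaf)"

definition child_paths :: "bool \<Rightarrow> bool list set \<Rightarrow> bool list set" where
  "child_paths b A = {p. b # p \<in> A}"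

fun view :: "'a tree \<Rightarrow> bool list set \<Rightarrow> 'a ptree" where
  "view Leaf A = PLeaf"
| "view (Node l a r) A = (if [] \<in> A then PNode (view l (child_paths False A)) a (view r (child_paths True A)) else Hole)"

fun subview :: "'a ptree \<Rightarrow> bool list \<Rightarrow> 'a ptree" where
  "subview v [] = v"
| "subview (PNode l a r) (b # p) = subview (if b then r else l) p"
| "subview _ (b # p) = Hole"

lemma prefix_closed_child_paths: "prefix_closed A \<Longrightarrow> prefix_closed (child_paths b A)"
  unfolding prefix_closed_def child_paths_def by (metis append_Cons mem_Collect_eq)

lemma finite_child_paths: "finite A \<Longrightarrow> finite (child_paths b A)"
  unfolding child_paths_def by (rule finite_imageD[where f = "(#) b"]) (auto intro: finite_subset)

lemma explored_child_paths: "explored (Node l a r) A \<Longrightarrow> explored (if b then r else l) (child_paths b A)"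
  using prefix_closed_child_paths finite_child_paths by (fastforce simp: explored_def child_paths_def)

lemma prefix_closed_Nil: "prefix_closed A \<Longrightarrow> [] \<notin> A \<Longrightarrow> A = {}"
  by (auto simp: prefix_closed_def) (metis append_Nil ex_in_conv)

lemma split_child_paths:
  assumes "[] \<in> A" shows "A = insert [] ((#) False ` child_paths False A \<union> (#) True ` child_paths True A)"
proof -
  have "p \<in> insert [] ((#) False ` child_paths False A \<union> (#) True ` child_paths True A)" if "p \<in> A" for p
  proof (cases p)
    case (Cons b q) then show ?thesis using that by (cases b) (auto simp: child_paths_def)
  qed auto
  then show ?thesis using assms by (auto simp: child_paths_def)
qed

lemma card_child_paths:
  assumes "[] \<in> A" "finite A" shows "card A = Suc (card (child_paths False A) + card (child_paths True A))"
proof -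
  have "card A = Suc (card ((#) False ` child_paths False A \<union> (#) True ` child_paths True A))"
    by (subst split_child_paths[OF assms(1)], subst card_insert_disjoint) (auto simp: finite_child_paths assms)
  also have "card ((#) False ` child_paths False A \<union> (#) True ` child_paths True A) = card (child_paths False A) + card (child_paths True A)"
    by (subst card_Un_disjoint) (auto simp: finite_child_paths assms card_image)
  finally show ?thesis .
qed

lemma length_vnodes_view: "explored t A \<Longrightarrow> length (vnodes (view t A)) = card A"
proof (induction t arbitrary: A)
  case Leaf
  then have "A = {}" by (auto simp: explored_def) (metis subt.simps(1,3) list.exhaust)
  then show ?case by simp
next
  case (Node l a r)
  show ?case
  proof (cases "[] \<in> A")
    case True
    then show ?thesis using Node.IH(1)[of "child_paths False A"] Node.IH(2)[of "child_paths True A"]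
        explored_child_paths[OF Node.prems, of False] explored_child_paths[OF Node.prems, of True] card_child_paths[of A] Node.prems
      by (auto simp: explored_def)
  next
    case False
    then have "A = {}" using Node.prems prefix_closed_Nil by (auto simp: explored_def)
    then show ?thesis by simp
  qed
qed

lemma length_vnodes_view_le: "length (vnodes (view t A)) \<le> size t"
  by (induction t A rule: view.induct) auto

lemma expand_view:
  assumes "explored t A" "reach A p" "p \<notin> A" "subt t p \<noteq> Leaf"
  shows "expand t (view t A) p = Some (view t (insert p A))"
  using assms
proof (induction p arbitrary: t A)
  case Nil
  then obtain l a r where t: "t = Node l a r" by (cases t) auto
  have "A = {}" using Nil prefix_closed_Nil by (auto simp: explored_def)
  moreover have "view s {} = stub s" for s :: "'a tree" by (cases s) auto
  ultimately show ?case by (simp add: t child_paths_def)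
next
  case (Cons b p)
  then obtain l a r where t: "t = Node l a r" by (cases t) auto
  have "prefix_closed A" using Cons.prems by (simp add: explored_def)
  moreover have "butlast (b # p) \<in> A" using Cons.prems by (simp add: reach_def)
  ultimately have e: "[] \<in> A" unfolding prefix_closed_def by (metis append_Nil)
  have re: "reach (child_paths b A) p"
    using Cons.prems by (auto simp: reach_def child_paths_def split: if_splits)
  have "expand (if b then r else l) (view (if b then r else l) (child_paths b A)) p
      = Some (view (if b then r else l) (insert p (child_paths b A)))"
    by (rule Cons.IH) (use Cons.prems re explored_child_paths[of l a r A b] in \<open>auto simp: t child_paths_def\<close>)
  moreover have "insert p (child_paths b A) = child_paths b (insert (b # p) A)"
      "child_paths (\<not> b) (insert (b # p) A) = child_paths (\<not> b) A"
    by (auto simp: child_paths_def)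
  ultimately show ?case using e by (cases b) (auto simp: t)
qed

lemma explored_insert:
  assumes "explored t A" "reach A p" "subt t p \<noteq> Leaf" shows "explored t (insert p A)"
proof -
  have "q \<in> insert p A" if "q @ r = p" for q r
  proof (cases r rule: rev_exhaust)
    case (snoc r' b)
    then have "p = (q @ r') @ [b]" using that by simp
    then have "q @ r' \<in> A" using assms(2) by (auto simp: reach_def butlast_append)
    then show ?thesis using assms(1) by (auto simp: explored_def prefix_closed_def)
  qed (use that in auto)
  then show ?thesis using assms unfolding explored_def prefix_closed_def by blast
qed

lemma subview_view:
  assumes "prefix_closed A" "reach A p" "subt t p \<noteq> Leaf"
  shows "subview (view t A) p = view (subt t p) {q. p @ q \<in> A}"
  using assms
proof (induction p arbitrary: t A)
  case (Cons b p)
  then obtain l a r where t: "t = Node l a r" by (cases t) auto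
  have "butlast (b # p) \<in> A" using Cons.prems by (simp add: reach_def)
  then have e: "[] \<in> A" using Cons.prems(1) unfolding prefix_closed_def by (metis append_Nil)
  have re: "reach (child_paths b A) p"
    using Cons.prems by (auto simp: reach_def child_paths_def split: if_splits)
  have "subview (view (if b then r else l) (child_paths b A)) p = view (subt (if b then r else l) p) {q. p @ q \<in> child_paths b A}"
    by (rule Cons.IH) (use Cons.prems re prefix_closed_child_paths[of A b] in \<open>auto simp: t\<close>)
  then show ?case using e by (cases b) (auto simp: t child_paths_def)
qed auto

text \<open>\<open>fill\<close> attaches the hanging subtrees from left to right, so input and
  output are compared through in-order token lists: \<open>Inl\<close> for an unvisited subtree,
  \<open>Inr\<close> for a visited key.\<close>

fun tokv :: "(nat \<times> 'b) tree \<Rightarrow> (nat \<times> 'b) ptree \<Rightarrow> ((nat \<times> 'b) tree + nat) list" where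
  "tokv t Hole = [Inl t]"
| "tokv t PLeaf = []"
| "tokv (Node l a r) (PNode vl b vr) = tokv l vl @ [Inr (fst a)] @ tokv r vr"
| "tokv Leaf (PNode vl b vr) = []"

definition texp :: "(nat \<times> 'b) tree + nat \<Rightarrow> nat list" where
  "texp z = (case z of Inl h \<Rightarrow> map fst (inorder h) | Inr k \<Rightarrow> [k])"

definition thole :: "(nat \<times> 'b) tree + nat \<Rightarrow> (nat \<times> 'b) tree list" where
  "thole z = (case z of Inl h \<Rightarrow> [h] | Inr k \<Rightarrow> [])"

lemma holes_tokv: "holes t v = concat (map thole (tokv t v))"
  by (induction t v rule: tokv.induct) (auto simp: thole_def)

lemma texp_tokv: "concat (map texp (tokv t (view t A))) = map fst (inorder t)"
  by (induction t A rule: view.induct) (auto simp: texp_def)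

lemma tokv_nonempty: "z \<in> set (tokv t (view t A)) \<Longrightarrow> texp z \<noteq> []"
  by (induction t A rule: view.induct) (auto simp: texp_def split: if_splits)

lemma nholes_view: "nholes (view t A) = length (holes t (view t A))"
  by (induction t A rule: view.induct) auto

lemma fill_view: "fill (view t A) (holes t (view t A) @ hs) = (t, hs)"
  by (induction t A arbitrary: hs rule: view.induct) auto

lemma tokv_subview:
  assumes "prefix_closed A" "reach A p" "subt t p \<noteq> Leaf"
  shows "set (tokv (subt t p) (subview (view t A) p)) \<subseteq> set (tokv t (view t A))"
  using assms
proof (induction p arbitrary: t A)
  case (Cons b p)
  then obtain l a r where t: "t = Node l a r" by (cases t) auto
  have "butlast (b # p) \<in> A" using Cons.prems by (simp add: reach_def)
  then have e: "[] \<in> A" using Cons.prems(1) unfolding prefix_closed_def by (metis append_Nil)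
  have re: "reach (child_paths b A) p"
    using Cons.prems by (auto simp: reach_def child_paths_def split: if_splits)
  have "set (tokv (subt (if b then r else l) p) (subview (view (if b then r else l) (child_paths b A)) p))
      \<subseteq> set (tokv (if b then r else l) (view (if b then r else l) (child_paths b A)))"
    by (rule Cons.IH) (use Cons.prems re prefix_closed_child_paths[of A b] in \<open>auto simp: t\<close>)
  then show ?case using e by (cases b) (auto simp: t)
qed auto

lemma tokv_visited:
  assumes "explored t A" "p \<in> A" "subt t p = Node l a r"
  shows "Inr (fst a) \<in> set (tokv t (view t A))"
proof -
  have "reach A p" using assms(1,2) unfolding explored_def prefix_closed_def reach_def
    by (metis append_butlast_last_id)
  then have "set (tokv (subt t p) (subview (view t A) p)) \<subseteq> set (tokv t (view t A))"
      "subview (view t A) p = view (subt t p) {q. p @ q \<in> A}"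
    using assms tokv_subview[of A p t] subview_view[of A p t] by (auto simp: explored_def)
  then show ?thesis using assms by auto
qed

text \<open>The first key of the common expansion identifies the first token, because expansions are
  nonempty and, by distinctness, a key occurs in one token of \<open>vs\<close> only. So an output
  built from tokens of the input with the same keys in order lists the hanging subtrees in their old
  order.\<close>

lemma tokens_unique:
  assumes "concat (map f us) = concat (map f vs)" "distinct (concat (map f vs))"
    "set us \<subseteq> set vs" "\<And>x. x \<in> set vs \<Longrightarrow> f x \<noteq> []"
  shows "us = vs"
  using assms
proof (induction us arbitrary: vs)
  case Nil
  then show ?case by (cases vs) auto
next
  case (Cons u us)
  then obtain v vs' where vs: "vs = v # vs'" by (cases vs) auto
  obtain k ks where k: "f u = k # ks" using Cons.prems(3,4) by (cases "f u") auto
  obtain k' ks' where k': "f v = k' # ks'" using Cons.prems(4) vs by (cases "f v") auto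
  have "k = k'" using Cons.prems(1) k k' vs by simp
  have uv: "u = v"
  proof (rule ccontr)
    assume "u \<noteq> v"
    then have "u \<in> set vs'" using Cons.prems(3) vs by auto
    then have "k \<in> set (concat (map f vs'))" using k by (auto intro!: bexI[of _ u])
    then show False using Cons.prems(2) vs k' \<open>k = k'\<close> by auto
  qed
  have nin: "v \<notin> set us"
  proof
    assume "v \<in> set us"
    then have "k \<in> set (concat (map f us))" using k' \<open>k = k'\<close> by (auto intro!: bexI[of _ v])
    moreover have "concat (map f us) = concat (map f vs')" using Cons.prems(1) uv vs by auto
    ultimately show False using Cons.prems(2) vs k' \<open>k = k'\<close> by auto
  qed
  have "us = vs'" by (rule Cons.IH) (use Cons.prems nin uv vs in auto)
  then show ?case using uv vs by simp
qed

locale encoded =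
  fixes enc :: "nd \<Rightarrow> node" and dcd :: "node \<Rightarrow> nd" and okn :: "nd \<Rightarrow> bool"
  assumes dcd_enc: "okn a \<Longrightarrow> dcd (enc a) = a" and fst_enc: "fst (enc a) = ky a"
begin

fun ou :: "node ptree \<Rightarrow> vt \<Rightarrow> node ptree" where
  "ou v (VH p) = subview v p"
| "ou v VL = PLeaf"
| "ou v (VN l a r) = PNode (ou v l) (enc a) (ou v r)"

primrec dec_of :: "vt dt \<Rightarrow> node ptree \<Rightarrow> bool list + node ptree" where
  "dec_of (Ret u) v = Inr (ou v u)"
| "dec_of (Ask p g) v = (case subview v p of PNode l a r \<Rightarrow> dec_of (g (dcd a, l = PLeaf, r = PLeaf)) v
      | _ \<Rightarrow> Inl p)"

definition real_tree :: "nd tree \<Rightarrow> node tree" where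
  "real_tree t = map_tree enc t"

lemma subt_real: "subt (real_tree t) p = real_tree (subt t p)"
  unfolding real_tree_def by (induction t p rule: subt.induct) auto

lemma real_Leaf [simp]: "real_tree t = Leaf \<longleftrightarrow> t = Leaf"
  by (cases t) (auto simp: real_tree_def)

lemma explored_real: "explored (real_tree t) A \<longleftrightarrow> explored t A"
  by (simp add: explored_def subt_real)

lemma view_PLeaf [simp]: "view t A = PLeaf \<longleftrightarrow> t = Leaf"
  by (cases t) auto

lemma okn_subt: "\<forall>a\<in>set_tree t. okn a \<Longrightarrow> subt t p = Node l a r \<Longrightarrow> okn a"
  by (induction t p rule: subt.induct) (auto split: if_splits)

text \<open>Rerunning the program on the view reproduces its run on the tree up to the first
  question outside \<open>B\<close>. As \<open>A\<close>, the set of earlier questions, lies in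
  \<open>B\<close>, that question is reachable from \<open>B\<close>.\<close>

lemma dec_of_view:
  assumes "explored t B" "vasks M t A" "A \<subseteq> B" "\<forall>a\<in>set_tree t. okn a"
  shows "(set (asks M t) \<subseteq> B \<and> dec_of M (view (real_tree t) B) = Inr (ou (view (real_tree t) B) (res M t)))
    \<or> (\<exists>p\<in>set (asks M t). p \<notin> B \<and> reach B p \<and> subt t p \<noteq> Leaf \<and> dec_of M (view (real_tree t) B) = Inl p)"
  using assms
proof (induction M arbitrary: A)
  case (Ret r)
  then show ?case by simp
next
  case (Ask p g)
  obtain l a r where s: "subt t p = Node l a r" using Ask.prems by (cases "subt t p") auto
  have re: "reach B p" using Ask.prems by (auto simp: reach_def)
  have e: "subview (view (real_tree t) B) p = view (real_tree (Node l a r)) {q. p @ q \<in> B}"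
    using subview_view[of B p "real_tree t"] re Ask.prems s by (simp add: explored_def subt_real)
  show ?case
  proof (cases "p \<in> B")
    case True
    have "okn a" using okn_subt Ask.prems s by blast
    then have "dec_of (Ask p g) (view (real_tree t) B) = dec_of (g (info t p)) (view (real_tree t) B)"
      using e True s by (simp add: info_def dcd_enc real_tree_def[of "Node l a r"] flip: real_tree_def)
    moreover have "(set (asks (g (info t p)) t) \<subseteq> B \<and> dec_of (g (info t p)) (view (real_tree t) B) = Inr (ou (view (real_tree t) B) (res (g (info t p)) t)))
    \<or> (\<exists>q\<in>set (asks (g (info t p)) t). q \<notin> B \<and> reach B q \<and> subt t q \<noteq> Leaf \<and> dec_of (g (info t p)) (view (real_tree t) B) = Inl q)"
      by (rule Ask.IH[OF rangeI Ask.prems(1), of _ "insert p A"]) (use Ask.prems True in auto)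
    ultimately show ?thesis using True by (auto simp del: dec_of.simps)
  next
    case False
    then show ?thesis using e s re by (simp add: real_tree_def)
  qed
qed

text \<open>Each \<open>Inl\<close> answer moves one more path of \<open>insert [] C\<close> into
  \<open>B\<close>, so the gap in cardinality bounds the fuel. The root belongs to the final view
  even if the program asks nothing, since an access starts there.\<close>

lemma walk_dec_of:
  assumes "explored t B" "vasks M t A" "A \<subseteq> B" "\<forall>a\<in>set_tree t. okn a"
    and "C = A \<union> set (asks M t)" "B \<subseteq> insert [] C" "finite C"
    and "card (insert [] C) < card B + k" "dec x = dec_of M" "[] \<in> B"
  shows "walk dec (real_tree t) x k (view (real_tree t) B)
    = Some (view (real_tree t) (insert [] C), ou (view (real_tree t) (insert [] C)) (res M t))"
  using assms(1,3,6,8,10)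
proof (induction k arbitrary: B)
  case 0
  then show ?case using assms card_mono[of "insert [] C" B] by auto
next
  case (Suc k)
  consider (a) "set (asks M t) \<subseteq> B" "dec_of M (view (real_tree t) B) = Inr (ou (view (real_tree t) B) (res M t))"
    | (b) p where "p\<in>set (asks M t)" "p \<notin> B" "reach B p" "subt t p \<noteq> Leaf" "dec_of M (view (real_tree t) B) = Inl p"
    using dec_of_view[OF Suc.prems(1) assms(2) Suc.prems(2) assms(4)] by blast
  then show ?case
  proof cases
    case a
    then have "B = insert [] C" using Suc.prems assms by auto
    then show ?thesis using a assms by simp
  next
    case b
    have "expand (real_tree t) (view (real_tree t) B) p = Some (view (real_tree t) (insert p B))"
      by (rule expand_view) (use b Suc.prems in \<open>auto simp: explored_real subt_real\<close>)
    moreover have "walk dec (real_tree t) x k (view (real_tree t) (insert p B))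
      = Some (view (real_tree t) (insert [] C), ou (view (real_tree t) (insert [] C)) (res M t))"
      by (rule Suc.IH)
        (use b Suc.prems explored_insert[OF Suc.prems(1) b(3,4)] assms(5) in \<open>auto simp: explored_def\<close>)
    ultimately show ?thesis using b assms by simp
  qed
qed

fun toku :: "node tree \<Rightarrow> node ptree \<Rightarrow> vt \<Rightarrow> (node tree + nat) list" where
  "toku t v (VH p) = tokv (subt t p) (subview v p)"
| "toku t v VL = []"
| "toku t v (VN l a r) = toku t v l @ [Inr (ky a)] @ toku t v r"

lemma known_toku:
  assumes "explored t B" "known t B u"
  defines "v \<equiv> view (real_tree t) B"
  shows "set (toku (real_tree t) v u) \<subseteq> set (tokv (real_tree t) v) \<and>
    concat (map texp (toku (real_tree t) v u)) = map fst (inorder (real_tree (denote t u))) \<and>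
    (\<forall>hs. fill (ou v u) (concat (map thole (toku (real_tree t) v u)) @ hs) = (real_tree (denote t u), hs)) \<and>
    nholes (ou v u) = length (concat (map thole (toku (real_tree t) v u)))"
  using assms(2)
proof (induction u)
  case (VH p)
  have "subview v p = view (subt (real_tree t) p) {q. p @ q \<in> B}"
    using subview_view[of B p "real_tree t"] VH assms(1) by (simp add: explored_def subt_real v_def)
  then show ?case
    using tokv_subview[of B p "real_tree t"] VH assms(1)
      texp_tokv[of "subt (real_tree t) p"] fill_view[of "subt (real_tree t) p"] nholes_view[of "subt (real_tree t) p"]
    by (simp add: v_def explored_def subt_real flip: holes_tokv)
next
  case VL
  show ?case by (simp add: real_tree_def)
next
  case (VN l a r)
  obtain p l' b r' where p: "p \<in> B" "subt t p = Node l' b r'" "ky b = ky a"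
  proof -
    obtain p where "p \<in> B" "ky (fst (info t p)) = ky a" using VN.prems by (auto simp: vis_def)
    moreover from this obtain l' b r' where "subt t p = Node l' b r'" using assms(1) by (cases "subt t p") (auto simp: explored_def)
    ultimately show thesis using that by (auto simp: info_def)
  qed
  then have "Inr (ky a) \<in> set (tokv (real_tree t) v)"
    using tokv_visited[of "real_tree t" B p "real_tree l'" "enc b" "real_tree r'"] assms(1) p
    by (simp add: explored_real subt_real v_def fst_enc) (simp add: real_tree_def)
  then show ?case
    using VN by (auto simp: texp_def thole_def real_tree_def fst_enc)
qed

lemma vasks_explored:
  assumes "explored t A" "vasks M t A" shows "explored t (A \<union> set (asks M t))"
  using assms
proof (induction M arbitrary: A)
  case (Ask p g)
  have "explored t (insert p A \<union> set (asks (g (info t p)) t))"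
    by (rule Ask.IH) (use Ask.prems explored_insert in auto)
  then show ?case by simp
qed simp

text \<open>The bridge from programs to the tree model. The extra visit in \<open>Suc c\<close> is
  the root, should the program not ask for it; the fuel suffices because a view has at most
  \<open>size t\<close> nodes.\<close>

theorem access_dec_of:
  assumes "wp t {} M (\<lambda>A m u. m \<le> c \<and> rep t A u T \<and> x \<in> vis t A)"
    and "map ky (inorder T) = map ky (inorder t)" "distinct (map ky (inorder t))"
    and "\<forall>a\<in>set_tree t. okn a" "t \<noteq> Leaf" "size t \<le> n" "dec x = dec_of M"
  obtains v out where "access dec n (real_tree t) x = Some (v, out)"
    "x \<in> fst ` set (vnodes v)" "nholes out = nholes v" "new_tree (real_tree t) v out = real_tree T"
    "length (vnodes v) \<le> Suc c"
proof -
  define C where "C = set (asks M t)"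
  define B where "B = insert [] C"
  define u where "u = res M t"
  have wpM: "vasks M t {}" "length (asks M t) \<le> c" "rep t C u T" "x \<in> vis t C"
    using assms(1) by (auto simp: wp_def C_def u_def)
  have v0: "explored t {[]}" using \<open>t \<noteq> Leaf\<close> by (auto simp: explored_def prefix_closed_def)
  have v1: "explored t C" using vasks_explored[of t "{}" M] wpM by (auto simp: C_def explored_def prefix_closed_def)
  have vB: "explored t B" using explored_insert[OF v1, of "[]"] \<open>t \<noteq> Leaf\<close> by (simp add: B_def reach_def)
  define v where "v = view (real_tree t) B"
  have cB: "length (vnodes v) = card B" using length_vnodes_view[of "real_tree t" B] vB by (simp add: explored_real v_def)
  have "card B \<le> n" using cB length_vnodes_view_le[of "real_tree t" B] assms by (simp add: v_def real_tree_def)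
  obtain l a r where t: "t = Node l a r" using \<open>t \<noteq> Leaf\<close> by (cases t) auto
  have "expand (real_tree t) Hole [] = Some (view (real_tree t) {[]})"
    using expand_view[of "real_tree t" "{}" "[]"] t by (simp add: explored_def prefix_closed_def reach_def real_tree_def)
  moreover have "walk dec (real_tree t) x (Suc n) (view (real_tree t) {[]})
     = Some (view (real_tree t) (insert [] C), ou (view (real_tree t) (insert [] C)) (res M t))"
    by (rule walk_dec_of[where A = "{}"])
      (use v0 wpM assms \<open>card B \<le> n\<close> in \<open>auto simp: C_def B_def\<close>)
  ultimately have acc: "access dec n (real_tree t) x = Some (v, ou v u)"
    by (simp add: access_def v_def B_def u_def)
  have known: "known t B u" "denote t u = T" using wpM known_mono[of t C u B] by (auto simp: rep_def B_def)
  note K0 = known_toku[OF vB known(1), folded v_def]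
  note K = conjunct1[OF K0] conjunct1[OF conjunct2[OF K0]] spec[OF conjunct1[OF conjunct2[OF conjunct2[OF K0]]]]
    conjunct2[OF conjunct2[OF conjunct2[OF K0]]]
  \<comment> \<open>The hanging subtrees keep their left-to-right order, so filling the output gives
    back exactly \<open>T\<close>.\<close>
  have eq: "toku (real_tree t) v u = tokv (real_tree t) v"
  proof (rule tokens_unique)
    have m: "map fst (inorder (real_tree s)) = map ky (inorder s)" for s
      by (induction s) (auto simp: real_tree_def fst_enc)
    show "concat (map texp (toku (real_tree t) v u)) = concat (map texp (tokv (real_tree t) v))"
      using K(2) texp_tokv[of "real_tree t" B] assms(2) known by (simp add: v_def m)
    show "distinct (concat (map texp (tokv (real_tree t) v)))"
      using texp_tokv[of "real_tree t" B] assms(3) by (simp add: v_def m)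
  qed (use K(1) tokv_nonempty in \<open>auto simp: v_def\<close>)
  have "x \<in> fst ` set (vnodes v)"
  proof -
    obtain p where p: "p \<in> B" "x = ky (fst (info t p))" using wpM(4) by (auto simp: vis_def B_def)
    then obtain l' b r' where s: "subt t p = Node l' b r'" using vB by (cases "subt t p") (auto simp: explored_def)
    have vn: "Inr k \<in> set (tokv s w) \<Longrightarrow> \<exists>B. w = view s B \<Longrightarrow> k \<in> fst ` set (vnodes w)" for k and s :: "node tree" and w
      by (induction s w rule: tokv.induct) (auto split: if_splits elim!: view.elims)
    have "Inr (fst (enc b)) \<in> set (tokv (real_tree t) v)"
      using tokv_visited[of "real_tree t" B p "real_tree l'" "enc b" "real_tree r'"] vB p s
      by (simp add: explored_real subt_real v_def) (simp add: real_tree_def)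
    then have "fst (enc b) \<in> fst ` set (vnodes v)" using vn v_def by blast
    then show ?thesis using p s by (simp add: info_def fst_enc)
  qed
  moreover have "nholes (ou v u) = nholes v"
    using K(4) eq nholes_view[of "real_tree t" B] by (simp add: v_def flip: holes_tokv)
  moreover have "new_tree (real_tree t) v (ou v u) = real_tree T"
    using K(3)[of "[]"] eq known by (simp add: new_tree_def flip: holes_tokv)
  moreover have "card B \<le> Suc c"
  proof -
    have "card C \<le> c" using wpM(2) card_length[of "asks M t"] by (simp add: C_def)
    then show ?thesis unfolding B_def using card_insert_le_m1[of "Suc c" C "[]"] by (simp add: card_insert_if C_def)
  qed
  ultimately show thesis using that acc cB by simp
qed

end

section \<open>Layered height-balanced trees\<close>

abbreviation ly :: "nd \<Rightarrow> nat" where "ly a \<equiv> fst (st a)"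

fun lh :: "nat \<Rightarrow> nd tree \<Rightarrow> nat" where
  "lh k Leaf = 0"
| "lh k (Node l a r) = (if ly a = k then ht a else 0)"

fun ge :: "nat \<Rightarrow> nd tree \<Rightarrow> bool" where
  "ge k Leaf = True"
| "ge k (Node l a r) = (k \<le> ly a)"

fun sms :: "nd tree \<Rightarrow> (nat \<times> nat) set" where
  "sms Leaf = {}"
| "sms (Node l a r) = sm a"

text \<open>Every maximal connected set of nodes of one layer is an AVL tree of its own:
  \<open>ht\<close> counts inside it, and children in deeper layers have height \<open>0\<close>
  there.\<close>

fun wf :: "(nat \<Rightarrow> nat \<times> nat) set \<Rightarrow> nd tree \<Rightarrow> bool" where
  "wf G Leaf = True"
| "wf G (Node l a r) = (wf G l \<and> wf G r \<and> ge (ly a) l \<and> ge (ly a) r \<and>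
     lh (ly a) l \<le> lh (ly a) r + 1 \<and> lh (ly a) r \<le> lh (ly a) l + 1 \<and>
     ht a = 1 + max (lh (ly a) l) (lh (ly a) r) \<and> sm a = insert (st a) (sms l \<union> sms r) \<and> gl a \<in> G)"

definition ks :: "nd tree \<Rightarrow> (nat \<times> nat \<times> nat) list" where
  "ks T = map (\<lambda>a. (ky a, st a)) (inorder T)"

lemma ks_simps [simp]: "ks Leaf = []" "ks (Node l a r) = ks l @ (ky a, st a) # ks r"
  by (auto simp: ks_def)

lemma sms_ks: "wf G T \<Longrightarrow> sms T = snd ` set (ks T)"
  by (induction T) auto

lemma ge_mono: "ge k T \<Longrightarrow> j \<le> k \<Longrightarrow> ge j T"
  by (cases T) auto

lemma lh_ge: "ge (Suc k) T \<Longrightarrow> lh k T = 0"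
  by (cases T) auto

lemma lh_ge_less: "ge j T \<Longrightarrow> k < j \<Longrightarrow> lh k T = 0"
  by (cases T) auto

lemma lh_le_size: "wf G T \<Longrightarrow> lh k T \<le> size T"
proof (induction T arbitrary: k)
  case (Node l a r)
  then have "lh (ly a) l \<le> size l" "lh (ly a) r \<le> size r" by auto
  then show ?case using Node.prems by auto
qed simp

definition okT :: "nd tree \<Rightarrow> (nat \<Rightarrow> nat \<times> nat) set \<Rightarrow> bool list set \<Rightarrow> vt \<Rightarrow> nd tree \<Rightarrow> bool" where
  "okT t G A u T \<longleftrightarrow> rep t A u T \<and> wf G T"

lemma okT_mono: "okT t G A u T \<Longrightarrow> A \<subseteq> B \<Longrightarrow> okT t G B u T"
  using rep_mono by (auto simp: okT_def)

lemma okT_rep: "okT t G A u T \<Longrightarrow> A \<subseteq> B \<Longrightarrow> rep t B u T"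
  using rep_mono by (auto simp: okT_def)

lemma vis_monoD: "y \<in> vis t A \<Longrightarrow> A \<subseteq> B \<Longrightarrow> y \<in> vis t B"
  using vis_mono by blast

fun vlh :: "nat \<Rightarrow> vt \<Rightarrow> nat" where
  "vlh k (VN l a r) = (if ly a = k then ht a else 0)"
| "vlh k _ = 0"

fun vsm :: "vt \<Rightarrow> (nat \<times> nat) set" where
  "vsm (VN l a r) = sm a"
| "vsm _ = {}"

lemma rep1_vlh: "rep1 t A u T \<Longrightarrow> vlh k u = lh k T"
  by (cases T) (auto simp: rep1_Node)

lemma rep1_vsm: "rep1 t A u T \<Longrightarrow> vsm u = sms T"
  by (cases T) (auto simp: rep1_Node)

lemma rep1_rep: "rep1 t A u T \<Longrightarrow> rep t A u T"
  by (simp add: rep1_def)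

lemma wp_opn1: "rep t A u T \<Longrightarrow> wp t A (opn u) (\<lambda>B m v. m \<le> 1 \<and> rep1 t B v T)"
  by (rule wp_opn) auto

lemma rep1_mono: "rep1 t A u T \<Longrightarrow> A \<subseteq> B \<Longrightarrow> rep1 t B u T"
  using rep_mono by (auto simp: rep1_def)

section \<open>Rebalancing and joining within a layer\<close>

definition mk :: "vt \<Rightarrow> nd \<Rightarrow> vt \<Rightarrow> vt dt" where
  "mk l a r = bnd (opn l) (\<lambda>l. bnd (opn r) (\<lambda>r.
     Ret (VN l (ND (ky a) (st a) (1 + max (vlh (ly a) l) (vlh (ly a) r)) (insert (st a) (vsm l \<union> vsm r)) (gl a)) r)))"

lemma wp_mk:
  assumes "okT t G A l L" "okT t G A r R" "ky a \<in> vis t A" "gl a \<in> G" "ge (ly a) L" "ge (ly a) R"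
    "lh (ly a) L \<le> lh (ly a) R + 1" "lh (ly a) R \<le> lh (ly a) L + 1"
  shows "wp t A (mk l a r) (\<lambda>B n u. n \<le> 2 \<and> (\<exists>T. okT t G B u T \<and> ks T = ks L @ (ky a, st a) # ks R
    \<and> ge (ly a) T \<and> lh (ly a) T = 1 + max (lh (ly a) L) (lh (ly a) R)))"
  unfolding mk_def
proof (rule wp_bnd[OF wp_opn1[OF okT_rep[OF assms(1) order_refl]]], goal_cases)
 case (1 B m l') note c1 = 1
  show ?case
  proof (rule wp_bnd[OF wp_opn1[OF okT_rep[OF assms(2) c1(1)]]], goal_cases)
 case (1 C m' r') note c = 1
    let ?a = "ND (ky a) (st a) (1 + max (vlh (ly a) l') (vlh (ly a) r')) (insert (st a) (vsm l' \<union> vsm r')) (gl a)"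
    have "rep1 t C l' L" using c1 c rep1_mono by blast
    moreover have "ky a \<in> vis t C" using assms c1 c vis_monoD by blast
    ultimately have "okT t G C (VN l' ?a r') (Node L ?a R)"
      using c assms by (auto simp: okT_def rep_VN rep1_rep rep1_vlh rep1_vsm)
    then show ?case using c1 c assms rep1_vlh[OF \<open>rep1 t C l' L\<close>] rep1_vlh[of t C r' R]
      by (auto intro!: exI[of _ "Node L ?a R"])
  qed
qed

text \<open>The flag \<open>d\<close> is an orientation: \<open>app\<close>, \<open>mkd\<close> and
  \<open>vin\<close> are mirrored when it is false, so symmetric rotations are verified
  once.\<close>

definition app :: "bool \<Rightarrow> 'a list \<Rightarrow> 'a list \<Rightarrow> 'a list" where
  "app d xs ys = (if d then xs @ ys else ys @ xs)"

lemma app_assoc [simp]: "app d (app d xs ys) zs = app d xs (app d ys zs)"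
  by (simp add: app_def)

definition mkd :: "bool \<Rightarrow> vt \<Rightarrow> nd \<Rightarrow> vt \<Rightarrow> vt dt" where
  "mkd d l a r = (if d then mk l a r else mk r a l)"

definition key :: "nd \<Rightarrow> nat \<times> nat \<times> nat" where
  "key a = (ky a, st a)"

lemma wp_mkd:
  assumes "okT t G A l L" "okT t G A r R" "ky a \<in> vis t A" "gl a \<in> G" "ge (ly a) L" "ge (ly a) R"
    "lh (ly a) L \<le> lh (ly a) R + 1" "lh (ly a) R \<le> lh (ly a) L + 1"
  shows "wp t A (mkd d l a r) (\<lambda>B n u. n \<le> 2 \<and> (\<exists>T. okT t G B u T \<and> ks T = app d (ks L) (app d [key a] (ks R))
    \<and> ge (ly a) T \<and> lh (ly a) T = 1 + max (lh (ly a) L) (lh (ly a) R)))"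
proof (cases d)
  case True
  then show ?thesis using wp_mk[OF assms] by (simp add: mkd_def app_def key_def)
next
  case False
  then show ?thesis using wp_mk[OF assms(2,1,3,4,6,5,8,7)] by (simp add: mkd_def app_def key_def max.commute)
qed

definition vin :: "bool \<Rightarrow> vt \<Rightarrow> vt" where
  "vin d u = (case u of VN x c y \<Rightarrow> if d then x else y | _ \<Rightarrow> VL)"

definition vrt :: "vt \<Rightarrow> nd" where
  "vrt u = (case u of VN x c y \<Rightarrow> c | _ \<Rightarrow> undefined)"

text \<open>Rebalancing when the subtree \<open>m\<close> may be too high by one; the flag \<open>d\<close> tells whether \<open>m\<close> is the
  right (otherwise the left) subtree.\<close>
definition bal :: "bool \<Rightarrow> vt \<Rightarrow> nd \<Rightarrow> vt \<Rightarrow> vt dt" where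
  "bal d l b m = bnd (opn l) (\<lambda>l. bnd (opn m) (\<lambda>m.
     if vlh (ly b) m \<le> vlh (ly b) l + 1 then mkd d l b m else
     bnd (opn (vin d m)) (\<lambda>p. bnd (opn (vin (\<not> d) m)) (\<lambda>q.
       if vlh (ly b) p \<le> vlh (ly b) q then bnd (mkd d l b p) (\<lambda>w. mkd d w (vrt m) q)
       else bnd (mkd d l b (vin d p)) (\<lambda>w. bnd (mkd d (vin (\<not> d) p) (vrt m) q) (\<lambda>z. mkd d w (vrt p) z))))))"

text \<open>Possible heights after joining parts of heights \<open>x\<close> and \<open>y\<close>.
  The exact value in the balanced case is what makes the cost of a split telescope.\<close>

definition hb :: "nat \<Rightarrow> nat \<Rightarrow> nat \<Rightarrow> bool" where
  "hb x y h \<longleftrightarrow> max x y \<le> h \<and> h \<le> 1 + max x y \<and> (x \<le> y + 1 \<and> y \<le> x + 1 \<longrightarrow> h = 1 + max x y)"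

lemma wf_dest:
  assumes "rep1 t A u T" "wf G T" "lh k T > 0"
  obtains P Q where "okT t G A (vin d u) P" "okT t G A (vin (\<not> d) u) Q" "ge k P" "ge k Q"
    "lh k P \<le> lh k Q + 1" "lh k Q \<le> lh k P + 1" "lh k T = 1 + max (lh k P) (lh k Q)"
    "ks T = app d (ks P) (app d [key (vrt u)] (ks Q))" "ly (vrt u) = k" "gl (vrt u) \<in> G" "ky (vrt u) \<in> vis t A"
proof -
  obtain L a R where T: "T = Node L a R" using assms(3) by (cases T) auto
  have k: "ly a = k" using assms(3) T by (auto split: if_splits)
  obtain l r where u: "u = VN l a r" "rep t A l L" "rep t A r R" "ky a \<in> vis t A" using assms(1) T by (auto simp: rep1_Node)
  show thesis
    by (cases d; rule that[of "if d then L else R" "if d then R else L"])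
      (use assms k u in \<open>auto simp: okT_def T vin_def vrt_def app_def key_def max.commute\<close>)
qed

text \<open>\<open>vin d m\<close> is the inner and \<open>vin (\<not> d) m\<close> the outer child
  of the high side: a single rotation works if the inner child is not the higher one, a double
  rotation otherwise.\<close>

lemma wp_bal:
  assumes "okT t G A l L" "okT t G A m M" "ky b \<in> vis t A" "gl b \<in> G" "ge (ly b) L" "ge (ly b) M"
    "lh (ly b) M \<le> lh (ly b) L + 2" "lh (ly b) L \<le> lh (ly b) M + 1"
  shows "wp t A (bal d l b m) (\<lambda>B n u. n \<le> 10 \<and> (\<exists>T. okT t G B u T \<and> ks T = app d (ks L) (app d [key b] (ks M))
    \<and> ge (ly b) T \<and> hb (lh (ly b) L) (lh (ly b) M) (lh (ly b) T)))"
  unfolding bal_def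
proof (rule wp_bnd[OF wp_opn1[OF okT_rep[OF assms(1) order_refl]]], goal_cases)
 case (1 A1 n1 l') note c1 = 1
  show ?case
  proof (rule wp_bnd[OF wp_opn1[OF okT_rep[OF assms(2) c1(1)]]], goal_cases)
 case (1 A2 n2 m') note c2 = 1
    have l': "rep1 t A2 l' L" using c1 c2 rep1_mono by blast
    have m': "rep1 t A2 m' M" using c2 by blast
    have okl: "okT t G A2 l' L" and okm: "okT t G A2 m' M" using l' m' assms by (auto simp: okT_def rep1_rep)
    have vb: "ky b \<in> vis t A2" using assms c1 c2 vis_monoD by blast
    have h: "vlh (ly b) l' = lh (ly b) L" "vlh (ly b) m' = lh (ly b) M" using l' m' rep1_vlh by auto
    show ?case
    proof (cases "lh (ly b) M \<le> lh (ly b) L + 1")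
      case True
      have "wp t A2 (mkd d l' b m') (\<lambda>B n u. n \<le> 2 \<and> (\<exists>T. okT t G B u T \<and> ks T = app d (ks L) (app d [key b] (ks M))
        \<and> ge (ly b) T \<and> lh (ly b) T = 1 + max (lh (ly b) L) (lh (ly b) M)))"
        using True wp_mkd okl okm vb assms by blast
      then show ?thesis
        by (simp only: h True if_True)
          (erule wp_mono, use c1 c2 in \<open>auto simp: hb_def\<close>)
    next
      case False
      define k where "k = ly b"
      note F = False[folded k_def]
      have pos: "lh k M > 0" using F by simp
      obtain P Q where PQ: "okT t G A2 (vin d m') P" "okT t G A2 (vin (\<not> d) m') Q" "ge k P" "ge k Q"
        "lh k P \<le> lh k Q + 1" "lh k Q \<le> lh k P + 1" "lh k M = 1 + max (lh k P) (lh k Q)"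
        "ks M = app d (ks P) (app d [key (vrt m')] (ks Q))" "ly (vrt m') = k" "gl (vrt m') \<in> G" "ky (vrt m') \<in> vis t A2"
        using wf_dest[OF m' _ pos, of G d] assms(2) unfolding okT_def by blast
      have "wp t A2 (bnd (opn (vin d m')) (\<lambda>p. bnd (opn (vin (\<not> d) m')) (\<lambda>q.
       if vlh k p \<le> vlh k q then bnd (mkd d l' b p) (\<lambda>w. mkd d w (vrt m') q)
       else bnd (mkd d l' b (vin d p)) (\<lambda>w. bnd (mkd d (vin (\<not> d) p) (vrt m') q) (\<lambda>z. mkd d w (vrt p) z)))))
        (\<lambda>B n u. n \<le> 8 \<and> (\<exists>T. okT t G B u T \<and> ks T = app d (ks L) (app d [key b] (ks M))
        \<and> ge k T \<and> hb (lh k L) (lh k M) (lh k T)))"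
      proof (rule wp_bnd[OF wp_opn1[OF okT_rep[OF PQ(1) order_refl]]], goal_cases)
 case (1 A3 n3 p) note c3 = 1
        show ?case
        proof (rule wp_bnd[OF wp_opn1[OF okT_rep[OF PQ(2) c3(1)]]], goal_cases)
 case (1 A4 n4 q) note c4 = 1
          have p: "rep1 t A4 p P" using c3 c4 rep1_mono by blast
          have q: "rep1 t A4 q Q" using c4 by blast
          have okp: "okT t G A4 p P" and okq: "okT t G A4 q Q" using p q PQ by (auto simp: okT_def rep1_rep)
          have A24: "A2 \<subseteq> A4" using c3 c4 by blast
          have okl4: "okT t G A4 l' L" using okl A24 okT_mono by blast
          have vb4: "ky b \<in> vis t A4" "ky (vrt m') \<in> vis t A4" using vb PQ A24 vis_monoD by blast+
          have h4: "vlh k p = lh k P" "vlh k q = lh k Q" using p q rep1_vlh by auto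
          have gL: "ge k L" using assms k_def by simp
          have mono: "\<And>B y. y \<in> vis t A4 \<Longrightarrow> A4 \<subseteq> B \<Longrightarrow> y \<in> vis t B" using vis_monoD by blast
          have m2: "lh k M = lh k L + 2" using F assms(7) by (simp add: k_def)
          show ?case
          proof (cases "lh k P \<le> lh k Q")
            case True
            have hQ: "lh k Q = lh k L + 1" and hP: "lh k P = lh k L \<or> lh k P = lh k L + 1" using m2 PQ(5-7) True by auto
            have "wp t A4 (bnd (mkd d l' b p) (\<lambda>w. mkd d w (vrt m') q))
              (\<lambda>B n u. n \<le> 4 \<and> (\<exists>T. okT t G B u T \<and> ks T = app d (ks L) (app d [key b] (ks M))
                \<and> ge k T \<and> hb (lh k L) (lh k M) (lh k T)))"
            proof (rule wp_bnd[OF wp_mkd[OF okl4 okp vb4(1) assms(4), folded k_def, of d]], goal_cases)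
              case (5 A5 n5 w)
              then obtain T where T: "n5 \<le> 2" "okT t G A5 w T" "ks T = app d (ks L) (app d [key b] (ks P))"
                "ge k T" "lh k T = 1 + max (lh k L) (lh k P)" by blast
              have hT: "lh k T = 1 + lh k P" using T(5) hP by auto
              show ?case
              proof (rule wp_mono[OF wp_mkd[OF T(2) okT_mono[OF okq 5(1)] mono[OF vb4(2) 5(1)] PQ(10), unfolded PQ(9), of d]], goal_cases)
                case (5 A6 n6 u)
                then obtain T6 where T6: "n6 \<le> 2" "okT t G A6 u T6" "ks T6 = app d (ks T) (app d [key (vrt m')] (ks Q))"
                  "ge k T6" "lh k T6 = 1 + max (lh k T) (lh k Q)" by blast
                have "hb (lh k L) (lh k M) (lh k T6)" using T6(5) hT hQ hP m2 by (auto simp: hb_def)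
                then show ?case using T6(1,2,4) T(1) T6(3) T(3) PQ(8) by auto
              qed (use T(4) PQ(4) hT hP hQ in auto)
            qed (use gL PQ(3) hP in auto)
            then show ?thesis
              by (simp only: h4 True if_True)
                (erule wp_mono, use c3 c4 in \<open>auto\<close>)
          next
            case False
            have posP: "lh k P > 0" using False by simp
            have hP: "lh k P = lh k L + 1" and hQ: "lh k Q = lh k L" using m2 PQ(5-7) False by auto
            obtain U V where UV: "okT t G A4 (vin d p) U" "okT t G A4 (vin (\<not> d) p) V" "ge k U" "ge k V"
              "lh k U \<le> lh k V + 1" "lh k V \<le> lh k U + 1" "lh k P = 1 + max (lh k U) (lh k V)"
              "ks P = app d (ks U) (app d [key (vrt p)] (ks V))" "ly (vrt p) = k" "gl (vrt p) \<in> G" "ky (vrt p) \<in> vis t A4"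
              using wf_dest[OF p _ posP, of G d] PQ(1) unfolding okT_def by blast
            have hUV: "lh k U \<le> lh k L" "lh k V \<le> lh k L" "lh k L \<le> lh k U + 1" "lh k L \<le> lh k V + 1" using hP UV(5-7) by auto
            have "wp t A4 (bnd (mkd d l' b (vin d p)) (\<lambda>w. bnd (mkd d (vin (\<not> d) p) (vrt m') q) (\<lambda>z. mkd d w (vrt p) z)))
              (\<lambda>B n u. n \<le> 6 \<and> (\<exists>T. okT t G B u T \<and> ks T = app d (ks L) (app d [key b] (ks M))
                \<and> ge k T \<and> hb (lh k L) (lh k M) (lh k T)))"
            proof (rule wp_bnd[OF wp_mkd[OF okl4 UV(1) vb4(1) assms(4), folded k_def, of d]], goal_cases)
              case (5 A5 n5 w)
              then obtain T where T: "n5 \<le> 2" "okT t G A5 w T" "ks T = app d (ks L) (app d [key b] (ks U))"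
                "ge k T" "lh k T = 1 + max (lh k L) (lh k U)" by blast
              have hT: "lh k T = 1 + lh k L" using T(5) hUV by auto
              note s5 = 5(1)
              show ?case
              proof (rule wp_bnd[OF wp_mkd[OF okT_mono[OF UV(2) s5] okT_mono[OF okq s5] mono[OF vb4(2) s5] PQ(10), unfolded PQ(9), of d]], goal_cases)
                case (5 A6 n6 z)
                then obtain T' where T': "n6 \<le> 2" "okT t G A6 z T'" "ks T' = app d (ks V) (app d [key (vrt m')] (ks Q))"
                  "ge k T'" "lh k T' = 1 + max (lh k V) (lh k Q)" by blast
                have hT': "lh k T' = 1 + lh k L" using T'(5) hUV hQ by auto
                note s6 = 5(1)
                show ?case
                proof (rule wp_mono[OF wp_mkd[OF okT_mono[OF T(2) s6] T'(2) mono[OF UV(11) order_trans[OF s5 s6]] UV(10), unfolded UV(9), of d]], goal_cases)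
                  case (5 A7 n7 u)
                  then obtain T7 where T7: "n7 \<le> 2" "okT t G A7 u T7" "ks T7 = app d (ks T) (app d [key (vrt p)] (ks T'))"
                    "ge k T7" "lh k T7 = 1 + max (lh k T) (lh k T')" by blast
                  have "hb (lh k L) (lh k M) (lh k T7)" using T7(5) hT hT' m2 by (auto simp: hb_def)
                  then show ?case using T7(1,2,4) T(1) T'(1) T7(3) T'(3) T(3) PQ(8) UV(8) by auto
                qed (use T(4) T'(4) hT hT' in auto)
              qed (use UV(4) PQ(4) hUV hQ in auto)
            qed (use gL UV(3) hUV in auto)
            then show ?thesis
              by (simp only: h4 False if_False)
                (erule wp_mono, use c3 c4 in \<open>auto\<close>)
          qed
        qed
      qed
      then show ?thesis
        by (simp only: h False if_False k_def)
          (erule wp_mono, use c1 c2 in \<open>auto\<close>)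
    qed
  qed
qed

text \<open>Join of two AVL trees around a middle node: it follows the inner spine of the higher
  tree until the heights nearly agree. A join raises the height by at most one, so one
  \<open>bal\<close> per step on the way back suffices and the cost is linear in the height
  difference.\<close>

fun lnk :: "nat \<Rightarrow> vt \<Rightarrow> nd \<Rightarrow> vt \<Rightarrow> vt dt" where
  "lnk 0 l a r = Ret VL"
| "lnk (Suc f) l a r = bnd (opn l) (\<lambda>l. bnd (opn r) (\<lambda>r.
     if vlh (ly a) l > vlh (ly a) r + 1 then
       bnd (lnk f (vin False l) a r) (\<lambda>m. bal True (vin True l) (vrt l) m)
     else if vlh (ly a) r > vlh (ly a) l + 1 then
       bnd (lnk f l a (vin True r)) (\<lambda>m. bal False (vin False r) (vrt r) m)
     else mk l a r))"

lemma wp_lnk: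
  assumes "okT t G A l L" "okT t G A r R" "ky a \<in> vis t A" "gl a \<in> G" "ge (ly a) L" "ge (ly a) R"
    "lh (ly a) L + lh (ly a) R < f"
  shows "wp t A (lnk f l a r) (\<lambda>B n u. n \<le> 14 * (1 + (lh (ly a) L - lh (ly a) R) + (lh (ly a) R - lh (ly a) L)) \<and>
    (\<exists>T. okT t G B u T \<and> ks T = ks L @ (ky a, st a) # ks R
    \<and> ge (ly a) T \<and> hb (lh (ly a) L) (lh (ly a) R) (lh (ly a) T)))"
  using assms
proof (induction f arbitrary: A l L r R)
  case (Suc f)
  define k where "k = ly a"
  show ?case
    unfolding lnk.simps
  proof (rule wp_bnd[OF wp_opn1[OF okT_rep[OF Suc.prems(1) order_refl]]], goal_cases)
 case (1 A1 n1 l') note c1 = 1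
    show ?case
    proof (rule wp_bnd[OF wp_opn1[OF okT_rep[OF Suc.prems(2) c1(1)]]], goal_cases)
 case (1 A2 n2 r') note c2 = 1
      have l': "rep1 t A2 l' L" using c1 c2 rep1_mono by blast
      have r': "rep1 t A2 r' R" using c2 by blast
      have okl: "okT t G A2 l' L" and okr: "okT t G A2 r' R" using l' r' Suc.prems by (auto simp: okT_def rep1_rep)
      have va: "ky a \<in> vis t A2" using Suc.prems c1 c2 vis_monoD by blast
      have h: "vlh (ly a) l' = lh k L" "vlh (ly a) r' = lh k R" using l' r' rep1_vlh k_def by auto
      consider (a) "lh k L > lh k R + 1" | (b) "lh k R > lh k L + 1" | (c) "lh k L \<le> lh k R + 1" "lh k R \<le> lh k L + 1" by linarith
      then show ?case
      proof cases
        case a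
        have pos: "lh k L > 0" using a by simp
        obtain P Q where PQ: "okT t G A2 (vin True l') P" "okT t G A2 (vin False l') Q" "ge k P" "ge k Q"
          "lh k P \<le> lh k Q + 1" "lh k Q \<le> lh k P + 1" "lh k L = 1 + max (lh k P) (lh k Q)"
          "ks L = app True (ks P) (app True [key (vrt l')] (ks Q))" "ly (vrt l') = k" "gl (vrt l') \<in> G" "ky (vrt l') \<in> vis t A2"
          using wf_dest[OF l' _ pos, of G True] Suc.prems(1) unfolding okT_def by auto
        have "wp t A2 (bnd (lnk f (vin False l') a r') (\<lambda>m. bal True (vin True l') (vrt l') m))
          (\<lambda>B n u. n \<le> 14 * (lh k L - lh k R) + 10 \<and> (\<exists>T. okT t G B u T \<and> ks T = ks L @ (ky a, st a) # ks R
          \<and> ge k T \<and> hb (lh k L) (lh k R) (lh k T)))"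
        proof (rule wp_bnd[OF Suc.IH[OF PQ(2) okr va]], goal_cases)
          case (5 A3 n3 m)
          then obtain M where M: "okT t G A3 m M" "ks M = ks Q @ (ky a, st a) # ks R" "ge k M" "hb (lh k Q) (lh k R) (lh k M)"
              "n3 \<le> 14 * (1 + (lh k Q - lh k R) + (lh k R - lh k Q))"
            unfolding k_def by blast
          have hQ: "lh k R \<le> lh k Q" using a PQ(5-7) by auto
          have hL: "lh k L \<ge> 1 + lh k Q" "lh k L \<le> 2 + lh k Q" "lh k L \<ge> 1 + lh k P" "lh k L \<le> 2 + lh k P" using PQ(5-7) by auto
          have hM: "lh k Q \<le> lh k M" "lh k M \<le> 1 + lh k Q" using M(4) hQ by (auto simp: hb_def)
          show ?case
          proof (rule wp_mono[OF wp_bal[OF okT_mono[OF PQ(1) 5(1)] M(1) vis_monoD[OF PQ(11) 5(1)] PQ(10), unfolded PQ(9), of True]], goal_cases)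
            case (5 A4 n4 u)
            then obtain T where T: "n4 \<le> 10" "okT t G A4 u T" "ks T = app True (ks P) (app True [key (vrt l')] (ks M))"
              "ge k T" "hb (lh k P) (lh k M) (lh k T)" by blast
            have "n3 \<le> 14 * (lh k L - lh k R)" using M(5) hQ hL by auto
            moreover have "hb (lh k L) (lh k R) (lh k T)"
              using T(5) hM hL a PQ(5-7) unfolding hb_def max_def by (auto split: if_splits)
            ultimately show ?case using T(1-4) M(2) PQ(8) by (auto simp: app_def)
          qed (use M(3) PQ(3,5,6) hM in \<open>auto\<close>)
        qed (use Suc.prems PQ(4,7) in \<open>auto simp: k_def\<close>)
        then show ?thesis using a
          by (simp only: h if_True Suc_eq_plus1) (erule wp_mono, use c1 c2 a in \<open>auto simp: k_def\<close>)
      next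
        case b
        have pos: "lh k R > 0" using b by simp
        obtain P Q where PQ: "okT t G A2 (vin True r') P" "okT t G A2 (vin False r') Q" "ge k P" "ge k Q"
          "lh k P \<le> lh k Q + 1" "lh k Q \<le> lh k P + 1" "lh k R = 1 + max (lh k P) (lh k Q)"
          "ks R = app True (ks P) (app True [key (vrt r')] (ks Q))" "ly (vrt r') = k" "gl (vrt r') \<in> G" "ky (vrt r') \<in> vis t A2"
          using wf_dest[OF r' _ pos, of G True] Suc.prems(2) unfolding okT_def by auto
        have "wp t A2 (bnd (lnk f l' a (vin True r')) (\<lambda>m. bal False (vin False r') (vrt r') m))
          (\<lambda>B n u. n \<le> 14 * (lh k R - lh k L) + 10 \<and> (\<exists>T. okT t G B u T \<and> ks T = ks L @ (ky a, st a) # ks R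
          \<and> ge k T \<and> hb (lh k L) (lh k R) (lh k T)))"
        proof (rule wp_bnd[OF Suc.IH[OF okl PQ(1) va]], goal_cases)
          case (5 A3 n3 m)
          then obtain M where M: "okT t G A3 m M" "ks M = ks L @ (ky a, st a) # ks P" "ge k M" "hb (lh k L) (lh k P) (lh k M)"
              "n3 \<le> 14 * (1 + (lh k L - lh k P) + (lh k P - lh k L))"
            unfolding k_def by blast
          have hP: "lh k L \<le> lh k P" using b PQ(5-7) by auto
          have hR: "lh k R \<ge> 1 + lh k Q" "lh k R \<le> 2 + lh k Q" "lh k R \<ge> 1 + lh k P" "lh k R \<le> 2 + lh k P" using PQ(5-7) by auto
          have hM: "lh k P \<le> lh k M" "lh k M \<le> 1 + lh k P" using M(4) hP by (auto simp: hb_def)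
          show ?case
          proof (rule wp_mono[OF wp_bal[OF okT_mono[OF PQ(2) 5(1)] M(1) vis_monoD[OF PQ(11) 5(1)] PQ(10), unfolded PQ(9), of False]], goal_cases)
            case (5 A4 n4 u)
            then obtain T where T: "n4 \<le> 10" "okT t G A4 u T" "ks T = app False (ks Q) (app False [key (vrt r')] (ks M))"
              "ge k T" "hb (lh k Q) (lh k M) (lh k T)" by blast
            have "n3 \<le> 14 * (lh k R - lh k L)" using M(5) hP hR by auto
            moreover have "hb (lh k L) (lh k R) (lh k T)"
              using T(5) hM hR b PQ(5-7) unfolding hb_def max_def by (auto split: if_splits)
            ultimately show ?case using T(1-4) M(2) PQ(8) by (auto simp: app_def)
          qed (use M(3) PQ(4,5,6) hM in \<open>auto\<close>)
        qed (use Suc.prems PQ(3,7) in \<open>auto simp: k_def\<close>)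
        moreover have "\<not> lh k L > lh k R + 1" using b by simp
        ultimately show ?thesis using b
          by (simp only: h if_True if_False Suc_eq_plus1) (erule wp_mono, use c1 c2 b in \<open>auto simp: k_def\<close>)
      next
        case c
        then have "\<not> lh k L > lh k R + 1" "\<not> lh k R > lh k L + 1" by auto
        then show ?thesis
          apply (simp only: h if_False)
          apply (rule wp_mono[OF wp_mk[OF okl okr va]])
          using Suc.prems c c1 c2 by (auto simp: k_def hb_def)
      qed
    qed
  qed
qed simp

definition link :: "vt \<Rightarrow> nd \<Rightarrow> vt \<Rightarrow> vt dt" where
  "link l a r = bnd (opn l) (\<lambda>l. bnd (opn r) (\<lambda>r. lnk (Suc (vlh (ly a) l + vlh (ly a) r)) l a r))"

lemma wp_link:
  assumes "okT t G A l L" "okT t G A r R" "ky a \<in> vis t A" "gl a \<in> G" "ge (ly a) L" "ge (ly a) R"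
  shows "wp t A (link l a r) (\<lambda>B n u. n \<le> 16 + 14 * ((lh (ly a) L - lh (ly a) R) + (lh (ly a) R - lh (ly a) L)) \<and>
    (\<exists>T. okT t G B u T \<and> ks T = ks L @ (ky a, st a) # ks R
    \<and> ge (ly a) T \<and> hb (lh (ly a) L) (lh (ly a) R) (lh (ly a) T)))"
  unfolding link_def
proof (rule wp_bnd[OF wp_opn1[OF okT_rep[OF assms(1) order_refl]]], goal_cases)
 case (1 A1 n1 l') note c1 = 1
  show ?case
  proof (rule wp_bnd[OF wp_opn1[OF okT_rep[OF assms(2) c1(1)]]], goal_cases)
 case (1 A2 n2 r') note c2 = 1
    have l': "rep1 t A2 l' L" using c1 c2 rep1_mono by blast
    have r': "rep1 t A2 r' R" using c2 by blast
    have okl: "okT t G A2 l' L" and okr: "okT t G A2 r' R" using l' r' assms by (auto simp: okT_def rep1_rep)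
    have va: "ky a \<in> vis t A2" using assms c1 c2 vis_monoD by blast
    show ?case
      by (rule wp_mono[OF wp_lnk[OF okl okr va]])
        (use assms c1 c2 rep1_vlh[OF l', of "ly a"] rep1_vlh[OF r', of "ly a"] in auto)
  qed
qed

section \<open>The search-path measure and splitting at a key\<close>

abbreviation keys :: "nd tree \<Rightarrow> nat set" where "keys T \<equiv> fst ` set (ks T)"

definition bst' :: "nd tree \<Rightarrow> bool" where
  "bst' T \<longleftrightarrow> sorted_wrt (<) (map fst (ks T))"

lemma bst'_Node [simp]: "bst' (Node l a r) \<longleftrightarrow> bst' l \<and> bst' r \<and> (\<forall>x\<in>keys l. x < ky a) \<and> (\<forall>x\<in>keys r. ky a < x)"
  by (fastforce simp: bst'_def sorted_wrt_append)

text \<open>Sum of the heights of the layers, other than \<open>k\<close>, that are met on the search path for \<open>y\<close>;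
  if \<open>y\<close> occurs, then the paths to its predecessor and its successor are followed as well.\<close>
fun path_height :: "nat \<Rightarrow> nat \<Rightarrow> nd tree \<Rightarrow> nat" where
  "path_height y k Leaf = 0"
| "path_height y k (Node l a r) = (if ly a = k then 0 else ht a) +
     (if y < ky a then path_height y (ly a) l else if ky a < y then path_height y (ly a) r
      else path_height y (ly a) l + path_height y (ly a) r)"

lemma path_height_conv: "ge j T \<Longrightarrow> k < j \<Longrightarrow> path_height y k T = lh j T + path_height y j T"
  by (cases T) auto

lemma rep1_NodeE:
  assumes "rep1 t B v (Node L a R)" "wf G (Node L a R)"
  obtains l r where "v = VN l a r" "okT t G B l L" "okT t G B r R" "ky a \<in> vis t B"
  using assms by (auto simp: rep1_Node okT_def)

lemma ge_ks: "wf G T \<Longrightarrow> ge k T \<Longrightarrow> p \<in> set (ks T) \<Longrightarrow> k \<le> fst (snd p)"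
  by (induction T arbitrary: k) (auto dest: ge_mono)

fun split :: "nat \<Rightarrow> nat \<Rightarrow> vt \<Rightarrow> (vt \<times> vt) dt" where
  "split 0 y u = Ret (VL, VL)"
| "split (Suc f) y u = bnd (opn u) (\<lambda>v. case v of VN l a r \<Rightarrow>
     if y < ky a then bnd (split f y l) (\<lambda>z. bnd (link (snd z) a r) (\<lambda>m. Ret (fst z, m)))
     else bnd (split f y r) (\<lambda>z. bnd (link l a (fst z)) (\<lambda>m. Ret (m, snd z)))
   | _ \<Rightarrow> Ret (VL, VL))"

text \<open>The term with \<open>lh k T1\<close> and \<open>lh k T2\<close> acts as a potential: a
  join costs \<open>14\<close> per unit of height difference, which the growth of the joined part
  matches, so the differences telescope along the path. Seen from a layer above, the coefficients
  \<open>17\<close>, \<open>14\<close> and \<open>14\<close> add up to the \<open>45\<close> charged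
  through \<open>path_height\<close>.\<close>

definition spl_post :: "nat \<Rightarrow> nd tree \<Rightarrow> nd tree \<Rightarrow> nd tree \<Rightarrow> nat \<Rightarrow> nat \<Rightarrow> bool" where
  "spl_post y T T1 T2 n k \<longleftrightarrow> ge k T1 \<and> ge k T2 \<and> lh k T1 \<le> lh k T \<and> lh k T2 \<le> lh k T \<and>
     n \<le> 17 * lh k T + 45 * path_height y k T + 14 * (lh k T1 + lh k T2) + 5"

lemma spl_post_less:
  assumes "spl_post y T T1 T2 n j" "ge j T" "k < j" shows "spl_post y T T1 T2 n k"
  using assms path_height_conv[OF assms(2,3), of y] ge_mono[of j _ k] lh_ge_less[of j _ k]
  unfolding spl_post_def by auto

lemma spl_post_all: "spl_post y (Node L a R) T1 T2 n (ly a) \<Longrightarrow> ge k (Node L a R) \<Longrightarrow> spl_post y (Node L a R) T1 T2 n k"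
  using spl_post_less[of y "Node L a R" T1 T2 n "ly a" k] by (cases "k = ly a") auto

lemma wp_split:
  assumes "okT t G A u T" "size T < f" "bst' T" "y \<notin> keys T"
  shows "wp t A (split f y u) (\<lambda>B n z. \<exists>T1 T2. okT t G B (fst z) T1 \<and> okT t G B (snd z) T2 \<and>
    ks T = ks T1 @ ks T2 \<and> (\<forall>x\<in>keys T1. x < y) \<and> (\<forall>x\<in>keys T2. y < x) \<and>
    (\<forall>k. ge k T \<longrightarrow> spl_post y T T1 T2 n k))"
  using assms
proof (induction f arbitrary: A u T)
  case (Suc f)
  show ?case
    unfolding split.simps
  proof (rule wp_bnd[OF wp_opn1[OF okT_rep[OF Suc.prems(1) order_refl]]], goal_cases)
    case (1 A1 n1 v)
    show ?case
    proof (cases T)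
      case Leaf
      then show ?thesis using 1 by (auto simp: okT_def spl_post_def intro!: exI[of _ Leaf])
    next
      case (Node L a R)
      have wfT: "wf G (Node L a R)" using Suc.prems Node by (simp add: okT_def)
      obtain l r where v: "v = VN l a r" "okT t G A1 l L" "okT t G A1 r R" "ky a \<in> vis t A1"
        using rep1_NodeE[OF _ wfT] 1 Node by blast
      define j where "j = ly a"
      have W: "ge j L" "ge j R" "lh j L \<le> lh j R + 1" "lh j R \<le> lh j L + 1" "lh j T = 1 + max (lh j L) (lh j R)" "gl a \<in> G"
        using wfT Node by (auto simp: j_def)
      show ?thesis
      proof (cases "y < ky a")
        case True
        have "wp t A1 (bnd (split f y l) (\<lambda>z. bnd (link (snd z) a r) (\<lambda>m. Ret (fst z, m)))) (\<lambda>B n z.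
            \<exists>T1 T2. okT t G B (fst z) T1 \<and> okT t G B (snd z) T2 \<and>
            ks T = ks T1 @ ks T2 \<and> (\<forall>x\<in>keys T1. x < y) \<and> (\<forall>x\<in>keys T2. y < x) \<and> (\<forall>k. ge k T \<longrightarrow> spl_post y T T1 T2 (n1 + n) k))"
        proof (rule wp_bnd[OF Suc.IH[OF v(2)]], goal_cases)
          case (4 B n z)
          then obtain T1 T2 where z: "okT t G B (fst z) T1" "okT t G B (snd z) T2"
            "ks L = ks T1 @ ks T2" "\<forall>x\<in>keys T1. x < y" "\<forall>x\<in>keys T2. y < x" "spl_post y L T1 T2 n j"
            using W by blast
          show ?case
          proof (rule wp_bnd[OF wp_link[OF z(2) okT_mono[OF v(3) 4(1)] vis_monoD[OF v(4) 4(1)] W(6)], folded j_def], goal_cases)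
            case (3 C m w)
            then obtain T' where T': "okT t G C w T'" "ks T' = ks T2 @ (ky a, st a) # ks R" "ge j T'"
              "hb (lh j T2) (lh j R) (lh j T')" "m \<le> 16 + 14 * ((lh j T2 - lh j R) + (lh j R - lh j T2))" by blast
            have zz: "lh j T2 \<le> lh j L" "ge j T1" "lh j T1 \<le> lh j L" using z(6) by (auto simp: spl_post_def)
            have "14 * (lh j T2 + ((lh j T2 - lh j R) + (lh j R - lh j T2))) \<le> 14 * lh j T'" "lh j T' \<le> lh j T"
              using T'(4) zz W unfolding hb_def by auto
            moreover have "n \<le> 17 * lh j L + 45 * path_height y j L + 14 * (lh j T1 + lh j T2) + 5" "lh j L + 1 \<le> lh j T"
              using z(6) W by (auto simp: spl_post_def)
            moreover have "path_height y j T = path_height y j L" using True Node by (simp add: j_def)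
            ultimately have "spl_post y T T1 T' (n1 + (n + m)) j"
              using T'(3,5) zz 1 unfolding spl_post_def by simp
            then have "\<forall>k. ge k T \<longrightarrow> spl_post y T T1 T' (n1 + (n + m)) k"
              unfolding Node j_def using spl_post_all by blast
            moreover have "\<forall>x\<in>keys T'. y < x" using T'(2) z(5) True Suc.prems(3) Node by (auto intro: less_trans[OF True])
            ultimately have "okT t G C (fst (fst z, w)) T1 \<and> okT t G C (snd (fst z, w)) T' \<and>
              ks T = ks T1 @ ks T' \<and> (\<forall>x\<in>keys T1. x < y) \<and> (\<forall>x\<in>keys T'. y < x) \<and>
              (\<forall>k. ge k T \<longrightarrow> spl_post y T T1 T' (n1 + (n + m)) k)"
              using okT_mono[OF z(1) 3(1)] T'(1,2) z(3,4) Node by simp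
            then show ?case unfolding wp_Ret add_0_right by blast
          qed (use W z in \<open>auto simp: spl_post_def j_def\<close>)
        qed (use Suc.prems Node in auto)
        then show ?thesis by (simp only: v(1) vt.case True if_True)
      next
        case False
        then have y: "ky a < y" using Suc.prems Node by force
        have "wp t A1 (bnd (split f y r) (\<lambda>z. bnd (link l a (fst z)) (\<lambda>m. Ret (m, snd z)))) (\<lambda>B n z.
            \<exists>T1 T2. okT t G B (fst z) T1 \<and> okT t G B (snd z) T2 \<and>
            ks T = ks T1 @ ks T2 \<and> (\<forall>x\<in>keys T1. x < y) \<and> (\<forall>x\<in>keys T2. y < x) \<and> (\<forall>k. ge k T \<longrightarrow> spl_post y T T1 T2 (n1 + n) k))"
        proof (rule wp_bnd[OF Suc.IH[OF v(3)]], goal_cases)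
          case (4 B n z)
          then obtain T1 T2 where z: "okT t G B (fst z) T1" "okT t G B (snd z) T2"
            "ks R = ks T1 @ ks T2" "\<forall>x\<in>keys T1. x < y" "\<forall>x\<in>keys T2. y < x" "spl_post y R T1 T2 n j"
            using W by blast
          show ?case
          proof (rule wp_bnd[OF wp_link[OF okT_mono[OF v(2) 4(1)] z(1) vis_monoD[OF v(4) 4(1)] W(6)], folded j_def], goal_cases)
            case (3 C m w)
            then obtain T' where T': "okT t G C w T'" "ks T' = ks L @ (ky a, st a) # ks T1" "ge j T'"
              "hb (lh j L) (lh j T1) (lh j T')" "m \<le> 16 + 14 * ((lh j L - lh j T1) + (lh j T1 - lh j L))" by blast
            have zz: "lh j T1 \<le> lh j R" "ge j T2" "lh j T2 \<le> lh j R" using z(6) by (auto simp: spl_post_def)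
            have "14 * (lh j T1 + ((lh j L - lh j T1) + (lh j T1 - lh j L))) \<le> 14 * lh j T'" "lh j T' \<le> lh j T"
              using T'(4) zz W unfolding hb_def by auto
            moreover have "n \<le> 17 * lh j R + 45 * path_height y j R + 14 * (lh j T1 + lh j T2) + 5" "lh j R + 1 \<le> lh j T"
              using z(6) W by (auto simp: spl_post_def)
            moreover have "path_height y j T = path_height y j R" using y Node by (simp add: j_def)
            ultimately have "spl_post y T T' T2 (n1 + (n + m)) j"
              using T'(3,5) zz 1 unfolding spl_post_def by simp
            then have "\<forall>k. ge k T \<longrightarrow> spl_post y T T' T2 (n1 + (n + m)) k"
              unfolding Node j_def using spl_post_all by blast
            moreover have "\<forall>x\<in>keys T'. x < y" using T'(2) z(4) y Suc.prems(3) Node by (auto intro: less_trans[OF _ y])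
            ultimately have "okT t G C (fst (w, snd z)) T' \<and> okT t G C (snd (w, snd z)) T2 \<and>
              ks T = ks T' @ ks T2 \<and> (\<forall>x\<in>keys T'. x < y) \<and> (\<forall>x\<in>keys T2. y < x) \<and>
              (\<forall>k. ge k T \<longrightarrow> spl_post y T T' T2 (n1 + (n + m)) k)"
              using okT_mono[OF z(2) 3(1)] T'(1,2) z(3,5) Node by simp
            then show ?case unfolding wp_Ret add_0_right by blast
          qed (use W z in \<open>auto simp: spl_post_def j_def\<close>)
        qed (use Suc.prems Node in auto)
        then show ?thesis by (simp only: v(1) vt.case False if_False)
      qed
    qed
  qed
qed simp

section \<open>Concatenating two layered trees\<close>

definition vat :: "nat \<Rightarrow> vt \<Rightarrow> bool" where
  "vat k u = (case u of VN l b r \<Rightarrow> ly b = k | _ \<Rightarrow> False)"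

text \<open>Extracts the last node of the topmost layer, not the last node of the tree: everything
  to its right lies in deeper layers and is returned separately.\<close>

fun pop :: "nat \<Rightarrow> vt \<Rightarrow> (vt \<times> nd \<times> vt) dt" where
  "pop 0 u = Ret (VL, undefined, VL)"
| "pop (Suc f) u = bnd (opn u) (\<lambda>v. case v of VN l a r \<Rightarrow> bnd (opn r) (\<lambda>r.
     if vat (ly a) r then bnd (pop f r) (\<lambda>z. bnd (link l a (fst z)) (\<lambda>m. Ret (m, snd z)))
     else Ret (l, a, r)) | _ \<Rightarrow> Ret (VL, undefined, VL))"

lemma rep1_vat: "rep1 t A u T \<Longrightarrow> ge k T \<Longrightarrow> \<not> vat k u \<longleftrightarrow> ge (Suc k) T"
  by (cases T) (auto simp: rep1_Node vat_def)

text \<open>For \<open>y\<close> beyond all keys the search path is the right spine, whose nodes of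
  layer \<open>k\<close> count nothing; hence the equality of path heights. Each level costs two
  openings and a join of parts whose heights differ by at most two,
  \<open>46 = 2 + 16 + 28\<close>.\<close>

definition pop_post :: "nd tree \<Rightarrow> nd tree \<Rightarrow> nd tree \<Rightarrow> nat \<Rightarrow> nat \<Rightarrow> bool" where
  "pop_post T T' Tg n k \<longleftrightarrow> ge k T' \<and> ge (Suc k) Tg \<and> lh k T' \<le> lh k T \<and> lh k T \<le> lh k T' + 1 \<and>
     size Tg < size T \<and> n \<le> 46 * lh k T \<and> (\<forall>y. (\<forall>x\<in>keys T. x < y) \<longrightarrow> path_height y k Tg = path_height y k T)"

lemma wp_pop:
  assumes "okT t G A u T" "size T < f" "ge k T" "\<not> ge (Suc k) T"
  shows "wp t A (pop f u) (\<lambda>B n z. \<exists>T' Tg. okT t G B (fst z) T' \<and> okT t G B (snd (snd z)) Tg \<and>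
    ks T = ks T' @ key (fst (snd z)) # ks Tg \<and> ly (fst (snd z)) = k \<and> gl (fst (snd z)) \<in> G \<and>
    ky (fst (snd z)) \<in> vis t B \<and> pop_post T T' Tg n k)"
  using assms
proof (induction f arbitrary: A u T)
  case (Suc f)
  obtain L a R where T: "T = Node L a R" using Suc.prems by (cases T) auto
  have k: "ly a = k" using Suc.prems T by auto
  have wfT: "wf G (Node L a R)" using Suc.prems T by (simp add: okT_def)
  have W: "ge k L" "ge k R" "lh k L \<le> lh k R + 1" "lh k R \<le> lh k L + 1" "lh k T = 1 + max (lh k L) (lh k R)" "gl a \<in> G"
    using wfT T by (auto simp: k)
  show ?case
    unfolding pop.simps
  proof (rule wp_bnd[OF wp_opn1[OF okT_rep[OF Suc.prems(1) order_refl]]], goal_cases)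
    case (1 A1 n1 v)
    note c1 = 1
    obtain l r where v: "v = VN l a r" "okT t G A1 l L" "okT t G A1 r R" "ky a \<in> vis t A1"
      using rep1_NodeE[OF _ wfT] 1 T by blast
    show ?case unfolding v(1) vt.case
    proof (rule wp_bnd[OF wp_opn1[OF okT_rep[OF v(3) order_refl]]], goal_cases)
      case (1 A2 n2 r')
      note c2 = 1
      have okr: "okT t G A2 r' R" using c2 wfT by (auto simp: okT_def rep1_rep)
      have okl: "okT t G A2 l L" using v okT_mono c2 by blast
      have va: "ky a \<in> vis t A2" using v vis_monoD c2 by blast
      show ?case
      proof (cases "vat (ly a) r'")
        case False
        then have g: "ge (Suc k) R" using rep1_vat[of t A2 r' R k] c2 W k by auto
        then have z: "lh k R = 0" by (rule lh_ge)
        have "pop_post T L R (n1 + n2) k"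
          using g z W c1 c2 T k by (auto simp: pop_post_def)
        then show ?thesis using False okr okl va W k T by (auto simp: key_def)
      next
        case True
        then have g: "\<not> ge (Suc k) R" using rep1_vat[of t A2 r' R k] c2 W k by auto
        have "wp t A2 (bnd (pop f r') (\<lambda>z. bnd (link l a (fst z)) (\<lambda>m. Ret (m, snd z))))
          (\<lambda>B n z. \<exists>T' Tg. okT t G B (fst z) T' \<and> okT t G B (snd (snd z)) Tg \<and>
            ks T = ks T' @ key (fst (snd z)) # ks Tg \<and> ly (fst (snd z)) = k \<and> gl (fst (snd z)) \<in> G \<and>
            ky (fst (snd z)) \<in> vis t B \<and> pop_post T T' Tg (n1 + n2 + n) k)"
        proof (rule wp_bnd[OF Suc.IH[OF okr]], goal_cases)
          case (4 B n z)
          then obtain T' Tg where z: "okT t G B (fst z) T'" "okT t G B (snd (snd z)) Tg"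
            "ks R = ks T' @ key (fst (snd z)) # ks Tg" "ly (fst (snd z)) = k" "gl (fst (snd z)) \<in> G"
            "ky (fst (snd z)) \<in> vis t B" "pop_post R T' Tg n k" by blast
          show ?case
          proof (rule wp_bnd[OF wp_link[OF okT_mono[OF okl 4(1)] z(1) vis_monoD[OF va 4(1)] W(6), unfolded k]], goal_cases)
            case (3 C m w)
            then obtain S where S: "okT t G C w S" "ks S = ks L @ (ky a, st a) # ks T'" "ge k S"
              "hb (lh k L) (lh k T') (lh k S)" "m \<le> 16 + 14 * ((lh k L - lh k T') + (lh k T' - lh k L))" by blast
            have zz: "lh k T' \<le> lh k R" "lh k R \<le> lh k T' + 1" "n \<le> 46 * lh k R" using z(7) by (auto simp: pop_post_def)
            have "m \<le> 44" "1 + lh k R \<le> lh k T" using S(5) W zz by auto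
            then have "n1 + n2 + (n + m) \<le> 46 * lh k T" using zz c1 c2 by linarith
            moreover have "lh k S \<le> lh k T" "lh k T \<le> lh k S + 1"
              using S(4) W zz unfolding hb_def by auto
            moreover have "\<forall>y. (\<forall>x\<in>keys T. x < y) \<longrightarrow> path_height y k Tg = path_height y k T"
              using z(7) T k by (auto simp: pop_post_def)
            ultimately have "pop_post T S Tg (n1 + n2 + (n + m)) k"
              using z(7) S(3) T by (auto simp: pop_post_def)
            then show ?case unfolding wp_Ret add_0_right
              using okT_mono[OF z(2) 3(1)] vis_monoD[OF z(6) 3(1)] z(3-5) S(1,2) T
              by (intro exI[of _ S] exI[of _ Tg]) (simp add: key_def)
          qed (use W z in \<open>auto simp: pop_post_def k\<close>)
        qed (use Suc.prems T W g in auto)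
        then show ?thesis using True by (simp add: add.assoc)
      qed
    qed
  qed
qed simp

text \<open>The root of smaller layer stays on top. For equal layers the node popped from the left
  tree becomes the middle node of a join, after the deeper part to its right has been merged with
  the right tree.\<close>

fun merge :: "nat \<Rightarrow> vt \<Rightarrow> vt \<Rightarrow> vt dt" where
  "merge 0 l r = Ret VL"
| "merge (Suc f) l r = bnd (opn l) (\<lambda>l. bnd (opn r) (\<lambda>r. case l of VN ll a lr \<Rightarrow> (case r of VN rl b rr \<Rightarrow>
     if ly a < ly b then bnd (merge f lr r) (\<lambda>m. link ll a m)
     else if ly b < ly a then bnd (merge f l rl) (\<lambda>m. link m b rr)
     else bnd (pop f l) (\<lambda>z. bnd (merge f (snd (snd z)) r) (\<lambda>m. link (fst z) (fst (snd z)) m))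
   | _ \<Rightarrow> Ret l) | _ \<Rightarrow> Ret r))"

text \<open>If one side lies below layer \<open>k\<close>, merging preserves the height of the other
  side, so every join has constant cost and \<open>32\<close> per level suffices. Only the case of
  equal layers pays for a \<open>pop\<close> and a long join; it arises once per layer, since the
  popped remainder is deeper. \<open>80\<close> covers both.\<close>

definition mrg_post :: "nat \<Rightarrow> nd tree \<Rightarrow> nd tree \<Rightarrow> nd tree \<Rightarrow> nat \<Rightarrow> nat \<Rightarrow> bool" where
  "mrg_post y L R T n k \<longleftrightarrow> ge k T \<and> lh k T \<le> 1 + max (lh k L) (lh k R) \<and>
     (lh k L \<le> lh k R + 1 \<and> lh k R \<le> lh k L + 1 \<longrightarrow> max (lh k L) (lh k R) \<le> lh k T) \<and>
     (ge (Suc k) R \<longrightarrow> lh k T = lh k L) \<and> (ge (Suc k) L \<longrightarrow> lh k T = lh k R) \<and>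
     n \<le> 80 * (lh k L + lh k R + path_height y k L + path_height y k R) + 2 \<and>
     (ge (Suc k) L \<or> ge (Suc k) R \<longrightarrow> n \<le> 32 * (lh k L + lh k R) + 80 * (path_height y k L + path_height y k R) + 2)"

lemma mrg_post_less:
  assumes "mrg_post y L R T n j" "ge j L" "ge j R" "k < j" shows "mrg_post y L R T n k"
proof -
  have z: "lh k L = 0" "lh k R = 0" "lh k T = 0" "ge k T"
    using assms lh_ge_less[of j _ k] ge_mono[of j _ k] by (auto simp: mrg_post_def)
  have "n \<le> 80 * (lh j L + lh j R + path_height y j L + path_height y j R) + 2" using assms by (simp add: mrg_post_def)
  then show ?thesis using z path_height_conv[OF assms(2,4), of y] path_height_conv[OF assms(3,4), of y] by (simp add: mrg_post_def)
qed

lemma mrg_post_all: "mrg_post y L R T n j \<Longrightarrow> ge j L \<Longrightarrow> ge j R \<Longrightarrow> \<not> ge (Suc j) L \<or> \<not> ge (Suc j) R \<Longrightarrow>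
   ge k L \<Longrightarrow> ge k R \<Longrightarrow> mrg_post y L R T n k"
  using mrg_post_less[of y L R T n j k] ge_mono[of k _ "Suc j"] by (cases k j rule: linorder_cases) auto

lemma wp_merge:
  assumes "okT t G A l L" "okT t G A r R" "size L + size R < f" "\<forall>x\<in>keys L. x < y" "\<forall>x\<in>keys R. y < x"
  shows "wp t A (merge f l r) (\<lambda>B n u. \<exists>T. okT t G B u T \<and> ks T = ks L @ ks R \<and>
    (\<forall>k. ge k L \<and> ge k R \<longrightarrow> mrg_post y L R T n k))"
  using assms
proof (induction f arbitrary: A l L r R)
  case (Suc f)
  show ?case
    unfolding merge.simps
  proof (rule wp_bnd[OF wp_opn1[OF okT_rep[OF Suc.prems(1) order_refl]]], goal_cases)
    case (1 A1 n1 l')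
    note c1 = 1
    show ?case
    proof (rule wp_bnd[OF wp_opn1[OF okT_rep[OF Suc.prems(2) c1(1)]]], goal_cases)
      case (1 A2 n2 r')
      note c2 = 1
      have l': "rep1 t A2 l' L" using c1 c2 rep1_mono by blast
      have r': "rep1 t A2 r' R" using c2 by blast
      have okl: "okT t G A2 l' L" and okr: "okT t G A2 r' R" using l' r' Suc.prems by (auto simp: okT_def rep1_rep)
      have n12: "n1 + n2 \<le> 2" using c1 c2 by simp
      consider (LL) "L = Leaf" | (RL) "L \<noteq> Leaf" "R = Leaf" | (NN) LL a LR RL b RR where "L = Node LL a LR" "R = Node RL b RR"
        by (cases L; cases R) auto
      then show ?case
      proof cases
        case LL
        then have "l' = VL" using l' by simp
        then show ?thesis using okr LL n12 by (auto simp: mrg_post_def intro!: exI[of _ R] dest: lh_ge)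
      next
        case RL
        then have "r' = VL" using r' by simp
        moreover obtain LL a LR where "L = Node LL a LR" using RL by (cases L) auto
        moreover from this obtain ll lr where "l' = VN ll a lr" using l' by (auto simp: rep1_Node)
        ultimately show ?thesis using okl RL n12 by (auto simp: mrg_post_def intro!: exI[of _ L] dest: lh_ge)
      next
        case NN
        have wfL: "wf G (Node LL a LR)" and wfR: "wf G (Node RL b RR)" using Suc.prems NN by (auto simp: okT_def)
        obtain ll lr where lv: "l' = VN ll a lr" "okT t G A2 ll LL" "okT t G A2 lr LR" "ky a \<in> vis t A2"
          using rep1_NodeE[OF _ wfL] l' NN by blast
        obtain rl rr where rv: "r' = VN rl b rr" "okT t G A2 rl RL" "okT t G A2 rr RR" "ky b \<in> vis t A2"
          using rep1_NodeE[OF _ wfR] r' NN by blast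
        consider (lt) "ly a < ly b" | (gt) "ly b < ly a" | (eq) "ly a = ly b" by linarith
        then show ?thesis
        proof cases
          case lt
          define j where "j = ly a"
          have W: "ge j LL" "ge j LR" "lh j LL \<le> lh j LR + 1" "lh j LR \<le> lh j LL + 1" "lh j L = 1 + max (lh j LL) (lh j LR)" "gl a \<in> G"
            using wfL NN by (auto simp: j_def)
          have R: "ge (Suc j) R" "ge j R" "lh j R = 0" using lt NN by (auto simp: j_def)
          have L: "ge j L" "\<not> ge (Suc j) L" using NN by (auto simp: j_def)
          have yL: "path_height y j L = path_height y j LR" using Suc.prems NN by (auto simp: j_def)
          have "wp t A2 (bnd (merge f lr r') (\<lambda>m. link ll a m)) (\<lambda>B n u. \<exists>T. okT t G B u T \<and> ks T = ks L @ ks R \<and>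
            (\<forall>k. ge k L \<and> ge k R \<longrightarrow> mrg_post y L R T (n1 + (n2 + n)) k))"
          proof (rule wp_bnd[OF Suc.IH[OF lv(3) okr]], goal_cases)
            case (4 B n m)
            then obtain M where M: "okT t G B m M" "ks M = ks LR @ ks R" "mrg_post y LR R M n j" using W R by blast
            have hM: "lh j M = lh j LR" "ge j M" using M(3) R by (auto simp: mrg_post_def)
            have nM: "n \<le> 32 * lh j LR + 80 * (path_height y j LR + path_height y j R) + 2" using M(3) R by (auto simp: mrg_post_def)
            show ?case
            proof (rule wp_mono[OF wp_link[OF okT_mono[OF lv(2) 4(1)] M(1) vis_monoD[OF lv(4) 4(1)] W(6), folded j_def]], goal_cases)
              case (3 C m w)
              then obtain S where S: "okT t G C w S" "ks S = ks LL @ (ky a, st a) # ks M" "ge j S"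
                "hb (lh j LL) (lh j M) (lh j S)" "m \<le> 16 + 14 * ((lh j LL - lh j M) + (lh j M - lh j LL))" by blast
              have "m \<le> 30" "lh j S = lh j L" "1 + lh j LR \<le> lh j L" using S(4,5) hM W unfolding hb_def by auto
              then have "mrg_post y L R S (n1 + (n2 + (n + m))) j" using S(3) R L yL nM n12
                unfolding mrg_post_def by simp
              then have "\<forall>k. ge k L \<and> ge k R \<longrightarrow> mrg_post y L R S (n1 + (n2 + (n + m))) k"
                using mrg_post_all[of y L R S _ j] R L by blast
              then show ?case using S(1,2) M(2) NN by auto
            qed (use W hM in \<open>auto simp: j_def\<close>)
          qed (use Suc.prems NN in auto)
          then show ?thesis
            by (simp only: lv(1) rv(1) vt.case lt if_True)
        next
          case gt
          then have ng: "(ly a < ly b) = False" "(ly b < ly a) = True" by auto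
          define j where "j = ly b"
          have W: "ge j RL" "ge j RR" "lh j RL \<le> lh j RR + 1" "lh j RR \<le> lh j RL + 1" "lh j R = 1 + max (lh j RL) (lh j RR)" "gl b \<in> G"
            using wfR NN by (auto simp: j_def)
          have L: "ge (Suc j) L" "ge j L" "lh j L = 0" using gt NN by (auto simp: j_def)
          have R: "ge j R" "\<not> ge (Suc j) R" using NN by (auto simp: j_def)
          have yR: "path_height y j R = path_height y j RL" using Suc.prems NN by (auto simp: j_def)
          have "wp t A2 (bnd (merge f l' rl) (\<lambda>m. link m b rr)) (\<lambda>B n u. \<exists>T. okT t G B u T \<and> ks T = ks L @ ks R \<and>
            (\<forall>k. ge k L \<and> ge k R \<longrightarrow> mrg_post y L R T (n1 + (n2 + n)) k))"
          proof (rule wp_bnd[OF Suc.IH[OF okl rv(2)]], goal_cases)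
            case (4 B n m)
            then obtain M where M: "okT t G B m M" "ks M = ks L @ ks RL" "mrg_post y L RL M n j" using W L by blast
            have hM: "lh j M = lh j RL" "ge j M" using M(3) L by (auto simp: mrg_post_def)
            have nM: "n \<le> 32 * lh j RL + 80 * (path_height y j L + path_height y j RL) + 2" using M(3) L by (auto simp: mrg_post_def)
            show ?case
            proof (rule wp_mono[OF wp_link[OF M(1) okT_mono[OF rv(3) 4(1)] vis_monoD[OF rv(4) 4(1)] W(6), folded j_def]], goal_cases)
              case (3 C m w)
              then obtain S where S: "okT t G C w S" "ks S = ks M @ (ky b, st b) # ks RR" "ge j S"
                "hb (lh j M) (lh j RR) (lh j S)" "m \<le> 16 + 14 * ((lh j M - lh j RR) + (lh j RR - lh j M))" by blast
              have "m \<le> 30" "lh j S = lh j R" "1 + lh j RL \<le> lh j R" using S(4,5) hM W unfolding hb_def by auto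
              then have "mrg_post y L R S (n1 + (n2 + (n + m))) j" using S(3) L R yR nM n12
                unfolding mrg_post_def by simp
              then have "\<forall>k. ge k L \<and> ge k R \<longrightarrow> mrg_post y L R S (n1 + (n2 + (n + m))) k"
                using mrg_post_all[of y L R S _ j] R L by blast
              then show ?case using S(1,2) M(2) NN by auto
            qed (use W hM in \<open>auto simp: j_def\<close>)
          qed (use Suc.prems NN in auto)
          then show ?thesis
            using gt ng by (simp only: lv(1) rv(1) vt.case if_True if_False)
        next
          case eq
          define j where "j = ly a"
          have L: "ge j L" "\<not> ge (Suc j) L" "lh j L \<ge> 1" using NN wfL by (auto simp: j_def)
          have R: "ge j R" "\<not> ge (Suc j) R" using NN eq by (auto simp: j_def)
          have "wp t A2 (bnd (pop f l') (\<lambda>z. bnd (merge f (snd (snd z)) r') (\<lambda>m. link (fst z) (fst (snd z)) m)))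
            (\<lambda>B n u. \<exists>T. okT t G B u T \<and> ks T = ks L @ ks R \<and>
            (\<forall>k. ge k L \<and> ge k R \<longrightarrow> mrg_post y L R T (n1 + (n2 + n)) k))"
          proof (rule wp_bnd[OF wp_pop[OF okl _ L(1,2)]], goal_cases)
            case (2 B n z)
            then obtain T' Tg where z: "okT t G B (fst z) T'" "okT t G B (snd (snd z)) Tg"
              "ks L = ks T' @ key (fst (snd z)) # ks Tg" "ly (fst (snd z)) = j" "gl (fst (snd z)) \<in> G"
              "ky (fst (snd z)) \<in> vis t B" "pop_post L T' Tg n j" by blast
            have p: "ge j T'" "ge (Suc j) Tg" "lh j T' \<le> lh j L" "lh j L \<le> lh j T' + 1" "size Tg < size L" "n \<le> 46 * lh j L"
              "path_height y j Tg = path_height y j L" "ge j Tg" "lh j Tg = 0"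
              using z(7) Suc.prems(4) ge_mono[of "Suc j" Tg j] lh_ge[of j Tg] by (auto simp: pop_post_def)
            show ?case
            proof (rule wp_bnd[OF Suc.IH[OF z(2) okT_mono[OF okr 2(1)]]], goal_cases)
              case (4 C n' m)
              then obtain M where M: "okT t G C m M" "ks M = ks Tg @ ks R" "mrg_post y Tg R M n' j" using p R by blast
              have hM: "lh j M = lh j R" "ge j M" using M(3) p by (auto simp: mrg_post_def)
              have nM: "n' \<le> 32 * lh j R + 80 * (path_height y j L + path_height y j R) + 2" using M(3) p by (auto simp: mrg_post_def)
              show ?case
              proof (rule wp_mono[OF wp_link[OF okT_mono[OF z(1) 4(1)] M(1) vis_monoD[OF z(6) 4(1)] z(5), unfolded z(4)]], goal_cases)
                case (3 D m' w)
                then obtain S where S: "okT t G D w S" "ks S = ks T' @ (ky (fst (snd z)), st (fst (snd z))) # ks M" "ge j S"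
                  "hb (lh j T') (lh j M) (lh j S)" "m' \<le> 16 + 14 * ((lh j T' - lh j M) + (lh j M - lh j T'))" by blast
                have "m' \<le> 16 + 14 * (lh j L + lh j R)" using S(5) hM p by auto
                then have "n1 + n2 + (n + (n' + m')) \<le> 80 * (lh j L + lh j R + path_height y j L + path_height y j R) + 2"
                  using nM p(6) n12 L(3) unfolding distrib_left by linarith
                moreover have "lh j S \<le> 1 + max (lh j L) (lh j R)" "lh j L \<le> lh j R + 1 \<and> lh j R \<le> lh j L + 1 \<longrightarrow> max (lh j L) (lh j R) \<le> lh j S"
                  using S(4) hM p unfolding hb_def by auto
                ultimately have "mrg_post y L R S (n1 + (n2 + (n + (n' + m')))) j" using S(3) L R
                  by (simp add: mrg_post_def)
                then have "\<forall>k. ge k L \<and> ge k R \<longrightarrow> mrg_post y L R S (n1 + (n2 + (n + (n' + m')))) k"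
                  using mrg_post_all[of y L R S _ j] R L by blast
                then show ?case using S(1,2) M(2) z(3) by (auto simp: key_def)
              qed (use p hM in auto)
            qed (use Suc.prems p z in auto)
          qed (use Suc.prems NN in auto)
          then show ?thesis
            by (simp only: lv(1) rv(1) vt.case eq if_False less_irrefl)
        qed
      qed
    qed
  qed
qed simp

section \<open>Insertion into a prescribed layer\<close>

fun ins :: "nat \<Rightarrow> nd \<Rightarrow> vt \<Rightarrow> vt dt" where
  "ins 0 z u = Ret VL"
| "ins (Suc f) z u = bnd (opn u) (\<lambda>v. case v of VN l a r \<Rightarrow>
     if ly a \<le> ly z then
       (if ky z < ky a then bnd (ins f z l) (\<lambda>m. link m a r) else bnd (ins f z r) (\<lambda>m. link l a m))
     else bnd (split (Suc f) (ky z) v) (\<lambda>w. mk (fst w) z (snd w))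
   | _ \<Rightarrow> mk VL z VL)"

definition ins_post :: "nat \<Rightarrow> nd tree \<Rightarrow> nd tree \<Rightarrow> nat \<Rightarrow> nat \<Rightarrow> bool" where
  "ins_post y T T' n k \<longleftrightarrow> ge k T' \<and> lh k T \<le> lh k T' \<and> lh k T' \<le> lh k T + 1 \<and>
     n \<le> 50 * lh k T + 80 * path_height y k T + 10"

lemma ins_post_less:
  assumes "ins_post y T T' n j" "ge j T" "k < j" shows "ins_post y T T' n k"
  using assms path_height_conv[OF assms(2,3), of y] ge_mono[of j _ k] lh_ge_less[of j _ k]
  unfolding ins_post_def by auto

definition ins_ks :: "nd \<Rightarrow> nd tree \<Rightarrow> nd tree \<Rightarrow> bool" where
  "ins_ks z T T' \<longleftrightarrow> (\<exists>xs ys. ks T = xs @ ys \<and> ks T' = xs @ key z # ys \<and>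
     (\<forall>x\<in>fst ` set xs. x < ky z) \<and> (\<forall>x\<in>fst ` set ys. ky z < x))"

lemma wp_ins:
  assumes "okT t G A u T" "size T < f" "bst' T" "ky z \<notin> keys T" "ky z \<in> vis t A" "gl z \<in> G"
  shows "wp t A (ins f z u) (\<lambda>B n u. \<exists>T'. okT t G B u T' \<and> ins_ks z T T' \<and>
    (\<forall>k. k \<le> ly z \<and> ge k T \<longrightarrow> ins_post (ky z) T T' n k))"
  using assms
proof (induction f arbitrary: A u T)
  case (Suc f)
  show ?case
    unfolding ins.simps
  proof (rule wp_bnd[OF wp_opn1[OF okT_rep[OF Suc.prems(1) order_refl]]], goal_cases)
    case (1 A1 n1 v)
    note c1 = 1
    have vz: "ky z \<in> vis t A1" using Suc.prems(5) c1 vis_monoD by blast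
    show ?case
    proof (cases T)
      case Leaf
      have v: "v = VL" using c1 Leaf by simp
      have "okT t G A1 VL Leaf" by (simp add: okT_def)
      note w = wp_mk[OF this this vz Suc.prems(6)]
      show ?thesis unfolding v vt.case
      proof (rule wp_mono[OF w], goal_cases)
        case (5 B m u)
        then obtain T' where T': "m \<le> 2" "okT t G B u T'" "ks T' = [key z]" "ge (ly z) T'" "lh (ly z) T' = 1"
          by (auto simp: key_def)
        have "ins_post (ky z) T T' (n1 + m) (ly z)" using T' c1 Leaf by (simp add: ins_post_def)
        then have "\<forall>k. k \<le> ly z \<longrightarrow> ins_post (ky z) T T' (n1 + m) k"
          using ins_post_less[of "ky z" T T' _ "ly z"] Leaf by (auto simp: le_less)
        moreover have "ins_ks z T T'" using T' Leaf by (simp add: ins_ks_def)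
        ultimately show ?case using T' by blast
      qed auto
    next
      case (Node L a R)
      have wfT: "wf G (Node L a R)" using Suc.prems Node by (simp add: okT_def)
      obtain l r where v: "v = VN l a r" "okT t G A1 l L" "okT t G A1 r R" "ky a \<in> vis t A1"
        using rep1_NodeE[OF _ wfT] c1 Node by blast
      define j where "j = ly a"
      have W: "ge j L" "ge j R" "lh j L \<le> lh j R + 1" "lh j R \<le> lh j L + 1" "lh j T = 1 + max (lh j L) (lh j R)" "gl a \<in> G"
        using wfT Node by (auto simp: j_def)
      have all: "\<forall>k. k \<le> ly z \<and> ge k T \<longrightarrow> ins_post (ky z) T T' n k" if "ins_post (ky z) T T' n i" "ge i T" "i = j \<or> i = ly z \<and> i \<le> j" for T' n i
      proof (intro allI impI)
        fix k assume k: "k \<le> ly z \<and> ge k T"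
        then have "k \<le> i" using that(3) Node by (auto simp: j_def)
        then show "ins_post (ky z) T T' n k" using ins_post_less[OF that(1,2)] that(1) by (cases "k = i") auto
      qed
      show ?thesis
      proof (cases "j \<le> ly z")
        case False
        have ge: "ge (Suc (ly z)) T" "ge (ly z) T" using False Node by (auto simp: j_def)
        have okv: "okT t G A1 v T" using c1 Suc.prems by (auto simp: okT_def rep1_rep)
        have "wp t A1 (bnd (split (Suc f) (ky z) v) (\<lambda>w. mk (fst w) z (snd w))) (\<lambda>B n u. \<exists>T'. okT t G B u T' \<and>
          ins_ks z T T' \<and> (\<forall>k. k \<le> ly z \<and> ge k T \<longrightarrow> ins_post (ky z) T T' (n1 + n) k))"
        proof (rule wp_bnd[OF wp_split[OF okv Suc.prems(2,3,4)]], goal_cases)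
          case (1 B n w)
          then obtain T1 T2 where T: "okT t G B (fst w) T1" "okT t G B (snd w) T2" "ks T = ks T1 @ ks T2"
            "\<forall>x\<in>keys T1. x < ky z" "\<forall>x\<in>keys T2. ky z < x" "\<forall>k. ge k T \<longrightarrow> spl_post (ky z) T T1 T2 n k" by blast
          have s: "spl_post (ky z) T T1 T2 n (Suc (ly z))" "spl_post (ky z) T T1 T2 n (ly z)" using T(6) ge by auto
          have z: "lh (ly z) T1 = 0" "lh (ly z) T2 = 0" "ge (ly z) T1" "ge (ly z) T2" "lh (ly z) T = 0"
            using s ge by (auto simp: spl_post_def lh_ge)
          show ?case
          proof (rule wp_mono[OF wp_mk[OF T(1,2) vis_monoD[OF vz 1(1)] Suc.prems(6)]], goal_cases)
            case (5 C m u)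
            then obtain T' where T': "m \<le> 2" "okT t G C u T'" "ks T' = ks T1 @ key z # ks T2" "ge (ly z) T'" "lh (ly z) T' = 1"
              using z by (auto simp: key_def)
            have "ins_post (ky z) T T' (n1 + (n + m)) (ly z)" using T' c1 s z by (simp add: ins_post_def spl_post_def)
            then have "\<forall>k. k \<le> ly z \<and> ge k T \<longrightarrow> ins_post (ky z) T T' (n1 + (n + m)) k"
              using all[of T' _ "ly z"] ge(2) False by simp
            moreover have "ins_ks z T T'" unfolding ins_ks_def using T'(3) T(3-5) by blast
            ultimately show ?case using T' by blast
          qed (use z in auto)
        qed
        then show ?thesis using False by (simp add: v j_def)
      next
        case jz: True
        show ?thesis
        proof (cases "ky z < ky a")
          case True
          have yT: "path_height (ky z) j T = path_height (ky z) j L" using True Node by (simp add: j_def)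
          have "wp t A1 (bnd (ins f z l) (\<lambda>m. link m a r)) (\<lambda>B n u. \<exists>T'. okT t G B u T' \<and>
            ins_ks z T T' \<and> (\<forall>k. k \<le> ly z \<and> ge k T \<longrightarrow> ins_post (ky z) T T' (n1 + n) k))"
          proof (rule wp_bnd[OF Suc.IH[OF v(2)]], goal_cases)
            case (6 B n m)
            then obtain M where M: "okT t G B m M" "ins_ks z L M" "ins_post (ky z) L M n j" using W jz by blast
            have hM: "ge j M" "lh j L \<le> lh j M" "lh j M \<le> lh j L + 1" using M(3) by (auto simp: ins_post_def)
            show ?case
            proof (rule wp_mono[OF wp_link[OF M(1) okT_mono[OF v(3) 6(1)] vis_monoD[OF v(4) 6(1)] W(6), folded j_def]], goal_cases)
              case (3 C m' w)
              then obtain S where S: "okT t G C w S" "ks S = ks M @ (ky a, st a) # ks R" "ge j S"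
                "hb (lh j M) (lh j R) (lh j S)" "m' \<le> 16 + 14 * ((lh j M - lh j R) + (lh j R - lh j M))" by blast
              have a: "m' \<le> 44" "lh j T \<le> lh j S" "lh j S \<le> lh j T + 1" "1 + lh j L \<le> lh j T"
                using S(4,5) hM W unfolding hb_def by auto
              have "ins_post (ky z) T S (n1 + (n + m')) j" using S(3) a M(3) yT c1
                unfolding ins_post_def by simp
              then have "\<forall>k. k \<le> ly z \<and> ge k T \<longrightarrow> ins_post (ky z) T S (n1 + (n + m')) k"
                using all[of S _ j] Node by (simp add: j_def)
              moreover have "ins_ks z T S"
              proof -
                obtain xs ys where x: "ks L = xs @ ys" "ks M = xs @ key z # ys"
                  "\<forall>x\<in>fst ` set xs. x < ky z" "\<forall>x\<in>fst ` set ys. ky z < x" using M(2) by (auto simp: ins_ks_def)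
                have "ky z < x" if "x \<in> keys R" for x
                proof -
                  have "ky a < x" using that Suc.prems(3) Node by auto
                  then show ?thesis using True by simp
                qed
                then show ?thesis unfolding ins_ks_def
                  using x S(2) Node True
                  by (intro exI[of _ xs] exI[of _ "ys @ (ky a, st a) # ks R"]) (simp add: ball_Un image_Un)
              qed
              ultimately show ?case using S(1) by blast
            qed (use W hM in \<open>auto simp: j_def\<close>)
          qed (use Suc.prems Node vz in auto)
          then show ?thesis using jz True by (simp add: v j_def)
        next
          case False
          then have y: "ky a < ky z" using Suc.prems Node by force
          have yT: "path_height (ky z) j T = path_height (ky z) j R" using y Node by (simp add: j_def)
          have "wp t A1 (bnd (ins f z r) (\<lambda>m. link l a m)) (\<lambda>B n u. \<exists>T'. okT t G B u T' \<and>
            ins_ks z T T' \<and> (\<forall>k. k \<le> ly z \<and> ge k T \<longrightarrow> ins_post (ky z) T T' (n1 + n) k))"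
          proof (rule wp_bnd[OF Suc.IH[OF v(3)]], goal_cases)
            case (6 B n m)
            then obtain M where M: "okT t G B m M" "ins_ks z R M" "ins_post (ky z) R M n j" using W jz by blast
            have hM: "ge j M" "lh j R \<le> lh j M" "lh j M \<le> lh j R + 1" using M(3) by (auto simp: ins_post_def)
            show ?case
            proof (rule wp_mono[OF wp_link[OF okT_mono[OF v(2) 6(1)] M(1) vis_monoD[OF v(4) 6(1)] W(6), folded j_def]], goal_cases)
              case (3 C m' w)
              then obtain S where S: "okT t G C w S" "ks S = ks L @ (ky a, st a) # ks M" "ge j S"
                "hb (lh j L) (lh j M) (lh j S)" "m' \<le> 16 + 14 * ((lh j L - lh j M) + (lh j M - lh j L))" by blast
              have a: "m' \<le> 44" "lh j T \<le> lh j S" "lh j S \<le> lh j T + 1" "1 + lh j R \<le> lh j T"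
                using S(4,5) hM W unfolding hb_def by auto
              have "ins_post (ky z) T S (n1 + (n + m')) j" using S(3) a M(3) yT c1
                unfolding ins_post_def by simp
              then have "\<forall>k. k \<le> ly z \<and> ge k T \<longrightarrow> ins_post (ky z) T S (n1 + (n + m')) k"
                using all[of S _ j] Node by (simp add: j_def)
              moreover have "ins_ks z T S"
              proof -
                obtain xs ys where x: "ks R = xs @ ys" "ks M = xs @ key z # ys"
                  "\<forall>x\<in>fst ` set xs. x < ky z" "\<forall>x\<in>fst ` set ys. ky z < x" using M(2) by (auto simp: ins_ks_def)
                have "x < ky z" if "x \<in> keys L" for x
                proof -
                  have "x < ky a" using that Suc.prems(3) Node by auto
                  then show ?thesis using y by simp
                qed
                then show ?thesis unfolding ins_ks_def
                  using x S(2) Node y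
                  by (intro exI[of _ "ks L @ (ky a, st a) # xs"] exI[of _ ys]) (simp add: ball_Un image_Un)
              qed
              ultimately show ?case using S(1) by blast
            qed (use W hM in \<open>auto simp: j_def\<close>)
          qed (use Suc.prems Node vz in auto)
          then show ?thesis using jz False by (simp add: v j_def)
        qed
      qed
    qed
  qed
qed simp

section \<open>Deletion\<close>

lemma keys_left: "bst' (Node L a R) \<Longrightarrow> y < ky a \<Longrightarrow> (y, s) \<in> set (ks (Node L a R)) \<longleftrightarrow> (y, s) \<in> set (ks L)"
  by fastforce

lemma keys_right: "bst' (Node L a R) \<Longrightarrow> ky a < y \<Longrightarrow> (y, s) \<in> set (ks (Node L a R)) \<longleftrightarrow> (y, s) \<in> set (ks R)"
  by fastforce

lemma keys_iff: "y \<in> keys T \<longleftrightarrow> (\<exists>s. (y, s) \<in> set (ks T))"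
  by force

fun del :: "nat \<Rightarrow> nat \<Rightarrow> vt \<Rightarrow> (nd \<times> vt) dt" where
  "del 0 y u = Ret (undefined, VL)"
| "del (Suc f) y u = bnd (opn u) (\<lambda>v. case v of VN l a r \<Rightarrow>
     if y < ky a then bnd (del f y l) (\<lambda>z. bnd (link (snd z) a r) (\<lambda>m. Ret (fst z, m)))
     else if ky a < y then bnd (del f y r) (\<lambda>z. bnd (link l a (snd z)) (\<lambda>m. Ret (fst z, m)))
     else bnd (merge (Suc f) l r) (\<lambda>m. Ret (a, m))
   | _ \<Rightarrow> Ret (undefined, VL))"

text \<open>\<open>160 = 2 * 80\<close>: merging the two children of \<open>y\<close> pays for both
  of their heights.\<close>

definition del_post :: "nat \<Rightarrow> nd tree \<Rightarrow> nd tree \<Rightarrow> nat \<Rightarrow> nat \<Rightarrow> bool" where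
  "del_post y T T' n k \<longleftrightarrow> ge k T' \<and> lh k T' \<le> lh k T \<and> lh k T \<le> lh k T' + 1 \<and>
     n \<le> 160 * (lh k T + path_height y k T) + 3"

lemma del_post_less:
  assumes "del_post y T T' n j" "ge j T" "k < j" shows "del_post y T T' n k"
  using assms path_height_conv[OF assms(2,3), of y] ge_mono[of j _ k] lh_ge_less[of j _ k]
  unfolding del_post_def by auto

lemma del_post_all: "del_post y (Node L a R) T' n (ly a) \<Longrightarrow> ge k (Node L a R) \<Longrightarrow> del_post y (Node L a R) T' n k"
  using del_post_less[of y "Node L a R" T' n "ly a" k] by (cases "k = ly a") auto

definition del_ks :: "nat \<Rightarrow> nd tree \<Rightarrow> nd tree \<Rightarrow> bool" where
  "del_ks y T T' \<longleftrightarrow> (\<exists>xs s ys. ks T = xs @ (y, s) # ys \<and> ks T' = xs @ ys)"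

lemma wp_del:
  assumes "okT t G A u T" "size T < f" "bst' T" "y \<in> keys T"
  shows "wp t A (del f y u) (\<lambda>B n z. \<exists>T'. okT t G B (snd z) T' \<and> del_ks y T T' \<and> y \<in> vis t B \<and> gl (fst z) \<in> G \<and>
    (\<forall>k. ge k T \<longrightarrow> del_post y T T' n k))"
  using assms
proof (induction f arbitrary: A u T)
  case (Suc f)
  obtain L a R where T: "T = Node L a R" using Suc.prems by (cases T) auto
  have wfT: "wf G (Node L a R)" using Suc.prems T by (simp add: okT_def)
  define j where "j = ly a"
  have W: "ge j L" "ge j R" "lh j L \<le> lh j R + 1" "lh j R \<le> lh j L + 1" "lh j T = 1 + max (lh j L) (lh j R)" "gl a \<in> G"
    using wfT T by (auto simp: j_def)
  show ?case
    unfolding del.simps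
  proof (rule wp_bnd[OF wp_opn1[OF okT_rep[OF Suc.prems(1) order_refl]]], goal_cases)
    case (1 A1 n1 v)
    note c1 = 1
    obtain l r where v: "v = VN l a r" "okT t G A1 l L" "okT t G A1 r R" "ky a \<in> vis t A1"
      using rep1_NodeE[OF _ wfT] c1 T by blast
    have all: "\<forall>k. ge k T \<longrightarrow> del_post y T T' n k" if "del_post y T T' n j" for T' n
      using that del_post_all unfolding T j_def by blast
    consider (lt) "y < ky a" | (gt) "ky a < y" | (eq) "y = ky a" by linarith
    then show ?case
    proof cases
      case lt
      have yT: "path_height y j T = path_height y j L" using lt T by (simp add: j_def)
      have yL: "y \<in> keys L" using keys_left[OF Suc.prems(3)[unfolded T] lt] Suc.prems(4) T unfolding keys_iff by blast
      have "wp t A1 (bnd (del f y l) (\<lambda>z. bnd (link (snd z) a r) (\<lambda>m. Ret (fst z, m)))) (\<lambda>B n z. \<exists>T'. okT t G B (snd z) T' \<and>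
        del_ks y T T' \<and> y \<in> vis t B \<and> gl (fst z) \<in> G \<and> (\<forall>k. ge k T \<longrightarrow> del_post y T T' (n1 + n) k))"
      proof (rule wp_bnd[OF Suc.IH[OF v(2)]], goal_cases)
        case (4 B n z)
        then obtain M where M: "okT t G B (snd z) M" "del_ks y L M" "del_post y L M n j" "y \<in> vis t B" "gl (fst z) \<in> G" using W by blast
        have hM: "ge j M" "lh j M \<le> lh j L" "lh j L \<le> lh j M + 1" using M(3) by (auto simp: del_post_def)
        show ?case
        proof (rule wp_bnd[OF wp_link[OF M(1) okT_mono[OF v(3) 4(1)] vis_monoD[OF v(4) 4(1)] W(6), folded j_def]], goal_cases)
          case (3 C m' w)
          then obtain S where S: "okT t G C w S" "ks S = ks M @ (ky a, st a) # ks R" "ge j S"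
            "hb (lh j M) (lh j R) (lh j S)" "m' \<le> 16 + 14 * ((lh j M - lh j R) + (lh j R - lh j M))" by blast
          have a: "m' \<le> 44" "lh j T \<le> lh j S + 1" "lh j S \<le> lh j T" "1 + lh j L \<le> lh j T"
            using S(4,5) hM W unfolding hb_def by auto
          have "del_post y T S (n1 + (n + m')) j" using S(3) a M(3) yT c1
            unfolding del_post_def by simp
          moreover have "del_ks y T S"
          proof -
            obtain xs s ys where x: "ks L = xs @ (y, s) # ys" "ks M = xs @ ys" using M(2) by (auto simp: del_ks_def)
            show ?thesis unfolding del_ks_def
              by (rule exI[of _ xs], rule exI[of _ s], rule exI[of _ "ys @ (ky a, st a) # ks R"]) (use x S(2) T in auto)
          qed
          ultimately show ?case unfolding wp_Ret add_0_right fst_conv snd_conv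
            using S(1) M(5) vis_monoD[OF M(4) 3(1)] all by blast
        qed (use W hM in \<open>auto simp: j_def\<close>)
      qed (use Suc.prems T yL in auto)
      then show ?thesis using lt by (simp add: v)
    next
      case gt
      have yT: "path_height y j T = path_height y j R" using gt T by (simp add: j_def)
      have yR: "y \<in> keys R" using keys_right[OF Suc.prems(3)[unfolded T] gt] Suc.prems(4) T unfolding keys_iff by blast
      have "wp t A1 (bnd (del f y r) (\<lambda>z. bnd (link l a (snd z)) (\<lambda>m. Ret (fst z, m)))) (\<lambda>B n z. \<exists>T'. okT t G B (snd z) T' \<and>
        del_ks y T T' \<and> y \<in> vis t B \<and> gl (fst z) \<in> G \<and> (\<forall>k. ge k T \<longrightarrow> del_post y T T' (n1 + n) k))"
      proof (rule wp_bnd[OF Suc.IH[OF v(3)]], goal_cases)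
        case (4 B n z)
        then obtain M where M: "okT t G B (snd z) M" "del_ks y R M" "del_post y R M n j" "y \<in> vis t B" "gl (fst z) \<in> G" using W by blast
        have hM: "ge j M" "lh j M \<le> lh j R" "lh j R \<le> lh j M + 1" using M(3) by (auto simp: del_post_def)
        show ?case
        proof (rule wp_bnd[OF wp_link[OF okT_mono[OF v(2) 4(1)] M(1) vis_monoD[OF v(4) 4(1)] W(6), folded j_def]], goal_cases)
          case (3 C m' w)
          then obtain S where S: "okT t G C w S" "ks S = ks L @ (ky a, st a) # ks M" "ge j S"
            "hb (lh j L) (lh j M) (lh j S)" "m' \<le> 16 + 14 * ((lh j L - lh j M) + (lh j M - lh j L))" by blast
          have a: "m' \<le> 44" "lh j T \<le> lh j S + 1" "lh j S \<le> lh j T" "1 + lh j R \<le> lh j T"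
            using S(4,5) hM W unfolding hb_def by auto
          have "del_post y T S (n1 + (n + m')) j" using S(3) a M(3) yT c1
            unfolding del_post_def by simp
          moreover have "del_ks y T S"
          proof -
            obtain xs s ys where x: "ks R = xs @ (y, s) # ys" "ks M = xs @ ys" using M(2) by (auto simp: del_ks_def)
            show ?thesis unfolding del_ks_def
              by (rule exI[of _ "ks L @ (ky a, st a) # xs"], rule exI[of _ s], rule exI[of _ ys]) (use x S(2) T in auto)
          qed
          ultimately show ?case unfolding wp_Ret add_0_right fst_conv snd_conv
            using S(1) M(5) vis_monoD[OF M(4) 3(1)] all by blast
        qed (use W hM in \<open>auto simp: j_def\<close>)
      qed (use Suc.prems T yR in auto)
      then show ?thesis using gt by (simp add: v)
    next
      case eq
      have yT: "path_height y j T = path_height y j L + path_height y j R" using eq T by (simp add: j_def)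
      have "wp t A1 (bnd (merge (Suc f) l r) (\<lambda>m. Ret (a, m))) (\<lambda>B n z. \<exists>T'. okT t G B (snd z) T' \<and>
        del_ks y T T' \<and> y \<in> vis t B \<and> gl (fst z) \<in> G \<and> (\<forall>k. ge k T \<longrightarrow> del_post y T T' (n1 + n) k))"
      proof (rule wp_bnd[OF wp_merge[OF v(2,3), of _ y]], goal_cases)
        case (4 B n m)
        then obtain M where M: "okT t G B m M" "ks M = ks L @ ks R" "mrg_post y L R M n j" using W by blast
        have "lh j L + lh j R \<le> 2 * lh j T" "lh j M \<le> lh j T" "lh j T \<le> lh j M + 1"
          using M(3) W unfolding mrg_post_def by auto
        then have "del_post y T M (n1 + n) j" using M(3) yT c1 unfolding del_post_def mrg_post_def by simp
        moreover have "del_ks y T M" unfolding del_ks_def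
          by (rule exI[of _ "ks L"], rule exI[of _ "st a"], rule exI[of _ "ks R"]) (use M(2) T eq in simp)
        moreover have "y \<in> vis t B" using vis_monoD[OF v(4) 4(1)] eq by simp
        ultimately show ?case unfolding wp_Ret add_0_right fst_conv snd_conv using M(1) W(6) all by blast
      qed (use Suc.prems T eq in auto)
      then show ?thesis using eq by (simp add: v)
    qed
  qed
qed simp

section \<open>Lookup by status and depth-bounded search\<close>

fun find :: "nat \<Rightarrow> nat \<times> nat \<Rightarrow> vt \<Rightarrow> nat dt" where
  "find 0 s u = Ret 0"
| "find (Suc f) s u = bnd (opn u) (\<lambda>v. case v of VN l a r \<Rightarrow>
     if st a = s then Ret (ky a) else bnd (opn l) (\<lambda>l. if s \<in> vsm l then find f s l else find f s r)
   | _ \<Rightarrow> Ret 0)"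

definition height_bounded :: "(nat \<Rightarrow> nat) \<Rightarrow> nat \<Rightarrow> nd tree \<Rightarrow> bool" where
  "height_bounded b j T \<longleftrightarrow> (\<forall>a\<in>set_tree T. ly a \<le> j \<longrightarrow> ht a \<le> b (ly a))"

lemma lh_sum_less:
  assumes "ge i T" "k < i" "i \<le> j" "height_bounded b j T"
  shows "lh i T + (\<Sum>x\<in>{i<..j}. b x) \<le> lh k T + (\<Sum>x\<in>{k<..j}. b x)"
proof -
  have "lh i T \<le> b i" using assms by (cases T) (auto simp: height_bounded_def)
  moreover have "b i + (\<Sum>x\<in>{i<..j}. b x) = sum b (insert i {i<..j})" by simp
  moreover have "sum b (insert i {i<..j}) \<le> sum b {k<..j}" by (rule sum_mono2) (use assms in auto)
  ultimately show ?thesis by simp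
qed

text \<open>The summaries \<open>sm\<close> lead to a node of status \<open>s\<close>. All nodes
  above it lie in layers up to \<open>fst s\<close>, so only the heights of these layers are met,
  each once.\<close>

lemma wp_find:
  assumes "okT t G A u T" "size T < f" "s \<in> snd ` set (ks T)" "fst s \<le> j" "height_bounded b j T"
  shows "wp t A (find f s u) (\<lambda>B n y. (y, s) \<in> set (ks T) \<and>
    (\<forall>k. ge k T \<longrightarrow> n \<le> 2 * (lh k T + (\<Sum>x\<in>{k<..j}. b x)) + 2))"
  using assms
proof (induction f arbitrary: A u T)
  case (Suc f)
  obtain L a R where T: "T = Node L a R" using Suc.prems by (cases T) auto
  have wfT: "wf G (Node L a R)" using Suc.prems T by (simp add: okT_def)
  define i where "i = ly a"
  obtain y0 where "(y0, s) \<in> set (ks T)" using Suc.prems(3) by auto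
  then have "i \<le> fst s" using ge_ks[OF wfT, of i "(y0, s)"] T by (simp add: i_def)
  then have ij: "i \<le> j" using Suc.prems by simp
  have W: "ge i L" "ge i R" "lh i L + 1 \<le> lh i T" "lh i R + 1 \<le> lh i T" "gl a \<in> G" "height_bounded b j L" "height_bounded b j R"
    using wfT T Suc.prems(5) by (auto simp: i_def height_bounded_def)
  have all: "\<forall>k. ge k T \<longrightarrow> n \<le> 2 * (lh k T + (\<Sum>x\<in>{k<..j}. b x)) + 2" if "n \<le> 2 * (lh i T + (\<Sum>x\<in>{i<..j}. b x)) + 2" for n
  proof (intro allI impI)
    fix k assume "ge k T"
    then have "k \<le> i" "ge i T" using T by (auto simp: i_def)
    then show "n \<le> 2 * (lh k T + (\<Sum>x\<in>{k<..j}. b x)) + 2"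
      using that lh_sum_less[of i T k j b] ij Suc.prems(5) by (cases "k = i") auto
  qed
  show ?case
    unfolding find.simps
  proof (rule wp_bnd[OF wp_opn1[OF okT_rep[OF Suc.prems(1) order_refl]]], goal_cases)
    case (1 A1 n1 v)
    note c1 = 1
    obtain l r where v: "v = VN l a r" "okT t G A1 l L" "okT t G A1 r R" "ky a \<in> vis t A1"
      using rep1_NodeE[OF _ wfT] c1 T by blast
    show ?case
    proof (cases "st a = s")
      case True
      then have "(ky a, s) \<in> set (ks T)" using T by simp
      then show ?thesis using True conjunct1[OF c1(2)] by (simp add: v(1))
    next
      case False
      have "wp t A1 (bnd (opn l) (\<lambda>l. if s \<in> vsm l then find f s l else find f s r)) (\<lambda>B n y. (y, s) \<in> set (ks T) \<and>
        (\<forall>k. ge k T \<longrightarrow> n1 + n \<le> 2 * (lh k T + (\<Sum>x\<in>{k<..j}. b x)) + 2))"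
      proof (rule wp_bnd[OF wp_opn1[OF okT_rep[OF v(2) order_refl]]], goal_cases)
        case (1 A2 n2 l')
        have okl: "okT t G A2 l' L" using 1 wfT by (auto simp: okT_def rep1_rep)
        have okr: "okT t G A2 r R" using v okT_mono 1 by blast
        have vs: "vsm l' = snd ` set (ks L)" using rep1_vsm[of t A2 l' L] sms_ks[of G L] 1(2) wfT by simp
        show ?case
        proof (cases "s \<in> vsm l'")
          case True
          have "wp t A2 (find f s l') (\<lambda>B n y. (y, s) \<in> set (ks T) \<and>
            (\<forall>k. ge k T \<longrightarrow> n1 + (n2 + n) \<le> 2 * (lh k T + (\<Sum>x\<in>{k<..j}. b x)) + 2))"
          proof (rule wp_mono[OF Suc.IH[OF okl _ _ Suc.prems(4) W(6)]], goal_cases)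
            case (3 B m y)
            note 5 = 3
            then have "m \<le> 2 * (lh i L + (\<Sum>x\<in>{i<..j}. b x)) + 2" using W(1) by simp
            then have "n1 + (n2 + m) \<le> 2 * (lh i T + (\<Sum>x\<in>{i<..j}. b x)) + 2" using W(3) conjunct1[OF c1(2)] conjunct1[OF 1(2)] unfolding distrib_left by linarith
            moreover have "(y, s) \<in> set (ks T)" using 5(2) T by simp
            ultimately show ?case using all by blast
          qed (use Suc.prems(2) T True vs in auto)
          then show ?thesis using True by simp
        next
          case F: False
          have "wp t A2 (find f s r) (\<lambda>B n y. (y, s) \<in> set (ks T) \<and>
            (\<forall>k. ge k T \<longrightarrow> n1 + (n2 + n) \<le> 2 * (lh k T + (\<Sum>x\<in>{k<..j}. b x)) + 2))"
          proof (rule wp_mono[OF Suc.IH[OF okr _ _ Suc.prems(4) W(7)]], goal_cases)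
            case (3 B m y)
            note 5 = 3
            then have "m \<le> 2 * (lh i R + (\<Sum>x\<in>{i<..j}. b x)) + 2" using W(2) by simp
            then have "n1 + (n2 + m) \<le> 2 * (lh i T + (\<Sum>x\<in>{i<..j}. b x)) + 2" using W(4) conjunct1[OF c1(2)] conjunct1[OF 1(2)] unfolding distrib_left by linarith
            moreover have "(y, s) \<in> set (ks T)" using 5(2) T by simp
            ultimately show ?case using all by blast
          qed (use Suc.prems(2,3) T F False vs in auto)
          then show ?thesis using F by simp
        qed
      qed
      then show ?thesis using False by (simp add: v)
    qed
  qed
qed simp

fun srch :: "nat \<Rightarrow> nat \<Rightarrow> vt \<Rightarrow> (nat \<times> nat) option dt" where
  "srch 0 y u = Ret None"
| "srch (Suc d) y u = bnd (opn u) (\<lambda>v. case v of VN l a r \<Rightarrow>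
     if y < ky a then srch d y l else if ky a < y then srch d y r else Ret (Some (st a))
   | _ \<Rightarrow> Ret None)"

text \<open>The last clause is the purpose of the depth bound: keys of layers up to \<open>j\<close>
  are found within the sum of the heights of these layers, so \<open>None\<close> after that many
  steps shows that the key is in none of them. The clause on \<open>size T\<close> serves the final
  search for the accessed key, whose cost comes from \<open>path_height\<close>.\<close>

definition srch_post :: "nat \<Rightarrow> nd tree \<Rightarrow> nat \<Rightarrow> nat \<Rightarrow> (nat \<times> nat) option \<Rightarrow> bool" where
  "srch_post y T d n r \<longleftrightarrow> n \<le> d \<and> (\<forall>s. r = Some s \<longrightarrow> (y, s) \<in> set (ks T)) \<and>
    (\<forall>k. ge k T \<longrightarrow> n \<le> 1 + lh k T + path_height y k T) \<and>
    (\<forall>s. size T \<le> d \<longrightarrow> (y, s) \<in> set (ks T) \<longrightarrow> r = Some s) \<and>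
    (\<forall>s k j b. height_bounded b j T \<longrightarrow> fst s \<le> j \<longrightarrow> (y, s) \<in> set (ks T) \<longrightarrow> ge k T \<longrightarrow>
       lh k T + (\<Sum>x\<in>{k<..j}. b x) \<le> d \<longrightarrow> r = Some s)"

lemma srch_post_child:
  assumes c: "srch_post y C d n r" "C = L \<and> y < ky a \<or> C = R \<and> ky a < y" and T: "T = Node L a R" "wf G T" "bst' T"
    and y: "n1 \<le> 1"
  shows "srch_post y T (Suc d) (n1 + n) r"
proof -
  define i where "i = ly a"
  have W: "ge i C" "lh i C + 1 \<le> lh i T" "path_height y i T = path_height y i C" "ge i T" "lh i T = ht a" "size C < size T"
    using assms by (auto simp: i_def)
  have S: "(y, s) \<in> set (ks T) \<longleftrightarrow> (y, s) \<in> set (ks C)" for s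
    using c(2) keys_left[of L a R y s] keys_right[of L a R y s] T(1,3) by blast
  note C = c(1)[unfolded srch_post_def]
  show ?thesis unfolding srch_post_def
  proof (intro conjI allI impI)
    show "n1 + n \<le> Suc d" using C y by linarith
    show "(y, s) \<in> set (ks T)" if "r = Some s" for s using that S C by blast
    show "n1 + n \<le> 1 + lh k T + path_height y k T" if "ge k T" for k
    proof -
      have "n \<le> 1 + lh i C + path_height y i C" using C W(1) by blast
      moreover have "k = i \<or> path_height y k T = lh i T + path_height y i T" using that path_height_conv[OF W(4)] T(1) by (auto simp: i_def)
      ultimately show ?thesis using W(2,3) y by auto
    qed
    show "r = Some s" if "size T \<le> Suc d" "(y, s) \<in> set (ks T)" for s
    proof -
      have "size C \<le> d" using that(1) W(6) by simp
      then show ?thesis using C S that(2) by blast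
    qed
    show "r = Some s" if h: "height_bounded b j T" "fst s \<le> j" "(y, s) \<in> set (ks T)" "ge k T"
       "lh k T + (\<Sum>x\<in>{k<..j}. b x) \<le> Suc d" for s k j b
    proof -
      have "i \<le> j" using ge_ks[OF T(2) W(4) h(3)] h(2) by simp
      moreover have "k \<le> i" using h(4) T(1) by (simp add: i_def)
      ultimately have "lh i T + (\<Sum>x\<in>{i<..j}. b x) \<le> Suc d"
        using lh_sum_less[OF W(4) _ _ h(1), of k] h(5) by (cases "k = i") auto
      then have "lh i C + (\<Sum>x\<in>{i<..j}. b x) \<le> d" using W(2) by simp
      moreover have "height_bounded b j C" using h(1) c(2) T(1) by (auto simp: height_bounded_def)
      ultimately show ?thesis using C h(2,3) S W(1) by blast
    qed
  qed
qed

lemma wp_srch: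
  assumes "okT t G A u T" "bst' T"
  shows "wp t A (srch d y u) (\<lambda>B n r. srch_post y T d n r \<and> (r \<noteq> None \<longrightarrow> y \<in> vis t B))"
  using assms
proof (induction d arbitrary: A u T)
  case 0
  have "T = Leaf" if "height_bounded b j T" "fst s \<le> j" "(y, s) \<in> set (ks T)" "ge k T" "lh k T + (\<Sum>x\<in>{k<..j}. b x) = 0" for s k j b
  proof (rule ccontr)
    assume "T \<noteq> Leaf"
    then obtain L a R where T: "T = Node L a R" by (cases T) auto
    have w: "wf G T" using 0 by (simp add: okT_def)
    then have i: "ge (ly a) T" "lh (ly a) T \<ge> 1" using T by auto
    then have "ly a \<le> j" using ge_ks[OF w i(1) that(3)] that by simp
    then have "lh (ly a) T \<le> 0" using lh_sum_less[OF i(1) _ _ that(1), of k] that T by (cases "k = ly a") auto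
    then show False using i by simp
  qed
  then have F: False if "height_bounded b j T" "fst s \<le> j" "(y, s) \<in> set (ks T)" "ge k T" "lh k T + (\<Sum>x\<in>{k<..j}. b x) \<le> 0" for s k j b
    using that by (metis le_zero_eq ks_simps(1) empty_iff list.set(1))
  have "srch_post y T 0 0 None" unfolding srch_post_def
  proof (intro conjI allI impI)
    show "None = Some s" if "size T \<le> 0" "(y, s) \<in> set (ks T)" for s using that by simp
  qed (use F in \<open>simp, simp, simp, blast\<close>)
  then show ?case by simp
next
  case (Suc d)
  show ?case
    unfolding srch.simps
  proof (rule wp_bnd[OF wp_opn1[OF okT_rep[OF Suc.prems(1) order_refl]]], goal_cases)
    case (1 A1 n1 v)
    note c1 = 1
    show ?case
    proof (cases T)
      case Leaf
      then show ?thesis using c1 by (auto simp: srch_post_def)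
    next
      case (Node L a R)
      have wfT: "wf G (Node L a R)" using Suc.prems Node by (simp add: okT_def)
      obtain l r where v: "v = VN l a r" "okT t G A1 l L" "okT t G A1 r R" "ky a \<in> vis t A1"
        using rep1_NodeE[OF _ wfT] c1 Node by blast
      have b: "bst' L" "bst' R" using Suc.prems Node by auto
      consider (lt) "y < ky a" | (gt) "ky a < y" | (eq) "y = ky a" by linarith
      then show ?thesis
      proof cases
        case lt
        have "wp t A1 (srch d y l) (\<lambda>B n r. srch_post y T (Suc d) (n1 + n) r \<and> (r \<noteq> None \<longrightarrow> y \<in> vis t B))"
          by (rule wp_mono[OF Suc.IH[OF v(2) b(1)]])
            (use srch_post_child[OF _ _ Node wfT[folded Node] Suc.prems(2), of y L d _ _ n1] lt c1(2) in simp)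
        then show ?thesis using lt by (simp add: v)
      next
        case gt
        have "wp t A1 (srch d y r) (\<lambda>B n r. srch_post y T (Suc d) (n1 + n) r \<and> (r \<noteq> None \<longrightarrow> y \<in> vis t B))"
          by (rule wp_mono[OF Suc.IH[OF v(3) b(2)]])
            (use srch_post_child[OF _ _ Node wfT[folded Node] Suc.prems(2), of y R d _ _ n1] gt c1(2) in simp)
        then show ?thesis using gt by (simp add: v)
      next
        case eq
        have "(ky a, s) \<in> set (ks T) \<longleftrightarrow> s = st a" for s using Suc.prems(2)[unfolded Node bst'_Node] Node by fastforce
        then have "srch_post y T (Suc d) n1 (Some (st a))" unfolding srch_post_def eq using c1(2)
          by (intro conjI allI impI) (simp_all, blast?)
        then show ?thesis using eq v by simp
      qed
    qed
  qed
qed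

section \<open>Heights and search paths in terms of the separators\<close>

definition lay :: "nat \<Rightarrow> nd tree \<Rightarrow> nat set" where
  "lay i T = fst ` {p \<in> set (ks T). fst (snd p) = i}"

lemma finite_lay [simp]: "finite (lay i T)"
  by (simp add: lay_def)

lemma card_lay_Node:
  assumes "bst' (Node l a r)" "ly a = i"
  shows "card (lay i (Node l a r)) = Suc (card (lay i l) + card (lay i r))"
proof -
  have e: "lay i (Node l a r) = insert (ky a) (lay i l \<union> lay i r)"
    unfolding lay_def ks_simps using assms(2) by (auto intro: rev_image_eqI[of "(ky a, st a)"])
  have "\<forall>x\<in>lay i l. x < ky a" "\<forall>x\<in>lay i r. ky a < x" using assms(1) by (auto simp: lay_def)
  then have "ky a \<notin> lay i l \<union> lay i r" "lay i l \<inter> lay i r = {}" by (auto, force)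
  then show ?thesis by (simp add: e card_Un_disjoint)
qed

text \<open>AVL height is at most twice a logarithm: both children have height at least
  \<open>h - 2\<close>, so with \<open>A\<close> and \<open>B\<close> one more than their numbers of
  nodes in the layer, \<open>2 ^ h \<le> 4 * min A B ^ 2 \<le> (A + B) ^ 2\<close>.\<close>

lemma two_pow_lh: "wf G T \<Longrightarrow> bst' T \<Longrightarrow> ge k T \<Longrightarrow> 2 ^ lh k T \<le> (1 + card (lay k T))\<^sup>2"
proof (induction T)
  case (Node l a r)
  show ?case
  proof (cases "ly a = k")
    case True
    define h where "h = lh k (Node l a r)"
    have IH: "2 ^ lh k l \<le> (1 + card (lay k l))\<^sup>2" "2 ^ lh k r \<le> (1 + card (lay k r))\<^sup>2"
      using Node True by auto
    have h: "h \<le> lh k l + 2" "h \<le> lh k r + 2" "h \<ge> 1" using Node.prems True by (auto simp: h_def)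
    define A where "A = 1 + card (lay k l)"
    define B where "B = 1 + card (lay k r)"
    have le: "2 ^ h \<le> 4 * A\<^sup>2" "2 ^ h \<le> 4 * B\<^sup>2"
    proof -
      have "(2::nat) ^ h \<le> 2 ^ (lh k l + 2)" "(2::nat) ^ h \<le> 2 ^ (lh k r + 2)" 
        by (rule power_increasing[OF h(1)], simp) (rule power_increasing[OF h(2)], simp)
      then show "2 ^ h \<le> 4 * A\<^sup>2" "2 ^ h \<le> 4 * B\<^sup>2" using IH by (auto simp: A_def B_def power_add)
    qed
    have "4 * min A B ^ 2 \<le> (A + B)\<^sup>2"
    proof -
      have "(2 * min A B)\<^sup>2 \<le> (A + B)\<^sup>2" by (rule power_mono) auto
      then show ?thesis by (simp add: power_mult_distrib)
    qed
    moreover have "2 ^ h \<le> 4 * min A B ^ 2" using le by (auto simp: min_def)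
    moreover have "1 + card (lay k (Node l a r)) = A + B"
      using card_lay_Node[OF Node.prems(2) True] by (simp add: A_def B_def)
    ultimately show ?thesis by (simp add: h_def)
  qed simp
qed simp

lemma lay_child: "lay i l \<subseteq> lay i (Node l a r)" "lay i r \<subseteq> lay i (Node l a r)"
  by (auto simp: lay_def)

lemma two_pow_ht:
  assumes "wf G T" "bst' T" "a \<in> set_tree T"
  shows "2 ^ ht a \<le> (1 + card (lay (ly a) T))\<^sup>2"
  using assms
proof (induction T)
  case (Node l b r)
  have m: "2 ^ ht a \<le> (1 + card (lay (ly a) (Node l b r)))\<^sup>2"
    if "2 ^ ht a \<le> (1 + card (lay (ly a) C))\<^sup>2" "lay (ly a) C \<subseteq> lay (ly a) (Node l b r)" for C
  proof -
    have "(1 + card (lay (ly a) C))\<^sup>2 \<le> (1 + card (lay (ly a) (Node l b r)))\<^sup>2"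
      by (rule power_mono) (use card_mono[OF _ that(2)] in auto)
    then show ?thesis using that(1) by linarith
  qed
  consider "a = b" | "a \<in> set_tree l" | "a \<in> set_tree r" using Node.prems by auto
  then show ?case
  proof cases
    case 1
    then show ?thesis using two_pow_lh[OF Node.prems(1,2), of "ly b"] by simp
  next
    case 2
    then show ?thesis using Node m lay_child by auto
  next
    case 3
    then show ?thesis using Node m lay_child by auto
  qed
qed simp

fun ps :: "nat \<Rightarrow> nd tree \<Rightarrow> nd tree set" where
  "ps y Leaf = {}"
| "ps y (Node l a r) = insert (Node l a r)
     (if y < ky a then ps y l else if ky a < y then ps y r else ps y l \<union> ps y r)"

lemma ps_sub: "v \<in> ps y T \<Longrightarrow> wf G T \<Longrightarrow> bst' T \<Longrightarrow> wf G v \<and> bst' v \<and> set (ks v) \<subseteq> set (ks T)"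
proof (induction T)
  case (Node l a r)
  consider "v = Node l a r" | "v \<in> ps y l" | "v \<in> ps y r" using Node.prems(1) by (auto split: if_splits)
  then show ?case
  proof cases
    case 2
    then show ?thesis using Node.IH(1) Node.prems by auto
  next
    case 3
    then show ?thesis using Node.IH(2) Node.prems by auto
  qed (use Node.prems in simp)
qed simp

text \<open>A key \<open>s\<close> outside \<open>v\<close> was cut off by a comparison at some
  ancestor of \<open>v\<close>, possibly with \<open>s\<close> itself, so all of \<open>v\<close>
  lies on the same side of \<open>s\<close> as \<open>y\<close>.\<close>

lemma ps_local:
  "v \<in> ps y T \<Longrightarrow> bst' T \<Longrightarrow> s \<in> keys T \<Longrightarrow> s \<notin> keys v \<Longrightarrow> z \<in> keys v \<Longrightarrow>
    (y < s \<longrightarrow> z < s) \<and> (s < y \<longrightarrow> s < z)"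
proof (induction T)
  case (Node l a r)
  have b: "bst' l" "bst' r" "\<And>x. x \<in> keys l \<Longrightarrow> x < ky a" "\<And>x. x \<in> keys r \<Longrightarrow> ky a < x"
    using Node.prems(2) by auto
  have sub: "C = l \<or> C = r \<Longrightarrow> v \<in> ps y C \<Longrightarrow> z \<in> keys C" for C
  proof -
    have "v \<in> ps y C \<Longrightarrow> keys v \<subseteq> keys C" for C by (induction C) (auto split: if_splits)
    then show "C = l \<or> C = r \<Longrightarrow> v \<in> ps y C \<Longrightarrow> z \<in> keys C" using Node.prems(5) by blast
  qed
  consider (r) "v = Node l a r" | (l) "v \<in> ps y l" "y \<le> ky a" | (rr) "v \<in> ps y r" "ky a \<le> y"
    using Node.prems(1) by (auto split: if_splits)
  then show ?case
  proof cases
    case r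
    then show ?thesis using Node.prems by auto
  next
    case l
    have z: "z < ky a" using sub[of l] l b by blast
    consider "s \<in> keys l" | "s = ky a" | "s \<in> keys r" using Node.prems(3) by auto
    then show ?thesis
    proof cases
      case 1
      then show ?thesis using Node.IH(1)[OF l(1) b(1) _ Node.prems(4,5)] by blast
    qed (use z l b(4)[of s] in auto)
  next
    case rr
    have z: "ky a < z" using sub[of r] rr b by blast
    consider "s \<in> keys l" | "s = ky a" | "s \<in> keys r" using Node.prems(3) by auto
    then show ?thesis
    proof cases
      case 3
      then show ?thesis using Node.IH(2)[OF rr(1) b(2) _ Node.prems(4,5)] by blast
    qed (use z rr b(3)[of s] in auto)
  qed
qed simp

definition path_bounded :: "(nat \<Rightarrow> nat) \<Rightarrow> nat \<Rightarrow> nat \<Rightarrow> nd tree \<Rightarrow> bool" where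
  "path_bounded b m y T \<longleftrightarrow> (\<forall>l a r. Node l a r \<in> ps y T \<longrightarrow> ht a \<le> b (ly a) \<and> ly a \<le> m)"

lemma sum_bd_less:
  fixes b :: "nat \<Rightarrow> nat"
  assumes "k < i" "i \<le> m" shows "b i + sum b {i<..m} \<le> sum b {k<..m}"
proof -
  have "b i + sum b {i<..m} = sum b (insert i {i<..m})" by simp
  also have "\<dots> \<le> sum b {k<..m}" by (rule sum_mono2) (use assms in auto)
  finally show ?thesis .
qed

text \<open>Layers never decrease on the way down and \<open>ht\<close> is charged on entering a
  layer only, so each layer contributes once.\<close>

lemma path_height_le_notin:
  assumes "wf G T" "path_bounded b m y T" "ge k T" "y \<notin> keys T"
  shows "path_height y k T \<le> sum b {k<..m}"
  using assms
proof (induction T arbitrary: k)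
  case (Node l a r)
  have a: "ht a \<le> b (ly a)" "ly a \<le> m" using Node.prems(2) by (auto simp: path_bounded_def)
  define C where "C = (if y < ky a then l else r)"
  have ne: "y \<noteq> ky a" using Node.prems by auto
  have "path_bounded b m y C" using Node.prems(2) ne by (auto simp: C_def path_bounded_def split: if_splits)
  moreover have "wf G C" "ge (ly a) C" "y \<notin> keys C" using Node.prems by (auto simp: C_def)
  ultimately have "path_height y (ly a) C \<le> sum b {ly a<..m}" using Node.IH by (auto simp: C_def split: if_splits)
  moreover have "path_height y k (Node l a r) = (if ly a = k then 0 else ht a) + path_height y (ly a) C"
    using ne by (auto simp: C_def)
  ultimately show ?case using a sum_bd_less[of k "ly a" m b] Node.prems(3) by (cases "ly a = k") auto
qed simp

text \<open>The factor two is for the two branches below an occurrence of \<open>y\<close>; neither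
  contains \<open>y\<close> again.\<close>

lemma path_height_le:
  assumes "wf G T" "bst' T" "path_bounded b m y T" "ge k T"
  shows "path_height y k T \<le> 2 * sum b {k<..m}"
  using assms
proof (induction T arbitrary: k)
  case (Node l a r)
  have a: "ht a \<le> b (ly a)" "ly a \<le> m" using Node.prems(3) by (auto simp: path_bounded_def)
  have c: "wf G l" "wf G r" "ge (ly a) l" "ge (ly a) r" "bst' l" "bst' r" using Node.prems by auto
  have "(if y < ky a then path_height y (ly a) l else if ky a < y then path_height y (ly a) r
      else path_height y (ly a) l + path_height y (ly a) r) \<le> 2 * sum b {ly a<..m}"
  proof (cases "y = ky a")
    case True
    have "path_bounded b m y l" "path_bounded b m y r" using Node.prems(3) True by (auto simp: path_bounded_def)
    moreover have "y \<notin> keys l" "y \<notin> keys r" using Node.prems(2) True by auto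
    ultimately show ?thesis using path_height_le_notin[of G l b m y "ly a"] path_height_le_notin[of G r b m y "ly a"] c True by simp
  next
    case False
    then have "y < ky a \<Longrightarrow> path_bounded b m y l" "ky a < y \<Longrightarrow> path_bounded b m y r" using Node.prems(3) by (auto simp: path_bounded_def)
    then show ?thesis using Node.IH c False by auto
  qed
  then show ?case using a sum_bd_less[of k "ly a" m b] Node.prems(4) by (cases "ly a = k") auto
qed simp

section \<open>Doubly exponential scales and residues\<close>

definition NN :: "nat \<Rightarrow> nat" where
  "NN k = 2 ^ (2 ^ k)"

lemma NN_Suc: "NN (Suc k) = NN k * NN k"
  by (simp add: NN_def power_add[symmetric] mult_2)

lemma NN_ge2: "2 \<le> NN k"
  using power_increasing[of 1 "2 ^ k" "2::nat"] by (simp add: NN_def)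

lemma NN_mono: "k \<le> j \<Longrightarrow> NN k \<le> NN j"
  by (simp add: NN_def)

lemma NN_dvd: "k \<le> j \<Longrightarrow> NN k dvd NN j"
  by (simp add: NN_def le_imp_power_dvd)

lemma NN_2: "k < j \<Longrightarrow> 2 * NN k \<le> NN j"
proof -
  assume "k < j"
  then have "NN (Suc k) \<le> NN j" by (intro NN_mono) simp
  moreover have "2 * NN k \<le> NN (Suc k)" unfolding NN_Suc by (rule mult_le_mono1[OF NN_ge2])
  ultimately show ?thesis by linarith
qed

lemma less_NN: "k < NN k"
proof -
  have "k < 2 ^ k" "(2::nat) ^ k < NN k" unfolding NN_def by (rule less_exp)+
  then show ?thesis by linarith
qed

lemma ex_residue:
  assumes "k < (m::nat)" shows "\<exists>s. y < s \<and> s \<le> y + m \<and> s mod m = k"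
proof -
  define s where "s = (y div m) * m + k"
  have sm: "s mod m = k" using assms by (simp add: s_def)
  have d: "(y div m) * m \<le> y" "y < (y div m) * m + m" using assms
    by (auto simp: div_mult_mod_eq) (metis add.commute dividend_less_div_times gr_zeroI not_less_zero)
  show ?thesis
  proof (cases "y < s")
    case True
    moreover have "s \<le> y + m" using d(1) assms unfolding s_def by linarith
    ultimately show ?thesis using sm by blast
  next
    case False
    then have "s + m \<le> y + m" "y < s + m" using d(2) unfolding s_def by linarith+
    moreover have "(s + m) mod m = k" using sm by simp
    ultimately show ?thesis by blast
  qed
qed

lemma residue_eq:
  assumes "(s::nat) mod m = s' mod m" "s < s' + m" "s' < s + m" shows "s = s'"
proof (rule ccontr)
  assume "s \<noteq> s'"
  have *: "m dvd b - a" if "a mod m = b mod m" "a \<le> b" for a b :: nat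
    using that mod_eq_dvd_iff_nat[of a b m] by metis
  show False
  proof (cases "s \<le> s'")
    case True
    then have "m dvd s' - s" "0 < s' - s" "s' - s < m" using *[of s s'] assms \<open>s \<noteq> s'\<close> by auto
    then show False using nat_dvd_not_less by blast
  next
    case False
    then have "m dvd s - s'" "0 < s - s'" "s - s' < m" using *[of s' s] assms \<open>s \<noteq> s'\<close> by auto
    then show False using nat_dvd_not_less by blast
  qed
qed

text \<open>The cached layers are \<open>kap, \<dots>, top - 1\<close>, and \<open>top\<close> is the layer of all other keys.
  The lower cutoff makes the height of layer \<open>kap\<close> about \<open>log log n\<close>.\<close>
locale sep =
  fixes n :: nat
  assumes n1: "1 \<le> n"
begin

definition top :: nat where "top = (LEAST k. 1 \<le> k \<and> n \<le> NN k)"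

text \<open>\<open>top + 1 \<le> 2 ^ kap\<close> serves twice: all residues \<open>k < top\<close>
  stay below every \<open>NN\<close> of a cached level, and the number of cached layers can be
  charged to \<open>2 ^ kap\<close>. The minimum \<open>4\<close> gives
  \<open>65536 \<le> NN k\<close>, which swallows additive constants.\<close>

definition kap :: nat where "kap = max 4 (LEAST j. top + 1 \<le> 2 ^ j)"

lemma top: "1 \<le> top" "n \<le> NN top"
proof -
  have "1 \<le> n \<and> n \<le> NN n" using less_NN[of n] n1 by simp
  then have "1 \<le> top \<and> n \<le> NN top" unfolding top_def by (rule LeastI)
  then show "1 \<le> top" "n \<le> NN top" by auto
qed

lemma NN_less_n: "1 \<le> k \<Longrightarrow> k < top \<Longrightarrow> NN k < n"
  using not_less_Least[of k "\<lambda>k. 1 \<le> k \<and> n \<le> NN k"] by (simp add: top_def)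

lemma kap: "4 \<le> kap" "top + 1 \<le> 2 ^ kap"
proof -
  have "top + 1 \<le> 2 ^ (top + 1)" using less_exp[of "top + 1"] by simp
  then have *: "top + 1 \<le> 2 ^ (LEAST j. top + 1 \<le> 2 ^ j)" by (rule LeastI)
  show "4 \<le> kap" by (simp add: kap_def)
  have "(2::nat) ^ (LEAST j. top + 1 \<le> 2 ^ j) \<le> 2 ^ kap" by (simp add: kap_def)
  with * show "top + 1 \<le> 2 ^ kap" by linarith
qed

lemma kap_top: "kap \<le> k \<Longrightarrow> top + 1 \<le> 2 ^ k"
  using kap(2) power_increasing[of kap k "2::nat"] by linarith

lemma top_less_NN: "kap \<le> k \<Longrightarrow> top < NN k"
  using kap_top[of k] less_exp[of "2 ^ k"] unfolding NN_def by linarith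

lemma NN_big: "kap \<le> k \<Longrightarrow> 65536 \<le> NN k"
  using NN_mono[of 4 k] kap(1) by (simp add: NN_def)

text \<open>\<open>NN a\<close> divides \<open>NN b\<close>, so a separator of level
  \<open>b\<close> also has residue \<open>b\<close> modulo \<open>NN a\<close>, as
  \<open>b < top < NN a\<close>; this equals \<open>a\<close> only if the levels agree.\<close>

lemma sep_unique:
  assumes "kap \<le> k" "kap \<le> j" "k < top" "j < top" "s mod NN k = k" "s mod NN j = j"
  shows "k = j"
proof -
  have *: "a = b" if "kap \<le> a" "a \<le> b" "b < top" "s mod NN a = a" "s mod NN b = b" for a b
  proof -
    have "(s mod NN b) mod NN a = s mod NN a" by (rule mod_mod_cancel[OF NN_dvd[OF that(2)]])
    then have "b mod NN a = a" by (simp only: that)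
    moreover have "b < NN a" using that(3) top_less_NN[OF that(1)] by simp
    ultimately show ?thesis by simp
  qed
  show ?thesis using *[of k j] *[of j k] assms by (cases "k \<le> j") auto
qed

text \<open>\<open>U i\<close> is a fixed superset of layer \<open>i\<close> during a whole access,
  which bounds the heights in all intermediate trees without following the counters. The bound
  generously covers the cached items and the five that one access may add.\<close>

definition U_ok :: "(nat \<Rightarrow> nat set) \<Rightarrow> bool" where
  "U_ok U \<longleftrightarrow> (\<forall>i. kap \<le> i \<longrightarrow> i < top \<longrightarrow> U i \<subseteq> {1..n} \<and> card (U i) \<le> 3 * (NN i + 5) \<and> (\<forall>y\<in>U i. y mod NN i = i))"

definition state_ok :: "(nat \<Rightarrow> nat set) \<Rightarrow> (nat \<Rightarrow> nat \<times> nat) \<Rightarrow> bool" where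
  "state_ok U \<gamma> \<longleftrightarrow> (\<forall>y\<in>{1..n}. \<gamma> y = (top, 3) \<or> kap \<le> fst (\<gamma> y) \<and> fst (\<gamma> y) < top \<and> y \<in> U (fst (\<gamma> y)))"

lemma state_okD: "state_ok U \<gamma> \<Longrightarrow> y \<in> {1..n} \<Longrightarrow>
    fst (\<gamma> y) = top \<or> kap \<le> fst (\<gamma> y) \<and> fst (\<gamma> y) < top \<and> y \<in> U (fst (\<gamma> y))"
  unfolding state_ok_def by (metis fst_conv)

definition tree_ok :: "(nat \<Rightarrow> nat \<times> nat) set \<Rightarrow> (nat \<Rightarrow> nat \<times> nat) \<Rightarrow> nat set \<Rightarrow> nd tree \<Rightarrow> bool" where
  "tree_ok G \<gamma> D T \<longleftrightarrow> wf G T \<and> bst' T \<and> set (ks T) = (\<lambda>y. (y, \<gamma> y)) ` D"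

text \<open>The hypothesis under which \<open>y\<close> is found in time \<open>O(2 ^ k)\<close>.\<close>
definition near :: "nat \<Rightarrow> nat \<Rightarrow> (nat \<Rightarrow> nat \<times> nat) \<Rightarrow> bool" where
  "near k y \<gamma> \<longleftrightarrow> (k < top \<longrightarrow> (\<forall>s\<in>{1..n}. s mod NN k = k \<longrightarrow> s \<le> y + NN k \<longrightarrow> y \<le> s + NN k \<longrightarrow> s \<noteq> y \<longrightarrow> fst (\<gamma> s) = k))"

lemma lay_eq: "tree_ok G \<gamma> D T \<Longrightarrow> lay i T = {y \<in> D. fst (\<gamma> y) = i}"
  by (force simp: tree_ok_def lay_def)

lemma layer_range:
  assumes "tree_ok G \<gamma> D T" "D \<subseteq> {1..n}" "state_ok U \<gamma>" "a \<in> set_tree T"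
  shows "ky a \<in> D" "st a = \<gamma> (ky a)" "ly a = top \<or> kap \<le> ly a \<and> ly a < top"
proof -
  have "(ky a, st a) \<in> set (ks T)" using assms(4) by (auto simp: ks_def)
  then show 1: "ky a \<in> D" "st a = \<gamma> (ky a)" using assms(1) by (auto simp: tree_ok_def)
  moreover from 1 have "ky a \<in> {1..n}" using assms(2) by blast
  ultimately show "ly a = top \<or> kap \<le> ly a \<and> ly a < top" using state_okD[OF assms(3), of "ky a"] by auto
qed

lemma ge1: "tree_ok G \<gamma> D T \<Longrightarrow> D \<subseteq> {1..n} \<Longrightarrow> state_ok U \<gamma> \<Longrightarrow> ge 1 T"
  using layer_range(3)[of G \<gamma> D T U] top(1) kap(1) by (cases T) force+

lemma small_ht:
  assumes "2 ^ h \<le> (1 + c)\<^sup>2" "c \<le> 3 * (NN i + 5)" "4 \<le> i" shows "h \<le> 3 * 2 ^ i"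
proof -
  have "65536 \<le> NN i" using NN_mono[OF assms(3)] by (simp add: NN_def)
  then have "1 + c \<le> 4 * NN i" using assms(2) by simp
  then have "(1 + c)\<^sup>2 \<le> (4 * NN i)\<^sup>2" by (rule power_mono) simp
  also have "(4 * NN i)\<^sup>2 = 2 ^ (4 + 2 * 2 ^ i)"
    unfolding NN_def power_mult_distrib power_add power_mult[symmetric] by (simp add: mult.commute)
  finally have "2 ^ h \<le> (2::nat) ^ (4 + 2 * 2 ^ i)" using assms(1) by linarith
  then have "h \<le> 4 + 2 * 2 ^ i" by (rule power_le_imp_le_exp[rotated]) simp
  moreover have "(2::nat) ^ 4 \<le> 2 ^ i" using assms(3) by (rule power_increasing) simp
  ultimately show ?thesis by simp
qed

lemma sum_pow2: "(\<Sum>i\<in>{a..<b}. (2::nat) ^ i) \<le> 2 ^ b"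
proof -
  have "(\<Sum>i\<in>{a..<b}. (2::nat) ^ i) \<le> (\<Sum>i\<in>{..<b}. 2 ^ i)" by (rule sum_mono2) auto
  also have "\<dots> \<le> 2 ^ b" by (induction b) auto
  finally show ?thesis .
qed

lemma height_bounded_tree:
  assumes "tree_ok G \<gamma> D T" "D \<subseteq> {1..n}" "state_ok U \<gamma>" "U_ok U" "j < top"
  shows "height_bounded (\<lambda>i. 3 * 2 ^ i) j T" "lh 0 T + (\<Sum>i\<in>{0<..j}. 3 * 2 ^ i) \<le> 6 * 2 ^ j"
proof -
  have "ht a \<le> 3 * 2 ^ ly a" if a: "a \<in> set_tree T" "ly a \<le> j" for a
  proof -
    have l: "kap \<le> ly a" "ly a < top" using layer_range(3)[OF assms(1-3) a(1)] a(2) assms(5) by auto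
    have "lay (ly a) T \<subseteq> U (ly a)" using lay_eq[OF assms(1), of "ly a"] assms(2) state_okD[OF assms(3)] l by fastforce
    moreover have "finite (U (ly a))" "card (U (ly a)) \<le> 3 * (NN (ly a) + 5)"
      using assms(4) l finite_subset[of "U (ly a)" "{1..n}"] by (auto simp: U_ok_def)
    ultimately have "card (lay (ly a) T) \<le> 3 * (NN (ly a) + 5)" by (meson card_mono le_trans)
    then show ?thesis using small_ht[OF two_pow_ht[of G T a]] assms(1) a(1) l kap(1) by (auto simp: tree_ok_def)
  qed
  then show "height_bounded (\<lambda>i. 3 * 2 ^ i) j T" by (simp add: height_bounded_def)
  have "{0<..j} = {1..<Suc j}" by auto
  then have "(\<Sum>i\<in>{0<..j}. (2::nat) ^ i) \<le> 2 ^ Suc j" using sum_pow2[of 1 "Suc j"] by simp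
  then have "(\<Sum>i\<in>{0<..j}. 3 * (2::nat) ^ i) \<le> 6 * 2 ^ j" by (simp flip: sum_distrib_left)
  moreover have "lh 0 T = 0" using ge1[OF assms(1-3)] lh_ge[of 0 T] by simp
  ultimately show "lh 0 T + (\<Sum>i\<in>{0<..j}. 3 * 2 ^ i) \<le> 6 * 2 ^ j" by simp
qed

text \<open>\<open>22 = 2 * (6 + 2 + 3)\<close>: two branches, each with the geometric sum of the
  layers up to \<open>k\<close>, at most two for each of the fewer than \<open>2 ^ k\<close> cached
  layers above, and the height of what layer \<open>top\<close> contributes. \<open>D\<close> may
  lack \<open>y\<close>, which covers the tree between the deletion of \<open>y\<close> and its
  reinsertion.\<close>

lemma near_path_height:
  assumes T: "tree_ok G \<gamma> D T" "D \<subseteq> {1..n}" "{1..n} - {y} \<subseteq> D" "state_ok U \<gamma>" "U_ok U"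
    and k: "kap \<le> k" "near k y \<gamma>" and yn: "y \<in> {1..n}"
  shows "lh 0 T = 0" "path_height y 0 T \<le> 22 * 2 ^ k"
proof -
  show "lh 0 T = 0" using ge1[OF T(1,2,4)] lh_ge[of 0 T] by simp
  \<comment> \<open>Height bounds for subtrees on the path: below the uncached keys and above level
    \<open>k\<close> a layer shows at most one separator, hence height at most two; layer
    \<open>top\<close> shows at most \<open>2 * NN k\<close> keys.\<close>
  define b :: "nat \<Rightarrow> nat" where "b i = (if i \<le> k \<and> i < top then 3 * 2 ^ i else if i < top then 2 else 3 * 2 ^ k)" for i
  have wfT: "wf G T" "bst' T" using T(1) by (auto simp: tree_ok_def)
  have keysT: "keys T = D" using T(1) by (simp add: tree_ok_def image_image)
  have "path_bounded b top y T" unfolding path_bounded_def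
  proof (intro allI impI)
    fix l a r assume v: "Node l a r \<in> ps y T"
    let ?v = "Node l a r" and ?i = "ly a"
    have V: "wf G ?v" "bst' ?v" "set (ks ?v) \<subseteq> set (ks T)" using ps_sub[OF v wfT] by auto
    have kg: "z \<in> D \<and> s = \<gamma> z" if "(z, s) \<in> set (ks ?v)" for z s
    proof -
      have "(z, s) \<in> (\<lambda>y. (y, \<gamma> y)) ` D" using V(3) T(1) that unfolding tree_ok_def by blast
      then show ?thesis by blast
    qed
    have h: "2 ^ ht a \<le> (1 + card (lay ?i ?v))\<^sup>2" using two_pow_ht[OF V(1,2), of a] by simp
    have ka: "ky a \<in> D" "st a = \<gamma> (ky a)" using kg[of "ky a" "st a"] by auto
    then have i: "?i = top \<or> kap \<le> ?i \<and> ?i < top" using state_okD[OF T(4), of "ky a"] T(2) by auto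
    have sub: "lay ?i ?v \<subseteq> {z \<in> D. fst (\<gamma> z) = ?i}"
    proof
      fix z assume "z \<in> lay ?i ?v"
      then obtain s where "(z, s) \<in> set (ks ?v)" "fst s = ?i" by (auto simp: lay_def simp del: ks_simps)
      then show "z \<in> {z \<in> D. fst (\<gamma> z) = ?i}" using kg by blast
    qed
    have kv: "keys ?v \<subseteq> D" using kg keys_iff by blast
    have layge: "?i \<le> fst (\<gamma> z)" if zk: "z \<in> keys ?v" for z
    proof -
      obtain s where "(z, s) \<in> set (ks ?v)" using zk unfolding keys_iff by blast
      moreover from this have "s = \<gamma> z" using kg by blast
      ultimately show ?thesis using ge_ks[OF V(1), of ?i "(z, s)"] by simp
    qed
    have loc: "z < y + NN k \<and> y < z + NN k" if z: "z \<in> lay ?i ?v" and ki: "k < ?i" for z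
    proof -
      have kt: "k < top" using ki i by auto
      have zv: "z \<in> keys ?v" using z by (auto simp: lay_def)
      have zn: "z \<in> {1..n}" using kv zv T(2) by blast
      \<comment> \<open>A separator of level \<open>k\<close> between \<open>y\<close> and
        \<open>z\<close>, possibly \<open>z\<close> itself, is in layer \<open>k\<close> and thus
        outside this deeper subtree; by \<open>ps_local\<close> it would cut off
        \<open>z\<close>.\<close>
      have no: False if s: "s \<in> {1..n}" "s mod NN k = k" "s \<le> y + NN k" "y \<le> s + NN k" "s \<noteq> y" "y < s \<and> s \<le> z \<or> s < y \<and> z \<le> s" for s
      proof -
        have "fst (\<gamma> s) = k" using k(2) kt s by (auto simp: near_def)
        then have "s \<notin> keys ?v" using layge[of s] ki by auto
        moreover have "s \<in> keys T" using s(1,5) T(3) keysT by blast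
        ultimately show False using ps_local[OF v wfT(2) _ _ zv, of s] s(6) by auto
      qed
      show ?thesis
      proof (rule ccontr)
        assume "\<not> (z < y + NN k \<and> y < z + NN k)"
        then consider "y + NN k \<le> z" | "z + NN k \<le> y" by linarith
        then show False
        proof cases
          case 1
          obtain s where "y < s" "s \<le> y + NN k" "s mod NN k = k" using ex_residue[OF less_NN[of k]] by blast
          then show False using no[of s] 1 zn by auto
        next
          case 2
          \<comment> \<open>Starting one below \<open>y - NN k\<close> gives a separator that is at
            least \<open>y - NN k\<close> and strictly below \<open>y\<close>.\<close>
          obtain s where s: "y - NN k - 1 < s" "s \<le> y - NN k - 1 + NN k" "s mod NN k = k" using ex_residue[OF less_NN[of k]] by blast
          have "1 \<le> z" using zn by simp
          then have "z \<le> s" "s < y" "y \<le> s + NN k" using s 2 by linarith+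
          then show False using no[of s] s(3) \<open>1 \<le> z\<close> yn by auto
        qed
      qed
    qed
    have inU: "z \<in> U ?i" if "z \<in> D" "fst (\<gamma> z) = ?i" "?i < top" for z
      using that T(2) state_okD[OF T(4), of z] by auto
    consider (a) "?i \<le> k" "?i < top" | (b) "k < ?i" "?i < top" | (c) "?i = top" using i by linarith
    then show "ht a \<le> b ?i \<and> ?i \<le> top"
    proof cases
      case a
      then have l: "kap \<le> ?i" using i by auto
      have "lay ?i ?v \<subseteq> U ?i" using sub T(2,4) a(2) inU by blast
      moreover have "finite (U ?i)" "card (U ?i) \<le> 3 * (NN ?i + 5)"
        using T(5) l a finite_subset[of "U ?i" "{1..n}"] by (auto simp: U_ok_def)
      ultimately have "card (lay ?i ?v) \<le> 3 * (NN ?i + 5)" by (meson card_mono le_trans)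
      then show ?thesis using small_ht[OF h] l a kap(1) by (simp add: b_def)
    next
      case b
      have "z = z'" if "z \<in> lay ?i ?v" "z' \<in> lay ?i ?v" for z z'
      proof (rule residue_eq)
        have "z \<in> U ?i" "z' \<in> U ?i" using that sub inU b(2) by blast+
        then show "z mod NN ?i = z' mod NN ?i" using T(5) b k(1) by (auto simp: U_ok_def)
        show "z < z' + NN ?i" "z' < z + NN ?i" using loc[of z] loc[of z'] that b NN_2[of k ?i] by auto
      qed
      then have "card (lay ?i ?v) \<le> 1" by (auto simp: card_le_Suc0_iff_eq)
      then have "(1 + card (lay ?i ?v))\<^sup>2 \<le> 2\<^sup>2" by (intro power_mono) auto
      then have "2 ^ ht a \<le> (2::nat) ^ 2" using h by linarith
      then have "ht a \<le> 2" using power_le_imp_le_exp[of "2::nat" "ht a" 2] by simp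
      then show ?thesis using b by (simp add: b_def)
    next
      case c
      have "card (lay ?i ?v) \<le> 2 * NN k"
      proof (cases "k < top")
        case True
        have "lay ?i ?v \<subseteq> {y + 1 - NN k..<y + NN k}" using loc True c by force
        then have "card (lay ?i ?v) \<le> card {y + 1 - NN k..<y + NN k}" by (intro card_mono) auto
        then show ?thesis by simp
      next
        case False
        have "card (lay ?i ?v) \<le> card {1..n}" by (intro card_mono) (use sub T(2) in auto)
        then show ?thesis using top(2) NN_mono[of top k] False by simp
      qed
      then show ?thesis using small_ht[OF h, of k] k(1) kap(1) c by (simp add: b_def)
    qed
  qed
  then have "path_height y 0 T \<le> 2 * sum b {0<..top}" using path_height_le[OF wfT, of b top y 0] ge1[OF T(1,2,4)] ge_mono by blast
  also have "sum b {0<..top} \<le> 11 * 2 ^ k"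
  proof -
    have "{0<..top} = insert top {0<..<top}" using top(1) by auto
    then have "sum b {0<..top} = b top + sum b {0<..<top}" by simp
    moreover have "sum b {0<..<top} \<le> (\<Sum>i\<in>{0<..<top}. (if i \<le> k then 3 * 2 ^ i else 0) + 2)"
      by (rule sum_mono) (auto simp: b_def)
    moreover have "\<dots> = (\<Sum>i\<in>{0<..<top}. (if i \<le> k then 3 * 2 ^ i else 0)) + 2 * (top - 1)"
      by (subst sum.distrib) simp
    moreover have "(\<Sum>i\<in>{0<..<top}. (if i \<le> k then 3 * 2 ^ i else 0)) \<le> 6 * (2::nat) ^ k"
    proof -
      have "(\<Sum>i\<in>{0<..<top}. (if i \<le> k then 3 * 2 ^ i else 0)) = (\<Sum>i\<in>{0<..<top} \<inter> {..k}. 3 * (2::nat) ^ i)"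
        by (subst sum.inter_restrict) auto
      also have "\<dots> \<le> (\<Sum>i\<in>{0..<Suc k}. 3 * 2 ^ i)" by (rule sum_mono2) auto
      also have "\<dots> \<le> 6 * 2 ^ k" using sum_pow2[of 0 "Suc k"] by (simp flip: sum_distrib_left)
      finally show ?thesis .
    qed
    moreover have "b top = 3 * 2 ^ k" by (simp add: b_def)
    ultimately show ?thesis using kap_top[OF k(1)] by linarith
  qed
  finally show "path_height y 0 T \<le> 22 * 2 ^ k" by simp
qed

end

section \<open>The access program\<close>

context sep
begin

text \<open>The possible global fields: a current class and a counter for every cached layer, and a default value elsewhere, which
  keeps their number polynomial in \<open>n\<close>.\<close>
definition G :: "(nat \<Rightarrow> nat \<times> nat) set" where
  "G = {g. \<forall>k. if kap \<le> k \<and> k < top then fst (g k) < 3 \<and> snd (g k) \<le> NN k + 4 else g k = (0, 0)}"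

text \<open>The radius is twice that of \<open>near\<close>, so that a separator of level
  \<open>k + 1\<close> near an item of \<open>W k x\<close> belongs to \<open>W (k + 1) x\<close>,
  by \<open>2 * NN k \<le> NN (k + 1)\<close>. Filling both windows therefore keeps the new items of
  layer \<open>k\<close> cheap to reach.\<close>

definition W :: "nat \<Rightarrow> nat \<Rightarrow> nat set" where
  "W k x = {s \<in> {1..n}. s mod NN k = k \<and> s \<le> x + 2 * NN k \<and> x \<le> s + 2 * NN k}"

definition S :: "nat \<Rightarrow> nat \<Rightarrow> (nat \<Rightarrow> nat \<times> nat) \<Rightarrow> nat set" where
  "S k j \<gamma> = {y \<in> {1..n}. \<gamma> y = (k, j)}"

lemma finite_W [simp]: "finite (W k x)" and W_sub: "W k x \<subseteq> {1..n}"
  by (auto simp: W_def)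

lemma finite_S [simp]: "finite (S k j \<gamma>)"
  by (auto simp: S_def)

lemma card_W: "card (W k x) \<le> 5"
proof -
  have N: "0 < NN k" using NN_ge2[of k] by simp
  have inj: "inj_on (\<lambda>s. s div NN k) (W k x)"
  proof (rule inj_onI)
    fix s s' assume a: "s \<in> W k x" "s' \<in> W k x" "s div NN k = s' div NN k"
    then have "s mod NN k = s' mod NN k" by (auto simp: W_def)
    then show "s = s'" using a(3) by (metis div_mult_mod_eq)
  qed
  have "(\<lambda>s. s div NN k) ` W k x \<subseteq> {x div NN k - 2..x div NN k + 2}"
  proof (rule image_subsetI)
    fix s assume s: "s \<in> W k x"
    have "s div NN k \<le> (x + 2 * NN k) div NN k" "x div NN k \<le> (s + 2 * NN k) div NN k"
      using s by (auto simp: W_def intro: div_le_mono)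
    moreover have "(a + 2 * NN k) div NN k = a div NN k + 2" for a using N by simp
    ultimately show "s div NN k \<in> {x div NN k - 2..x div NN k + 2}" by simp
  qed
  then have "card ((\<lambda>s. s div NN k) ` W k x) \<le> card {x div NN k - 2..x div NN k + 2}" by (intro card_mono) auto
  then show ?thesis using card_image[OF inj] by simp
qed

lemma tree_ok_keys: "tree_ok G \<gamma> D T \<Longrightarrow> keys T = D"
  by (simp add: tree_ok_def image_image)

lemma tree_ok_mem: "tree_ok G \<gamma> D T \<Longrightarrow> (y, s) \<in> set (ks T) \<longleftrightarrow> y \<in> D \<and> s = \<gamma> y"
  unfolding tree_ok_def by blast

lemma bst'_distinct: "bst' T \<Longrightarrow> distinct (map fst (ks T))"
  unfolding bst'_def using strict_sorted_iff by blast

lemma length_ks: "length (ks T) = size T"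
  by (simp add: ks_def)

lemma tree_ok_size: "tree_ok G \<gamma> D T \<Longrightarrow> size T = card D"
  using tree_ok_keys[of \<gamma> D T] distinct_card[OF bst'_distinct, of T]
  by (auto simp: tree_ok_def length_ks)

lemma tree_ok_del:
  assumes "tree_ok G \<gamma> D T" "del_ks y T T'" "wf G T'" shows "tree_ok G \<gamma> (D - {y}) T'"
proof -
  obtain xs s ys where k: "ks T = xs @ (y, s) # ys" "ks T' = xs @ ys" using assms(2) by (auto simp: del_ks_def)
  have b: "bst' T" using assms(1) by (simp add: tree_ok_def)
  have "bst' T'" using b by (simp add: bst'_def k sorted_wrt_append)
  moreover have "y \<notin> fst ` set xs" "y \<notin> fst ` set ys" using bst'_distinct[OF b] by (auto simp: k)
  then have "set (ks T') = {p \<in> set (ks T). fst p \<noteq> y}" by (force simp: k)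
  then have "set (ks T') = (\<lambda>y. (y, \<gamma> y)) ` (D - {y})" using assms(1) by (auto simp: tree_ok_def)
  ultimately show ?thesis using assms(3) by (simp add: tree_ok_def)
qed

lemma tree_ok_ins:
  assumes "tree_ok G \<gamma> (D - {y}) T" "ins_ks z T T'" "wf G T'" "ky z = y" "y \<in> D"
  shows "tree_ok G (\<gamma>(y := st z)) D T'"
proof -
  obtain xs ys where k: "ks T = xs @ ys" "ks T' = xs @ key z # ys"
     "\<forall>x\<in>fst ` set xs. x < y" "\<forall>x\<in>fst ` set ys. y < x" using assms(2,4) by (auto simp: ins_ks_def)
  have b: "bst' T" using assms(1) by (simp add: tree_ok_def)
  then have "bst' T'" using k(3,4) assms(4) by (auto simp: bst'_def k(1,2) sorted_wrt_append key_def)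
  moreover have "set (ks T') = insert (y, st z) (set (ks T))" using assms(4) by (auto simp: k key_def)
  then have "set (ks T') = (\<lambda>x. (x, (\<gamma>(y := st z)) x)) ` D" using assms(1,5) by (auto simp: tree_ok_def)
  ultimately show ?thesis using assms(3) by (simp add: tree_ok_def)
qed

section \<open>Changing, testing and evicting cached items\<close>

definition upd :: "nat \<Rightarrow> nat \<times> nat \<Rightarrow> vt \<Rightarrow> vt dt" where
  "upd s st' u = bnd (del (n + 1) s u) (\<lambda>z. ins (n + 1) (ND s st' 0 {} (gl (fst z))) (snd z))"

lemma okT_wf: "okT t G A u T \<Longrightarrow> wf G T"
  by (simp add: okT_def)

text \<open>\<open>near\<close> ignores the status of \<open>s\<close> itself, so the path bound
  holds for both the deletion and the reinsertion. \<open>5300\<close> covers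
  \<open>(160 + 80) * 22 = 5280\<close> and the additive terms, as
  \<open>16 \<le> 2 ^ k\<close>.\<close>

lemma wp_upd:
  assumes u: "okT t G A u T" and T: "tree_ok G \<gamma> {1..n} T" "state_ok U \<gamma>" "U_ok U"
    and s: "s \<in> {1..n}" "near k s \<gamma>" "kap \<le> k"
  shows "wp t A (upd s st' u) (\<lambda>B m w. m \<le> 5300 * 2 ^ k \<and> (\<exists>T'. okT t G B w T' \<and> tree_ok G (\<gamma>(s := st')) {1..n} T'))"
  unfolding upd_def
proof (rule wp_bnd[OF wp_del[OF u]], goal_cases)
  case 1 show ?case using tree_ok_size[OF T(1)] by simp
next
  case 2 show ?case using T by (simp add: tree_ok_def)
next
  case 3 show ?case using tree_ok_keys[OF T(1)] s(1) by simp
next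
  case (4 B m z)
  then obtain T1 where z: "okT t G B (snd z) T1" "del_ks s T T1" "s \<in> vis t B" "gl (fst z) \<in> G"
    "\<forall>k. ge k T \<longrightarrow> del_post s T T1 m k" by blast
  have T1: "tree_ok G \<gamma> ({1..n} - {s}) T1" using tree_ok_del[OF T(1) z(2) okT_wf[OF z(1)]] .
  have g0: "ge 0 X" for X by (cases X) auto
  have m: "m \<le> 160 * (lh 0 T + path_height s 0 T) + 3" using z(5) g0 by (simp add: del_post_def)
  have 1: "lh 0 T = 0" "path_height s 0 T \<le> 22 * 2 ^ k"
    using near_path_height[OF T(1) _ _ T(2,3) s(3,2) s(1)] by auto
  have 2: "lh 0 T1 = 0" "path_height s 0 T1 \<le> 22 * 2 ^ k"
    using near_path_height[OF T1 _ _ T(2,3) s(3,2) s(1)] by auto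
  let ?z = "ND s st' 0 {} (gl (fst z))"
  show ?case
  proof (rule wp_mono[OF wp_ins[OF z(1)]], goal_cases)
    case 1 show ?case using tree_ok_size[OF T1] s by simp
  next
    case 2 show ?case using T1 by (simp add: tree_ok_def)
  next
    case 3 show ?case using tree_ok_keys[OF T1] by simp
  next
    case 4 show ?case using z by simp
  next
    case 5 show ?case using z by simp
  next
    case (6 C m' w)
    then obtain T2 where w: "okT t G C w T2" "ins_ks ?z T1 T2"
      "\<forall>k. k \<le> ly ?z \<and> ge k T1 \<longrightarrow> ins_post (ky ?z) T1 T2 m' k" by blast
    have "ins_post s T1 T2 m' 0" using w(3) g0 by simp
    then have "m' \<le> 50 * lh 0 T1 + 80 * path_height s 0 T1 + 10" by (simp add: ins_post_def)
    moreover have "(16::nat) \<le> 2 ^ k" using power_increasing[of 4 k "2::nat"] kap(1) s(3) by simp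
    ultimately have "m + m' \<le> 5300 * 2 ^ k" using m 1 2 by simp
    moreover have "tree_ok G (\<gamma>(s := st')) {1..n} T2"
      using tree_ok_ins[OF T1 w(2) okT_wf[OF w(1)]] s by simp
    ultimately show ?case using w(1) by blast
  qed
qed

primrec chk :: "nat \<Rightarrow> nat \<times> nat \<Rightarrow> nat list \<Rightarrow> vt \<Rightarrow> bool dt" where
  "chk d st' [] u = Ret True"
| "chk d st' (s # ss) u = bnd (srch d s u) (\<lambda>r. if r = Some st' then chk d st' ss u else Ret False)"

lemma srch_status:
  assumes "okT t G A u T" "tree_ok G \<gamma> {1..n} T" "state_ok U \<gamma>" "U_ok U" "k < top" "s \<in> {1..n}"
  shows "wp t A (srch (6 * 2 ^ k) s u) (\<lambda>B m r. m \<le> 6 * 2 ^ k \<and> (r = Some (k, c) \<longleftrightarrow> \<gamma> s = (k, c)))"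
proof (rule wp_mono[OF wp_srch[OF assms(1)]], goal_cases)
  case 1 show ?case using assms(2) by (simp add: tree_ok_def)
next
  case (2 B m r)
  then have p: "srch_post s T (6 * 2 ^ k) m r" by blast
  have m: "m \<le> 6 * 2 ^ k" "\<And>s'. r = Some s' \<Longrightarrow> (s, s') \<in> set (ks T)" using p unfolding srch_post_def by blast+
  have g0: "ge 0 T" by (cases T) auto
  have "r = Some (k, c)" if "\<gamma> s = (k, c)"
  proof -
    have "(s, (k, c)) \<in> set (ks T)" using tree_ok_mem[OF assms(2)] assms(6) that by metis
    then show ?thesis using p height_bounded_tree[OF assms(2) _ assms(3-5)] g0 unfolding srch_post_def
      by (metis fst_conv order_refl)
  qed
  then show ?case using m tree_ok_mem[OF assms(2)] by metis
qed

lemma wp_chk: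
  assumes "okT t G A u T" "tree_ok G \<gamma> {1..n} T" "state_ok U \<gamma>" "U_ok U" "k < top" "set ss \<subseteq> {1..n}"
  shows "wp t A (chk (6 * 2 ^ k) (k, c) ss u) (\<lambda>B m b. m \<le> length ss * (6 * 2 ^ k) \<and> (b \<longleftrightarrow> (\<forall>s\<in>set ss. \<gamma> s = (k, c))))"
  using assms(1,6)
proof (induction ss arbitrary: A)
  case (Cons s ss)
  show ?case unfolding chk.simps
  proof (rule wp_bnd[OF srch_status[OF Cons.prems(1) assms(2-5), of s c]], goal_cases)
    case (2 B m r)
    show ?case
    proof (cases "r = Some (k, c)")
      case True
      have "wp t B (chk (6 * 2 ^ k) (k, c) ss u) (\<lambda>C m' b. m + m' \<le> length (s # ss) * (6 * 2 ^ k) \<and> (b \<longleftrightarrow> (\<forall>s\<in>set (s # ss). \<gamma> s = (k, c))))"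
        by (rule wp_mono[OF Cons.IH[OF okT_mono[OF Cons.prems(1) 2(1)]]]) (use Cons.prems 2 True in auto)
      then show ?thesis using True by simp
    next
      case False
      then show ?thesis using 2 by auto
    qed
  qed (use Cons.prems in auto)
qed simp

definition W_list :: "nat \<Rightarrow> nat \<Rightarrow> nat list" where
  "W_list k x = sorted_list_of_set (W k x)"

lemma W_list: "set (W_list k x) = W k x" "distinct (W_list k x)" "length (W_list k x) \<le> 5"
  using card_W[of k x] by (auto simp: W_list_def)

fun probe :: "nat \<Rightarrow> nat \<Rightarrow> (nat \<Rightarrow> nat \<times> nat) \<Rightarrow> nat \<Rightarrow> vt \<Rightarrow> nat dt" where
  "probe 0 k g x u = Ret k"
| "probe (Suc f) k g x u = bnd (chk (6 * 2 ^ k) (k, fst (g k)) (W_list k x) u)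
     (\<lambda>b. if b then Ret k else probe f (Suc k) g x u)"

text \<open>The current class is demanded, not just presence in the layer: an access stopping at
  \<open>k\<close> must find in the youngest class all separators that \<open>incl\<close> requires
  around its new items of layer \<open>k - 1\<close>.\<close>

definition fresh :: "(nat \<Rightarrow> nat \<times> nat) \<Rightarrow> (nat \<Rightarrow> nat \<times> nat) \<Rightarrow> nat \<Rightarrow> nat \<Rightarrow> bool" where
  "fresh \<gamma> g x k \<longleftrightarrow> (\<forall>s\<in>W k x. \<gamma> s = (k, fst (g k)))"

lemma wp_probe:
  assumes "okT t G A u T" "tree_ok G \<gamma> {1..n} T" "state_ok U \<gamma>" "U_ok U" "f = top - k"
  shows "wp t A (probe f k g x u) (\<lambda>B m k'. k \<le> k' \<and> k' \<le> max k top \<and> m \<le> (\<Sum>j\<in>{k..<Suc k'}. 30 * 2 ^ j) \<and>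
    (\<forall>j. k \<le> j \<and> j < k' \<longrightarrow> \<not> fresh \<gamma> g x j) \<and> (k' < top \<longrightarrow> fresh \<gamma> g x k'))"
  using assms(1,5)
proof (induction f arbitrary: A k)
  case (Suc f)
  have kt: "k < top" using Suc.prems by simp
  show ?case unfolding probe.simps
  proof (rule wp_bnd[OF wp_chk[OF Suc.prems(1) assms(2-4) kt]], goal_cases)
    case 1 show ?case using W_list W_sub by auto
  next
    case (2 B m b)
    have "length (W_list k x) * (6 * 2 ^ k) \<le> 5 * (6 * 2 ^ k)" using W_list(3) by (rule mult_le_mono1)
    then have m: "m \<le> 30 * 2 ^ k" using 2(2) by linarith
    have b: "b \<longleftrightarrow> fresh \<gamma> g x k" using 2(2) W_list(1) by (simp add: fresh_def)
    show ?case
    proof (cases b)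
      case True
      then show ?thesis using b m kt by auto
    next
      case False
      have "wp t B (probe f (Suc k) g x u) (\<lambda>C m' k'. k \<le> k' \<and> k' \<le> max k top \<and> m + m' \<le> (\<Sum>j\<in>{k..<Suc k'}. 30 * 2 ^ j) \<and>
        (\<forall>j. k \<le> j \<and> j < k' \<longrightarrow> \<not> fresh \<gamma> g x j) \<and> (k' < top \<longrightarrow> fresh \<gamma> g x k'))"
      proof (rule wp_mono[OF Suc.IH[OF okT_mono[OF Suc.prems(1) 2(1)]]], goal_cases)
        case (2 C m' k')
        have "\<not> fresh \<gamma> g x j" if "k \<le> j" "j < k'" for j
          using 2(2) False b that by (cases "j = k") auto
        moreover have "(\<Sum>j\<in>{k..<Suc k'}. 30 * 2 ^ j) = 30 * 2 ^ k + (\<Sum>j\<in>{Suc k..<Suc k'}. 30 * (2::nat) ^ j)"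
          using 2(2) by (subst sum.atLeast_Suc_lessThan) auto
        ultimately show ?case using 2(2) m kt by auto
      qed (use Suc.prems in simp)
      then show ?thesis using False by simp
    qed
  qed
qed auto

text \<open>By \<open>sep_unique\<close> no separator of level \<open>k + 1\<close> is among the
  changed keys, so work on layer \<open>k\<close> preserves the hypothesis that makes it
  cheap.\<close>

lemma near_cong:
  assumes "near (Suc k) y \<gamma>" "kap \<le> k" "k < top" "\<And>z. z \<in> {1..n} \<Longrightarrow> \<gamma> z \<noteq> \<gamma>' z \<Longrightarrow> z mod NN k = k"
  shows "near (Suc k) y \<gamma>'"
  unfolding near_def
proof (intro impI ballI)
  fix s assume s: "Suc k < top" "s \<in> {1..n}" "s mod NN (Suc k) = Suc k" "s \<le> y + NN (Suc k)" "y \<le> s + NN (Suc k)" "s \<noteq> y"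
  then have "s mod NN k \<noteq> k" using sep_unique[of k "Suc k" s] assms(2,3) by auto
  then have "\<gamma> s = \<gamma>' s" using assms(4) s(2) by blast
  moreover have "fst (\<gamma> s) = Suc k" using assms(1) s unfolding near_def by blast
  ultimately show "fst (\<gamma>' s) = Suc k" by simp
qed

primrec refresh :: "nat \<Rightarrow> nat \<times> nat \<Rightarrow> nat list \<Rightarrow> vt \<Rightarrow> nat \<Rightarrow> (vt \<times> nat) dt" where
  "refresh d st' [] u m = Ret (u, m)"
| "refresh d st' (s # ss) u m = bnd (srch d s u) (\<lambda>r. if r = Some st' then refresh d st' ss u m
     else bnd (upd s st' u) (\<lambda>u. refresh d st' ss u (Suc m)))"

text \<open>Layer \<open>k\<close> around these keys is still being filled, so they are moved under
  \<open>near (Suc k)\<close>: \<open>10606 = 2 * 5300 + 6\<close>, the last term for the bounded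
  search.\<close>

lemma wp_refresh:
  assumes "okT t G A u T" "tree_ok G \<gamma> {1..n} T" "state_ok U \<gamma>" "U_ok U" "kap \<le> k" "k < top"
    "distinct ss" "set ss \<subseteq> U k" "\<forall>s\<in>set ss. near (Suc k) s \<gamma>"
  shows "wp t A (refresh (6 * 2 ^ k) (k, c) ss u m) (\<lambda>B i z. i \<le> length ss * (10606 * 2 ^ k) \<and>
    snd z = m + card {s \<in> set ss. \<gamma> s \<noteq> (k, c)} \<and>
    (\<exists>T'. okT t G B (fst z) T' \<and> tree_ok G (\<lambda>y. if y \<in> set ss then (k, c) else \<gamma> y) {1..n} T'))"
  using assms(1-3,7-9)
proof (induction ss arbitrary: A u T \<gamma> m)
  case (Cons s ss)
  have sU: "s \<in> U k" using Cons.prems by simp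
  have s: "s \<in> {1..n}" "s mod NN k = k" using assms(4-6) sU unfolding U_ok_def by blast+
  show ?case unfolding refresh.simps
  proof (rule wp_bnd[OF srch_status[OF Cons.prems(1-3) assms(4,6) s(1), of c]], goal_cases)
    case (1 B i r)
    have okB: "okT t G B u T" using okT_mono[OF Cons.prems(1) 1(1)] .
    have cs: "card {s' \<in> set (s # ss). \<gamma> s' \<noteq> (k, c)} = (if \<gamma> s = (k, c) then 0 else 1) + card {s' \<in> set ss. \<gamma> s' \<noteq> (k, c)}"
    proof -
      have "{s' \<in> set (s # ss). \<gamma> s' \<noteq> (k, c)} = (if \<gamma> s = (k, c) then {} else {s}) \<union> {s' \<in> set ss. \<gamma> s' \<noteq> (k, c)}" by auto
      then show ?thesis using Cons.prems(4) by auto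
    qed
    show ?case
    proof (cases "\<gamma> s = (k, c)")
      case True
      have "wp t B (refresh (6 * 2 ^ k) (k, c) ss u m) (\<lambda>B i' z. i + i' \<le> length (s # ss) * (10606 * 2 ^ k) \<and>
        snd z = m + card {s' \<in> set (s # ss). \<gamma> s' \<noteq> (k, c)} \<and>
        (\<exists>T'. okT t G B (fst z) T' \<and> tree_ok G (\<lambda>y. if y \<in> set (s # ss) then (k, c) else \<gamma> y) {1..n} T'))"
      proof (rule wp_mono[OF Cons.IH[OF okB Cons.prems(2,3), of m]], goal_cases)
        case (4 C i' z)
        have e: "(\<lambda>y. if y \<in> set (s # ss) then (k, c) else \<gamma> y) = (\<lambda>y. if y \<in> set ss then (k, c) else \<gamma> y)" using True by auto
        have cs2: "card {s' \<in> set (s # ss). \<gamma> s' \<noteq> (k, c)} = card {s' \<in> set ss. \<gamma> s' \<noteq> (k, c)}" using cs True by simp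
        have "i + i' \<le> length (s # ss) * (10606 * 2 ^ k)" using 4(2) 1(2) by simp
        then show ?case using 4(2) unfolding e cs2 by blast
      qed (use Cons.prems in auto)
      then show ?thesis using True 1 by simp
    next
      case False
      define \<gamma>1 where "\<gamma>1 = \<gamma>(s := (k, c))"
      have nk: "near (Suc k) s \<gamma>" using Cons.prems(6) by simp
      have "wp t B (bnd (upd s (k, c) u) (\<lambda>u. refresh (6 * 2 ^ k) (k, c) ss u (Suc m))) (\<lambda>B i' z. i + i' \<le> length (s # ss) * (10606 * 2 ^ k) \<and>
        snd z = m + card {s' \<in> set (s # ss). \<gamma> s' \<noteq> (k, c)} \<and>
        (\<exists>T'. okT t G B (fst z) T' \<and> tree_ok G (\<lambda>y. if y \<in> set (s # ss) then (k, c) else \<gamma> y) {1..n} T'))"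
      proof (rule wp_bnd[OF wp_upd[OF okB Cons.prems(2,3) assms(4) s(1) nk]], goal_cases)
        case 1 show ?case using assms(5) by simp
      next
        case (2 C i1 w)
        then obtain T1 where T1: "okT t G C w T1" "tree_ok G \<gamma>1 {1..n} T1" unfolding \<gamma>1_def by blast
        have so: "state_ok U \<gamma>1" using Cons.prems(3) sU assms(5,6) by (auto simp: state_ok_def \<gamma>1_def)
        have ne: "\<forall>s\<in>set ss. near (Suc k) s \<gamma>1"
        proof
          fix z assume "z \<in> set ss"
          then have "near (Suc k) z \<gamma>" using Cons.prems(6) by simp
          then show "near (Suc k) z \<gamma>1" by (rule near_cong[OF _ assms(5,6)]) (use s(2) in \<open>auto simp: \<gamma>1_def split: if_splits\<close>)
        qed
        have snss: "s \<notin> set ss" using Cons.prems(4) by simp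
        show ?case
        proof (rule wp_mono[OF Cons.IH[OF T1 so _ _ ne, of "Suc m"]], goal_cases)
          case (3 D i2 z)
          have e: "{s \<in> set ss. \<gamma>1 s \<noteq> (k, c)} = {s \<in> set ss. \<gamma> s \<noteq> (k, c)}"
            "(\<lambda>y. if y \<in> set (s # ss) then (k, c) else \<gamma> y) = (\<lambda>y. if y \<in> set ss then (k, c) else \<gamma>1 y)"
            using snss by (auto simp: \<gamma>1_def)
          have cs2: "Suc m + card {s \<in> set ss. \<gamma>1 s \<noteq> (k, c)} = m + card {s' \<in> set (s # ss). \<gamma> s' \<noteq> (k, c)}" using cs False e(1) by simp
          have "i + (i1 + i2) \<le> length (s # ss) * (10606 * 2 ^ k)" using 3(2) 2(2) 1(2) by simp
          then show ?case using 3(2) unfolding e(2) cs2 by blast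
        qed (use Cons.prems in auto)
      qed
      then show ?thesis using False 1 by simp
    qed
  qed
qed auto

text \<open>The summary at the root tells whether an item of the class is left. Evicted keys get the
  class \<open>3\<close>, which is none of the three age classes.\<close>

primrec evict :: "nat \<Rightarrow> nat \<times> nat \<Rightarrow> vt \<Rightarrow> vt dt" where
  "evict 0 st' u = Ret u"
| "evict (Suc e) st' u = bnd (opn u) (\<lambda>v. if st' \<in> vsm v
     then bnd (find (n + 1) st' v) (\<lambda>y. bnd (upd y (top, 3) v) (\<lambda>w. evict e st' w)) else Ret v)"

lemma wp_evict:
  assumes "okT t G A u T" "tree_ok G \<gamma> {1..n} T" "state_ok U \<gamma>" "U_ok U" "kap \<le> k" "k < top"
    "\<forall>y\<in>S k c \<gamma>. near (Suc k) y \<gamma>"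
  shows "wp t A (evict e (k, c) u) (\<lambda>B i w. i \<le> e * (10700 * 2 ^ k) \<and>
    (\<exists>T' E. E \<subseteq> S k c \<gamma> \<and> (card E = e \<or> E = S k c \<gamma>) \<and> okT t G B w T' \<and>
      tree_ok G (\<lambda>y. if y \<in> E then (top, 3) else \<gamma> y) {1..n} T'))"
  using assms(1-3,7)
proof (induction e arbitrary: A u T \<gamma>)
  case 0
  show ?case unfolding evict.simps wp_Ret
    by (intro conjI exI[of _ T] exI[of _ "{}"]) (use 0 in simp_all)
next
  case (Suc e)
  have p16: "(16::nat) \<le> 2 ^ k" using power_increasing[of 4 k "2::nat"] kap(1) assms(5) by simp
  show ?case unfolding evict.simps
  proof (rule wp_bnd[OF wp_opn1[OF okT_rep[OF Suc.prems(1) order_refl]]], goal_cases)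
    case (1 B i v)
    note c1 = 1
    have okv: "okT t G B v T" using 1 Suc.prems(1) by (auto simp: okT_def rep1_rep)
    have vs: "vsm v = snd ` set (ks T)" using rep1_vsm[of t B v T] sms_ks[OF okT_wf[OF okv]] 1 by simp
    show ?case
    proof (cases "(k, c) \<in> vsm v")
      case False
      have "S k c \<gamma> = {}"
      proof (rule ccontr)
        assume "S k c \<gamma> \<noteq> {}"
        then obtain y where "y \<in> {1..n}" "\<gamma> y = (k, c)" by (auto simp: S_def)
        then have "(y, (k, c)) \<in> set (ks T)" using tree_ok_mem[OF Suc.prems(2)] by metis
        then show False using False vs by force
      qed
      moreover have "i \<le> Suc e * (10700 * 2 ^ k)" using 1(2) p16 by simp
      ultimately show ?thesis unfolding if_not_P[OF False] wp_Ret
        by (intro conjI exI[of _ T] exI[of _ "{}"]) (use okv Suc.prems(2) in simp_all)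
    next
      case True
      have "wp t B (bnd (find (n + 1) (k, c) v) (\<lambda>y. bnd (upd y (top, 3) v) (\<lambda>w. evict e (k, c) w)))
       (\<lambda>B i' w. i + i' \<le> Suc e * (10700 * 2 ^ k) \<and>
        (\<exists>T' E. E \<subseteq> S k c \<gamma> \<and> (card E = Suc e \<or> E = S k c \<gamma>) \<and> okT t G B w T' \<and>
         tree_ok G (\<lambda>y. if y \<in> E then (top, 3) else \<gamma> y) {1..n} T'))"
      proof (rule wp_bnd[OF wp_find[OF okv, of _ _ k "\<lambda>i. 3 * 2 ^ i"]], goal_cases)
        case 1 show ?case using tree_ok_size[OF Suc.prems(2)] by simp
      next
        case 2 show ?case using True vs by simp
      next
        case 3 show ?case by simp
      next
        case 4 show ?case using height_bounded_tree(1)[OF Suc.prems(2) _ Suc.prems(3) assms(4,6)] by simp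
      next
        case (5 C i1 y)
        have g0: "ge 0 T" by (cases T) auto
        have "i1 \<le> 2 * (lh 0 T + (\<Sum>x\<in>{0<..k}. 3 * 2 ^ x)) + 2" using 5(2) g0 by blast
        also have "\<dots> \<le> 2 * (6 * 2 ^ k) + 2"
          by (intro add_le_mono1 mult_le_mono2 height_bounded_tree(2)[OF Suc.prems(2) order_refl Suc.prems(3) assms(4,6)])
        finally have i1: "i1 \<le> 12 * 2 ^ k + 2" by simp
        have y: "y \<in> {1..n}" "\<gamma> y = (k, c)" using 5(2) tree_ok_mem[OF Suc.prems(2), of y "(k, c)"] by simp_all
        then have yS: "y \<in> S k c \<gamma>" by (simp add: S_def)
        have "y \<in> U k" using Suc.prems(3) y assms(6) unfolding state_ok_def by (metis fst_conv less_irrefl)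
        then have ym: "y mod NN k = k" using assms(4-6) unfolding U_ok_def by blast
        define \<gamma>1 where "\<gamma>1 = \<gamma>(y := (top, 3))"
        have nk: "near (Suc k) y \<gamma>" using Suc.prems(4) yS by blast
        show ?case
        proof (rule wp_bnd[OF wp_upd[OF okT_mono[OF okv 5(1)] Suc.prems(2,3) assms(4) y(1) nk]], goal_cases)
          case 1 show ?case using assms(5) by simp
        next
          case (2 D i2 w)
          then have i2: "i2 \<le> 5300 * 2 ^ Suc k" by blast
          from 2 obtain T1 where T1: "okT t G D w T1" "tree_ok G \<gamma>1 {1..n} T1" unfolding \<gamma>1_def by blast
          have so: "state_ok U \<gamma>1" using Suc.prems(3) by (auto simp: state_ok_def \<gamma>1_def)
          have S1: "S k c \<gamma>1 = S k c \<gamma> - {y}" using assms(6) by (auto simp: S_def \<gamma>1_def)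
          have ne: "\<forall>z\<in>S k c \<gamma>1. near (Suc k) z \<gamma>1"
          proof
            fix z assume "z \<in> S k c \<gamma>1"
            then have "near (Suc k) z \<gamma>" using S1 Suc.prems(4) by blast
            then show "near (Suc k) z \<gamma>1" by (rule near_cong[OF _ assms(5,6)]) (use ym in \<open>auto simp: \<gamma>1_def split: if_splits\<close>)
          qed
          show ?case
          proof (rule wp_mono[OF Suc.IH[OF T1 so ne]], goal_cases)
            case (1 D' i3 w')
            then have i3: "i3 \<le> e * (10700 * 2 ^ k)" by blast
            from 1 obtain T' E where E: "E \<subseteq> S k c \<gamma>1" "card E = e \<or> E = S k c \<gamma>1" "okT t G D' w' T'"
              "tree_ok G (\<lambda>y. if y \<in> E then (top, 3) else \<gamma>1 y) {1..n} T'" by blast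
            have "finite E" "y \<notin> E" using E(1) S1 finite_subset[OF E(1) finite_S] by auto
            have 1: "(\<lambda>z. if z \<in> insert y E then (top, 3) else \<gamma> z) = (\<lambda>z. if z \<in> E then (top, 3) else \<gamma>1 z)"
              by (auto simp: \<gamma>1_def)
            have 2: "insert y E \<subseteq> S k c \<gamma>" "card (insert y E) = Suc e \<or> insert y E = S k c \<gamma>"
              using E(1,2) S1 yS \<open>finite E\<close> \<open>y \<notin> E\<close> by auto
            have 3: "i + (i1 + (i2 + i3)) \<le> Suc e * (10700 * 2 ^ k)"
              using c1(2) i2 i3 i1 p16 by simp
            show ?case
              by (intro conjI exI[of _ T'] exI[of _ "insert y E"] 2 3 E(3)) (use E(4) 1 in simp)
          qed
        qed
      qed
      then show ?thesis using True by simp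
    qed
  qed
qed

end

section \<open>Age classes and a whole access\<close>

context sep
begin

text \<open>Classes rotate modulo 3: if \<open>c\<close> is current, then \<open>c + 2\<close> was
  current in the preceding phase, and \<open>c + 1\<close> before that; the latter is also the next
  to become current.\<close>

definition old :: "(nat \<Rightarrow> nat \<times> nat) \<Rightarrow> nat \<Rightarrow> nat" where
  "old g k = (fst (g k) + 1) mod 3"

definition prv :: "(nat \<Rightarrow> nat \<times> nat) \<Rightarrow> nat \<Rightarrow> nat" where
  "prv g k = (fst (g k) + 2) mod 3"

lemma classes:
  assumes "fst (g k) < 3"
  shows "old g k \<noteq> fst (g k)" "prv g k \<noteq> fst (g k)" "old g k \<noteq> prv g k" "{fst (g k), prv g k, old g k} = {0, 1, 2}"
proof -
  have "fst (g k) = 0 \<or> fst (g k) = 1 \<or> fst (g k) = 2" using assms by linarith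
  then show "old g k \<noteq> fst (g k)" "prv g k \<noteq> fst (g k)" "old g k \<noteq> prv g k" "{fst (g k), prv g k, old g k} = {0, 1, 2}"
    by (auto simp: old_def prv_def)
qed

definition level_rel :: "nat \<Rightarrow> (nat \<Rightarrow> nat \<times> nat) \<Rightarrow> (nat \<Rightarrow> nat \<times> nat) \<Rightarrow> (nat \<Rightarrow> nat \<times> nat) \<Rightarrow> nat \<Rightarrow> bool" where
  "level_rel x g \<gamma> \<gamma>' k \<longleftrightarrow> S k (fst (g k)) \<gamma>' = S k (fst (g k)) \<gamma> \<union> W k x \<and>
     S k (prv g k) \<gamma>' = S k (prv g k) \<gamma> - W k x \<and>
     card (S k (old g k) \<gamma>') \<le> card (S k (old g k) \<gamma>) - 10 \<and>
     (\<forall>j. j \<noteq> fst (g k) \<longrightarrow> S k j \<gamma>' \<subseteq> S k j \<gamma> - W k x)"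

definition lev1 :: "nat \<Rightarrow> nat \<Rightarrow> (nat \<Rightarrow> nat \<times> nat) \<Rightarrow> vt \<Rightarrow> (vt \<times> nat) dt" where
  "lev1 k x g u = bnd (refresh (6 * 2 ^ k) (k, fst (g k)) (W_list k x) u 0)
     (\<lambda>z. bnd (evict 10 (k, old g k) (fst z)) (\<lambda>w. Ret (w, snd z)))"

definition chg :: "nat \<Rightarrow> (nat \<Rightarrow> nat \<times> nat) \<Rightarrow> (nat \<Rightarrow> nat \<times> nat) \<Rightarrow> bool" where
  "chg k \<gamma> \<gamma>' \<longleftrightarrow> (\<forall>z\<in>{1..n}. \<gamma> z \<noteq> \<gamma>' z \<longrightarrow> z mod NN k = k)"

lemma wp_lev1:
  assumes "okT t G A u T" "tree_ok G \<gamma> {1..n} T" "state_ok U \<gamma>" "U_ok U" "kap \<le> k" "k < top"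
    "W k x \<subseteq> U k" "fst (g k) < 3" "\<forall>s\<in>W k x. near (Suc k) s \<gamma>" "\<forall>y\<in>S k (old g k) \<gamma>. near (Suc k) y \<gamma>"
  shows "wp t A (lev1 k x g u) (\<lambda>B i z. i \<le> 160100 * 2 ^ k \<and> snd z = card (W k x - S k (fst (g k)) \<gamma>) \<and>
    (\<exists>T' \<gamma>'. okT t G B (fst z) T' \<and> tree_ok G \<gamma>' {1..n} T' \<and> state_ok U \<gamma>' \<and> level_rel x g \<gamma> \<gamma>' k \<and> chg k \<gamma> \<gamma>'))"
  unfolding lev1_def
proof (rule wp_bnd[OF wp_refresh[OF assms(1-6) W_list(2)]], goal_cases)
  case 1 show ?case using assms(7) by (simp add: W_list)
next
  case 2 show ?case using assms(9) by (simp add: W_list)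
next
  case (3 B i z)
  define c where "c = fst (g k)"
  define \<gamma>1 where "\<gamma>1 = (\<lambda>y. if y \<in> W k x then (k, c) else \<gamma> y)"
  obtain T1 where T1: "okT t G B (fst z) T1" "tree_ok G \<gamma>1 {1..n} T1"
    using 3(2) unfolding \<gamma>1_def c_def W_list(1) by blast
  have "length (W_list k x) * (10606 * 2 ^ k) \<le> 5 * (10606 * 2 ^ k)" using W_list(3) by (rule mult_le_mono1)
  then have "i \<le> 5 * (10606 * 2 ^ k)" using conjunct1[OF 3(2)] order_trans by blast
  then have i: "i \<le> 53030 * 2 ^ k" by simp
  have "{s \<in> W k x. \<gamma> s \<noteq> (k, c)} = W k x - S k c \<gamma>" using W_sub[of k x] unfolding S_def by blast
  then have m: "snd z = card (W k x - S k c \<gamma>)" using 3(2) by (simp add: W_list c_def)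
  have so: "state_ok U \<gamma>1" using assms(3,5-7) by (auto simp: state_ok_def \<gamma>1_def)
  have Wm: "s mod NN k = k" if "s \<in> W k x" for s using that by (simp add: W_def)
  have co: "old g k \<noteq> c" "prv g k \<noteq> c" "old g k \<noteq> prv g k" using classes[of g k] assms(8) by (auto simp: c_def)
  have S1: "S k (old g k) \<gamma>1 = S k (old g k) \<gamma> - W k x" using co by (auto simp: S_def \<gamma>1_def)
  have ne: "\<forall>y\<in>S k (old g k) \<gamma>1. near (Suc k) y \<gamma>1"
  proof
    fix y assume "y \<in> S k (old g k) \<gamma>1"
    then have "near (Suc k) y \<gamma>" using S1 assms(10) by blast
    then show "near (Suc k) y \<gamma>1" by (rule near_cong[OF _ assms(5,6)]) (use Wm in \<open>auto simp: \<gamma>1_def split: if_splits\<close>)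
  qed
  show ?case
  proof (rule wp_bnd[OF wp_evict[OF T1 so assms(4-6) ne]], goal_cases)
    case (1 C i' w)
    then obtain T2 E where E: "E \<subseteq> S k (old g k) \<gamma>1" "card E = 10 \<or> E = S k (old g k) \<gamma>1" "okT t G C w T2"
      "tree_ok G (\<lambda>y. if y \<in> E then (top, 3) else \<gamma>1 y) {1..n} T2" by blast
    define \<gamma>2 where "\<gamma>2 = (\<lambda>y. if y \<in> E then (top, 3) else \<gamma>1 y)"
    have EU: "y \<in> U k" if "y \<in> E" for y
    proof -
      have "\<gamma>1 y = (k, old g k)" "y \<in> {1..n}" using that E(1) by (auto simp: S_def)
      then show ?thesis using so assms(6) unfolding state_ok_def by (metis fst_conv less_irrefl)
    qed
    have Em: "y mod NN k = k" if "y \<in> E" for y using EU[OF that] assms(4-6) unfolding U_ok_def by blast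
    have so2: "state_ok U \<gamma>2" using so by (auto simp: state_ok_def \<gamma>2_def)
    have ch: "chg k \<gamma> \<gamma>2" using Em Wm by (auto simp: chg_def \<gamma>2_def \<gamma>1_def split: if_splits)
    have E1: "\<gamma>1 y = (k, old g k)" if "y \<in> E" for y using that E(1) by (auto simp: S_def)
    have Sj: "S k j \<gamma>2 = S k j \<gamma>1 - E" for j using assms(6) by (auto simp: S_def \<gamma>2_def)
    have "S k c \<gamma>2 = S k c \<gamma> \<union> W k x"
    proof -
      have "S k c \<gamma>1 = S k c \<gamma> \<union> W k x" using W_sub[of k x] by (auto simp: S_def \<gamma>1_def)
      moreover have "E \<inter> S k c \<gamma>1 = {}" using E1 co(1) by (auto simp: S_def)
      ultimately show ?thesis unfolding Sj by blast
    qed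
    moreover have "S k (prv g k) \<gamma>2 = S k (prv g k) \<gamma> - W k x"
    proof -
      have "S k (prv g k) \<gamma>1 = S k (prv g k) \<gamma> - W k x" using co(2) by (auto simp: S_def \<gamma>1_def)
      moreover have "E \<inter> S k (prv g k) \<gamma>1 = {}" using E1 co(3) by (auto simp: S_def)
      ultimately show ?thesis unfolding Sj by blast
    qed
    moreover have "card (S k (old g k) \<gamma>2) \<le> card (S k (old g k) \<gamma>) - 10"
    proof -
      have "card (S k (old g k) \<gamma>2) = card (S k (old g k) \<gamma>1) - card E"
        unfolding Sj by (rule card_Diff_subset) (use E(1) finite_subset[OF E(1) finite_S] in auto)
      moreover have "card (S k (old g k) \<gamma>1) \<le> card (S k (old g k) \<gamma>)" unfolding S1 by (rule card_mono) auto
      ultimately show ?thesis using E(2) by auto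
    qed
    moreover have "S k j \<gamma>2 \<subseteq> S k j \<gamma> - W k x" if "j \<noteq> c" for j using that unfolding Sj by (auto simp: S_def \<gamma>1_def)
    ultimately have lr: "level_rel x g \<gamma> \<gamma>2 k" unfolding level_rel_def c_def by blast
    have "i + i' \<le> 160100 * 2 ^ k" using i 1(2) by simp
    then show ?case unfolding wp_Ret add_0_right fst_conv snd_conv
      by (intro conjI exI[of _ T2] exI[of _ \<gamma>2]) (use m E so2 lr ch in \<open>simp_all add: c_def \<gamma>2_def\<close>)
  qed
qed

lemma S_cong:
  assumes "chg k \<gamma> \<gamma>'" "state_ok U \<gamma>" "state_ok U \<gamma>'" "U_ok U" "kap \<le> k" "k < top" "i \<noteq> k" "i < top"
  shows "S i j \<gamma>' = S i j \<gamma>"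
proof -
  have *: "\<delta> y = \<gamma> y \<and> \<delta> y = \<gamma>' y" if "y \<in> {1..n}" "\<delta> y = (i, j)" "\<delta> = \<gamma> \<or> \<delta> = \<gamma>'" for y \<delta>
  proof -
    have so: "state_ok U \<delta>" using that(3) assms(2,3) by blast
    have i: "kap \<le> i" "y \<in> U i" using so that(1,2) assms(8) unfolding state_ok_def by (metis fst_conv less_irrefl)+
    then have "y mod NN i = i" using assms(4,8) unfolding U_ok_def by blast
    then have "y mod NN k \<noteq> k" using sep_unique[of k i y] assms(5-8) i by auto
    then have "\<gamma> y = \<gamma>' y" using assms(1) that(1) unfolding chg_def by blast
    then show ?thesis using that(3) by auto
  qed
  show ?thesis
  proof (intro equalityI subsetI)
    fix y assume "y \<in> S i j \<gamma>'"
    then have "y \<in> {1..n}" "\<gamma>' y = (i, j)" by (simp_all add: S_def)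
    then show "y \<in> S i j \<gamma>" using *[of y \<gamma>'] by (simp add: S_def)
  next
    fix y assume "y \<in> S i j \<gamma>"
    then have "y \<in> {1..n}" "\<gamma> y = (i, j)" by (simp_all add: S_def)
    then show "y \<in> S i j \<gamma>'" using *[of y \<gamma>] by (simp add: S_def)
  qed
qed

lemma W_near:
  assumes "s \<in> W k x" "q \<in> {1..n}" "q mod NN (Suc k) = Suc k" "q \<le> s + NN (Suc k)" "s \<le> q + NN (Suc k)"
  shows "q \<in> W (Suc k) x"
  using assms NN_2[of k "Suc k"] by (auto simp: W_def)

text \<open>Layers are treated from \<open>kap + d - 1\<close> down to \<open>kap\<close>, because
  the window in layer \<open>k + 1\<close> has to be complete before items of layer \<open>k\<close>
  move.\<close>

fun levels :: "nat \<Rightarrow> nat \<Rightarrow> (nat \<Rightarrow> nat \<times> nat) \<Rightarrow> vt \<Rightarrow> (vt \<times> (nat \<Rightarrow> nat \<times> nat)) dt" where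
  "levels 0 x g u = Ret (u, g)"
| "levels (Suc d) x g u = bnd (lev1 (kap + d) x g u)
     (\<lambda>z. levels d x (g(kap + d := (fst (g (kap + d)), snd (g (kap + d)) + snd z))) (fst z))"

lemma wp_levels:
  assumes "okT t G A u T" "tree_ok G \<gamma> {1..n} T" "state_ok U \<gamma>" "U_ok U" "d = 0 \<or> kap + d \<le> top"
    "\<forall>k. kap \<le> k \<and> k < top \<longrightarrow> fst (g k) < 3"
    "\<forall>k. kap \<le> k \<and> k < kap + d \<longrightarrow> W k x \<subseteq> U k"
    "kap + d < top \<longrightarrow> (\<forall>q\<in>W (kap + d) x. fst (\<gamma> q) = kap + d)"
    "\<forall>k. kap \<le> k \<and> k < kap + d \<and> Suc k < top \<longrightarrow> (\<forall>y\<in>S k (old g k) \<gamma>. \<forall>q\<in>{1..n}. q mod NN (Suc k) = Suc k \<longrightarrow>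
       q \<le> y + NN (Suc k) \<longrightarrow> y \<le> q + NN (Suc k) \<longrightarrow> \<gamma> q = (Suc k, fst (g (Suc k))) \<or> \<gamma> q = (Suc k, prv g (Suc k)))"
  shows "wp t A (levels d x g u) (\<lambda>B i z. i \<le> (\<Sum>k\<in>{kap..<kap + d}. 160100 * 2 ^ k) \<and>
    (\<forall>k. snd z k = (if kap \<le> k \<and> k < kap + d then (fst (g k), snd (g k) + card (W k x - S k (fst (g k)) \<gamma>)) else g k)) \<and>
    (\<exists>T' \<gamma>'. okT t G B (fst z) T' \<and> tree_ok G \<gamma>' {1..n} T' \<and> state_ok U \<gamma>' \<and>
      (\<forall>k. kap \<le> k \<and> k < kap + d \<longrightarrow> level_rel x g \<gamma> \<gamma>' k) \<and>
      (\<forall>k j. k < top \<longrightarrow> \<not> (kap \<le> k \<and> k < kap + d) \<longrightarrow> S k j \<gamma>' = S k j \<gamma>)))"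
  using assms(1-3,5-)
proof (induction d arbitrary: A u T \<gamma> g)
  case 0
  show ?case unfolding levels.simps wp_Ret fst_conv snd_conv
    by (intro conjI exI[of _ T] exI[of _ \<gamma>]) (use 0 in auto)
next
  case (Suc d)
  define k where "k = kap + d"
  have k: "kap \<le> k" "k < top" using Suc.prems(4) by (auto simp: k_def)
  have old3: "fst (g k) < 3" using Suc.prems(5) k by simp
  have n1: "\<forall>s\<in>W k x. near (Suc k) s \<gamma>"
  proof
    fix s assume s: "s \<in> W k x"
    show "near (Suc k) s \<gamma>" unfolding near_def
    proof (intro impI ballI)
      fix q assume q: "Suc k < top" "q \<in> {1..n}" "q mod NN (Suc k) = Suc k" "q \<le> s + NN (Suc k)" "s \<le> q + NN (Suc k)"
      then show "fst (\<gamma> q) = Suc k" using W_near[OF s q(2-5)] Suc.prems(7) by (simp add: k_def)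
    qed
  qed
  have n2: "\<forall>y\<in>S k (old g k) \<gamma>. near (Suc k) y \<gamma>"
  proof
    fix y assume y: "y \<in> S k (old g k) \<gamma>"
    show "near (Suc k) y \<gamma>" unfolding near_def
    proof (intro impI ballI)
      fix q assume q: "Suc k < top" "q \<in> {1..n}" "q mod NN (Suc k) = Suc k" "q \<le> y + NN (Suc k)" "y \<le> q + NN (Suc k)"
      then have "\<gamma> q = (Suc k, fst (g (Suc k))) \<or> \<gamma> q = (Suc k, prv g (Suc k))"
        using Suc.prems(8)[rule_format, of k y q] k y by (simp add: k_def)
      then show "fst (\<gamma> q) = Suc k" by auto
    qed
  qed
  have WU: "W k x \<subseteq> U k" using Suc.prems(6) by (simp add: k_def)
  show ?case unfolding levels.simps k_def[symmetric]
  proof (rule wp_bnd[OF wp_lev1[OF Suc.prems(1-3) assms(4) k WU old3 n1 n2]], goal_cases)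
    case (1 B i z)
    then have i: "i \<le> 160100 * 2 ^ k" "snd z = card (W k x - S k (fst (g k)) \<gamma>)" by blast+
    from 1 obtain T1 \<gamma>1 where T1: "okT t G B (fst z) T1" "tree_ok G \<gamma>1 {1..n} T1" "state_ok U \<gamma>1" "level_rel x g \<gamma> \<gamma>1 k" "chg k \<gamma> \<gamma>1"
      by blast
    have Sc: "S k2 j \<gamma>1 = S k2 j \<gamma>" if "k2 \<noteq> k" "k2 < top" for k2 j
      using S_cong[OF T1(5) Suc.prems(3) T1(3) assms(4) k that] .
    define g1 where "g1 = g(k := (fst (g k), snd (g k) + snd z))"
    have fg: "fst (g1 k2) = fst (g k2)" "old g1 k2 = old g k2" "prv g1 k2 = prv g k2" for k2 by (auto simp: g1_def old_def prv_def)
    have p1: "d = 0 \<or> kap + d \<le> top" using k by (simp add: k_def)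
    have p2: "\<forall>k. kap \<le> k \<and> k < top \<longrightarrow> fst (g1 k) < 3" using Suc.prems(5) fg by simp
    have p3: "\<forall>k. kap \<le> k \<and> k < kap + d \<longrightarrow> W k x \<subseteq> U k" using Suc.prems(6) by simp
    have Wc: "\<gamma>1 q = (k, fst (g k))" if "q \<in> W k x" for q
    proof -
      have "q \<in> S k (fst (g k)) \<gamma>1" using T1(4) that by (simp add: level_rel_def)
      then show ?thesis by (simp add: S_def)
    qed
    have p4: "kap + d < top \<longrightarrow> (\<forall>q\<in>W (kap + d) x. fst (\<gamma>1 q) = kap + d)" using Wc by (simp add: k_def)
    \<comment> \<open>The required neighbours in the next layer stay in the two younger classes: a
      refresh only moves items into the current class, and eviction takes only oldest ones.\<close>
    have p5: "\<forall>k. kap \<le> k \<and> k < kap + d \<and> Suc k < top \<longrightarrow> (\<forall>y\<in>S k (old g1 k) \<gamma>1. \<forall>q\<in>{1..n}. q mod NN (Suc k) = Suc k \<longrightarrow>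
       q \<le> y + NN (Suc k) \<longrightarrow> y \<le> q + NN (Suc k) \<longrightarrow> \<gamma>1 q = (Suc k, fst (g1 (Suc k))) \<or> \<gamma>1 q = (Suc k, prv g1 (Suc k)))"
    proof (intro allI impI ballI)
      fix k2 y q assume h: "kap \<le> k2 \<and> k2 < kap + d \<and> Suc k2 < top" "y \<in> S k2 (old g1 k2) \<gamma>1" "q \<in> {1..n}"
        "q mod NN (Suc k2) = Suc k2" "q \<le> y + NN (Suc k2)" "y \<le> q + NN (Suc k2)"
      have "y \<in> S k2 (old g k2) \<gamma>" using h(1,2) Sc[of k2] fg by (simp add: k_def)
      then obtain j where j: "\<gamma> q = (Suc k2, j)" "j = fst (g (Suc k2)) \<or> j = prv g (Suc k2)"
        using Suc.prems(8)[rule_format, of k2 y q] h by auto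
      then have qS: "q \<in> S (Suc k2) j \<gamma>" using h(3) by (simp add: S_def)
      show "\<gamma>1 q = (Suc k2, fst (g1 (Suc k2))) \<or> \<gamma>1 q = (Suc k2, prv g1 (Suc k2))"
      proof (cases "Suc k2 = k \<and> q \<in> W k x")
        case True
        then show ?thesis using Wc[of q] fg by auto
      next
        case False
        have "q \<in> S (Suc k2) j \<gamma>1"
        proof (cases "Suc k2 = k")
          case True
          then show ?thesis using j(2) qS False T1(4) unfolding level_rel_def by auto
        next
          case False
          then show ?thesis using Sc[of "Suc k2" j] h(1) qS by simp
        qed
        then show ?thesis using j fg by (auto simp: S_def)
      qed
    qed
    show ?case unfolding g1_def[symmetric]
    proof (rule wp_mono[OF Suc.IH[OF T1(1-3) p1 p2 p3 p4 p5]], goal_cases)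
      case (1 C i' w)
      then have i': "i' \<le> (\<Sum>k\<in>{kap..<kap + d}. 160100 * 2 ^ k)"
        and gw: "\<And>k. snd w k = (if kap \<le> k \<and> k < kap + d then (fst (g1 k), snd (g1 k) + card (W k x - S k (fst (g1 k)) \<gamma>1)) else g1 k)" by blast+
      from 1 obtain T2 \<gamma>2 where T2: "okT t G C (fst w) T2" "tree_ok G \<gamma>2 {1..n} T2" "state_ok U \<gamma>2"
        "\<forall>k. kap \<le> k \<and> k < kap + d \<longrightarrow> level_rel x g1 \<gamma>1 \<gamma>2 k"
        "\<forall>k j. k < top \<longrightarrow> \<not> (kap \<le> k \<and> k < kap + d) \<longrightarrow> S k j \<gamma>2 = S k j \<gamma>1" by blast
      have "i + i' \<le> (\<Sum>k\<in>{kap..<kap + Suc d}. 160100 * 2 ^ k)" using i(1) i' by (simp add: k_def)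
      moreover have "snd w k2 = (if kap \<le> k2 \<and> k2 < kap + Suc d then (fst (g k2), snd (g k2) + card (W k2 x - S k2 (fst (g k2)) \<gamma>)) else g k2)" for k2
      proof (cases "k2 = k")
        case True
        then show ?thesis using gw[of k2] i(2) by (simp add: g1_def k_def)
      next
        case False
        then have "S k2 j \<gamma>1 = S k2 j \<gamma>" if "k2 < kap + d" for j using Sc[of k2 j] that k by (simp add: k_def)
        then show ?thesis using gw[of k2] False by (auto simp: g1_def k_def)
      qed
      moreover have "level_rel x g \<gamma> \<gamma>2 k2" if "kap \<le> k2" "k2 < kap + Suc d" for k2
      proof (cases "k2 = k")
        case True
        have "S k j \<gamma>2 = S k j \<gamma>1" for j using T2(5) k by (simp add: k_def)
        then show ?thesis using T1(4) True by (simp add: level_rel_def)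
      next
        case False
        then have "k2 < kap + d" "k2 < top" using that k by (auto simp: k_def)
        then have "level_rel x g1 \<gamma>1 \<gamma>2 k2" using T2(4) that by blast
        then show ?thesis using Sc[OF False \<open>k2 < top\<close>] fg unfolding level_rel_def by simp
      qed
      moreover have "S k2 j \<gamma>2 = S k2 j \<gamma>" if "k2 < top" "\<not> (kap \<le> k2 \<and> k2 < kap + Suc d)" for k2 j
      proof -
        have "k2 \<noteq> k" "\<not> (kap \<le> k2 \<and> k2 < kap + d)" using that by (auto simp: k_def)
        then show ?thesis using T2(5) Sc that by simp
      qed
      ultimately show ?case by (intro conjI exI[of _ T2] exI[of _ \<gamma>2] T2(1-3)) blast+
    qed
  qed
qed

text \<open>A full phase ends: the (by then empty) oldest class becomes the current one.\<close>
definition flip :: "(nat \<Rightarrow> nat \<times> nat) \<Rightarrow> nat \<Rightarrow> nat \<times> nat" where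
  "flip g k = (if kap \<le> k \<and> k < top \<and> NN k \<le> snd (g k) then ((fst (g k) + 1) mod 3, 0) else g k)"

text \<open>The globals are read at the old root and written to the root of the result, which may be
  another node. By the time of the final search layer \<open>kap\<close> holds all separators around
  \<open>x\<close>, so finding \<open>x\<close> costs only \<open>O(2 ^ kap)\<close>.\<close>

definition prog :: "nat \<Rightarrow> vt dt" where
  "prog x = bnd (opn (VH [])) (\<lambda>v. bnd (probe (top - kap) kap (flip (gl (vrt v))) x v) (\<lambda>k.
     bnd (levels (k - kap) x (flip (gl (vrt v))) v) (\<lambda>z. bnd (srch (n + 1) x (fst z)) (\<lambda>r.
     bnd (opn (fst z)) (\<lambda>w. Ret (case w of VN l a r \<Rightarrow> VN l (ND (ky a) (st a) (ht a) (sm a) (snd z)) r | _ \<Rightarrow> w))))))"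

text \<open>An upper bound for the number of insertions into layer \<open>k\<close> since \<open>s\<close> was inserted.\<close>
definition age :: "(nat \<Rightarrow> nat \<times> nat) \<Rightarrow> (nat \<Rightarrow> nat \<times> nat) \<Rightarrow> nat \<Rightarrow> nat \<Rightarrow> nat" where
  "age \<gamma> g k s = snd (g k) + (if snd (\<gamma> s) = fst (g k) then 0 else if snd (\<gamma> s) = prv g k then NN k + 4 else 2 * (NN k + 4))"

text \<open>A separator cached in layer \<open>k\<close> has all separators of level \<open>k + 1\<close> near it cached as well, and none of them is of the oldest
  class: they were fresh or refreshed when it was inserted, and since then an access inserted at most five items into layer
  \<open>k + 1\<close>, and none unless it inserted one into layer \<open>k\<close>.\<close>
definition incl :: "(nat \<Rightarrow> nat \<times> nat) \<Rightarrow> (nat \<Rightarrow> nat \<times> nat) \<Rightarrow> bool" where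
  "incl \<gamma> g \<longleftrightarrow> (\<forall>k s q. kap \<le> k \<longrightarrow> Suc k < top \<longrightarrow> s \<in> {1..n} \<longrightarrow> fst (\<gamma> s) = k \<longrightarrow> q \<in> {1..n} \<longrightarrow>
     q mod NN (Suc k) = Suc k \<longrightarrow> q \<le> s + NN (Suc k) \<longrightarrow> s \<le> q + NN (Suc k) \<longrightarrow>
     \<gamma> q = (Suc k, fst (g (Suc k))) \<or> \<gamma> q = (Suc k, prv g (Suc k)) \<and> snd (g (Suc k)) \<le> 5 * age \<gamma> g k s)"

definition lay_ok :: "(nat \<Rightarrow> nat \<times> nat) \<Rightarrow> bool" where
  "lay_ok \<gamma> \<longleftrightarrow> (\<forall>y\<in>{1..n}. \<gamma> y = (top, 3) \<or> kap \<le> fst (\<gamma> y) \<and> fst (\<gamma> y) < top \<and> snd (\<gamma> y) < 3 \<and> y mod NN (fst (\<gamma> y)) = fst (\<gamma> y))"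

text \<open>Ten evictions against at most five insertions make the oldest class shrink at least
  twice as fast as the counter grows, so it is empty when the counter reaches \<open>NN k\<close>
  and the phase ends. The slack \<open>4\<close> is the overshoot of the last access, which starts
  below \<open>NN k\<close>.\<close>

definition cnt_ok :: "(nat \<Rightarrow> nat \<times> nat) \<Rightarrow> (nat \<Rightarrow> nat \<times> nat) \<Rightarrow> bool" where
  "cnt_ok \<gamma> g \<longleftrightarrow> (\<forall>k. kap \<le> k \<and> k < top \<longrightarrow> fst (g k) < 3 \<and> snd (g k) \<le> NN k + 4 \<and> card (S k (fst (g k)) \<gamma>) = snd (g k) \<and>
     card (S k (prv g k) \<gamma>) \<le> NN k + 4 \<and> card (S k (old g k) \<gamma>) \<le> NN k + 4 - 2 * snd (g k))"

text \<open>The effect of an access with stopping level \<open>k'\<close>. The maximum with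
  \<open>kap\<close> is for small \<open>n\<close>, where \<open>top \<le> kap\<close> and nothing
  is cached.\<close>

definition acc :: "nat \<Rightarrow> (nat \<Rightarrow> nat \<times> nat) \<Rightarrow> (nat \<Rightarrow> nat \<times> nat) \<Rightarrow> (nat \<Rightarrow> nat \<times> nat) \<Rightarrow> (nat \<Rightarrow> nat \<times> nat) \<Rightarrow> nat \<Rightarrow> bool" where
  "acc x \<gamma> g \<gamma>' g' k' \<longleftrightarrow> kap \<le> k' \<and> k' \<le> max kap top \<and> lay_ok \<gamma>' \<and> (k' < top \<longrightarrow> fresh \<gamma> g x k') \<and>
     (\<forall>k. kap \<le> k \<and> k < k' \<longrightarrow> \<not> fresh \<gamma> g x k \<and> level_rel x g \<gamma> \<gamma>' k \<and>
        g' k = (fst (g k), snd (g k) + card (W k x - S k (fst (g k)) \<gamma>))) \<and>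
     (\<forall>k. \<not> (kap \<le> k \<and> k < k') \<longrightarrow> g' k = g k \<and> (k < top \<longrightarrow> (\<forall>j. S k j \<gamma>' = S k j \<gamma>)))"

fun rgl :: "nd tree \<Rightarrow> nat \<Rightarrow> nat \<times> nat" where
  "rgl Leaf = (\<lambda>_. (0, 0))"
| "rgl (Node l a r) = gl a"

lemma level_classes:
  assumes "lay_ok \<gamma>" "fst (g k) < 3" "kap \<le> k" "k < top"
  shows "{y \<in> {1..n}. fst (\<gamma> y) = k} = S k (fst (g k)) \<gamma> \<union> S k (prv g k) \<gamma> \<union> S k (old g k) \<gamma>"
proof -
  have "snd (\<gamma> y) \<in> {fst (g k), prv g k, old g k}" if "y \<in> {1..n}" "fst (\<gamma> y) = k" for y
  proof -
    have "snd (\<gamma> y) < 3" using assms(1,4) that unfolding lay_ok_def by (metis fst_conv less_irrefl)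
    then have "snd (\<gamma> y) \<in> {0, 1, 2}" by auto
    then show ?thesis using classes(4)[of g k] assms(2) by simp
  qed
  then show ?thesis by (auto simp: S_def prod_eq_iff)
qed

lemma wp_prog:
  assumes T: "tree_ok G \<gamma> {1..n} T" and g: "g = flip (rgl T)" and inv: "lay_ok \<gamma>" "cnt_ok \<gamma> g" "incl \<gamma> g" "g \<in> G"
    and r: "\<forall>k. kap \<le> k \<and> k < top \<longrightarrow> snd (g k) < NN k" and x: "x \<in> {1..n}"
  shows "wp T {} (prog x) (\<lambda>B m u. \<exists>k' \<gamma>' g' T'. m \<le> 170000 * 2 ^ k' \<and> rep T B u T' \<and> x \<in> vis T B \<and>
    tree_ok G \<gamma>' {1..n} T' \<and> rgl T' = g' \<and> g' \<in> G \<and> acc x \<gamma> g \<gamma>' g' k')"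
proof -
  \<comment> \<open>The items of the layer at the start, and those which this access may
    add.\<close>
  define U where "U i = {y \<in> {1..n}. fst (\<gamma> y) = i} \<union> W i x" for i
  have Uok: "U_ok U" unfolding U_ok_def
  proof (intro allI impI)
    fix i assume i: "kap \<le> i" "i < top"
    have c: "fst (g i) < 3" "snd (g i) \<le> NN i + 4" "card (S i (fst (g i)) \<gamma>) = snd (g i)"
     "card (S i (prv g i) \<gamma>) \<le> NN i + 4" "card (S i (old g i) \<gamma>) \<le> NN i + 4 - 2 * snd (g i)"
      using inv(2) i unfolding cnt_ok_def by blast+
    have "card {y \<in> {1..n}. fst (\<gamma> y) = i} \<le> card (S i (fst (g i)) \<gamma>) + card (S i (prv g i) \<gamma>) + card (S i (old g i) \<gamma>)"
      unfolding level_classes[of \<gamma> g i, OF inv(1) c(1) i]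
      by (rule order_trans[OF card_Un_le add_right_mono[OF card_Un_le]])
    also have "\<dots> \<le> 2 * NN i + 8" using c by linarith
    finally have "card (U i) \<le> 2 * NN i + 8 + 5"
      unfolding U_def by (rule order_trans[OF card_Un_le add_mono[OF _ card_W]])
    moreover have "\<forall>y\<in>U i. y mod NN i = i" 
    proof
      fix y assume "y \<in> U i"
      then consider "y \<in> {1..n}" "fst (\<gamma> y) = i" | "y \<in> W i x" by (auto simp: U_def)
      then show "y mod NN i = i"
      proof cases
        case 1
        then show ?thesis using inv(1) i unfolding lay_ok_def by (metis fst_conv less_irrefl)
      qed (simp add: W_def)
    qed
    ultimately show "U i \<subseteq> {1..n} \<and> card (U i) \<le> 3 * (NN i + 5) \<and> (\<forall>y\<in>U i. y mod NN i = i)"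
      using W_sub by (auto simp: U_def)
  qed
  have so: "state_ok U \<gamma>" using inv(1) by (auto simp: state_ok_def lay_ok_def U_def)
  have wfT: "wf G T" using T by (simp add: tree_ok_def)
  have "size T = n" using tree_ok_size[OF T] by simp
  then have "T \<noteq> Leaf" using n1 by auto
  have rT: "rep T {} (VH []) T" using \<open>T \<noteq> Leaf\<close> by (simp add: rep_def reach_def)
  show ?thesis unfolding prog_def
  proof (rule wp_bnd[OF wp_opn1[OF rT]], goal_cases)
    case (1 A m v)
    note c1 = 1
    have vr: "gl (vrt v) = rgl T"
    proof -
      obtain L a R where "T = Node L a R" using \<open>T \<noteq> Leaf\<close> by (cases T) auto
      then show ?thesis using c1(2) by (auto simp: rep1_Node vrt_def)
    qed
    have okv: "okT T G A v T" using c1(2) wfT by (simp add: okT_def rep1_rep)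
    show ?case unfolding vr g[symmetric]
    proof (rule wp_bnd[OF wp_probe[OF okv T so Uok refl]], goal_cases)
      case (1 B m1 k')
      note c2 = 1
      have k': "kap \<le> k'" "k' \<le> max kap top" "m1 \<le> (\<Sum>j\<in>{kap..<Suc k'}. 30 * 2 ^ j)"
        "\<And>j. kap \<le> j \<Longrightarrow> j < k' \<Longrightarrow> \<not> fresh \<gamma> g x j" "k' < top \<Longrightarrow> fresh \<gamma> g x k'" using c2(2) by blast+
      define d where "d = k' - kap"
      have d: "kap + d = k'" "d = 0 \<or> kap + d \<le> top" using k' by (auto simp: d_def)
      have p1: "\<forall>k. kap \<le> k \<and> k < top \<longrightarrow> fst (g k) < 3" using inv(2) unfolding cnt_ok_def by blast
      have p2: "\<forall>k. kap \<le> k \<and> k < kap + d \<longrightarrow> W k x \<subseteq> U k" by (auto simp: U_def)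
      have p3: "kap + d < top \<longrightarrow> (\<forall>q\<in>W (kap + d) x. fst (\<gamma> q) = kap + d)" using k'(5) d by (auto simp: fresh_def)
      have p4: "\<forall>k. kap \<le> k \<and> k < kap + d \<and> Suc k < top \<longrightarrow> (\<forall>y\<in>S k (old g k) \<gamma>. \<forall>q\<in>{1..n}. q mod NN (Suc k) = Suc k \<longrightarrow>
         q \<le> y + NN (Suc k) \<longrightarrow> y \<le> q + NN (Suc k) \<longrightarrow> \<gamma> q = (Suc k, fst (g (Suc k))) \<or> \<gamma> q = (Suc k, prv g (Suc k)))"
      proof (intro allI impI ballI)
        fix k y q assume h: "kap \<le> k \<and> k < kap + d \<and> Suc k < top" "y \<in> S k (old g k) \<gamma>" "q \<in> {1..n}"
          "q mod NN (Suc k) = Suc k" "q \<le> y + NN (Suc k)" "y \<le> q + NN (Suc k)"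
        have "y \<in> {1..n}" "fst (\<gamma> y) = k" using h(2) by (auto simp: S_def)
        then show "\<gamma> q = (Suc k, fst (g (Suc k))) \<or> \<gamma> q = (Suc k, prv g (Suc k))"
          using inv(3)[unfolded incl_def, rule_format, of k y q] h by blast
      qed
      show ?case unfolding d_def[symmetric]
      proof (rule wp_bnd[OF wp_levels[OF okT_mono[OF okv c2(1)] T so Uok d(2) p1 p2 p3 p4]], goal_cases)
        case (1 C m2 z)
        note c3 = 1
        have z: "m2 \<le> (\<Sum>k\<in>{kap..<kap + d}. 160100 * 2 ^ k)"
          "\<And>k. snd z k = (if kap \<le> k \<and> k < kap + d then (fst (g k), snd (g k) + card (W k x - S k (fst (g k)) \<gamma>)) else g k)"
          using c3(2) by blast+
        from c3(2) obtain T2 \<gamma>2 where T2: "okT T G C (fst z) T2" "tree_ok G \<gamma>2 {1..n} T2" "state_ok U \<gamma>2"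
          "\<And>k. kap \<le> k \<Longrightarrow> k < kap + d \<Longrightarrow> level_rel x g \<gamma> \<gamma>2 k"
          "\<And>k j. k < top \<Longrightarrow> \<not> (kap \<le> k \<and> k < kap + d) \<Longrightarrow> S k j \<gamma>2 = S k j \<gamma>" by blast
        \<comment> \<open>Either the access stopped at \<open>kap\<close> because this window was
          fresh, or the window has just been filled.\<close>
        have Wk: "fst (\<gamma>2 s) = kap" if s: "s \<in> W kap x" "kap < top" for s
        proof -
          have "s \<in> S kap (fst (g kap)) \<gamma>2"
          proof (cases "d = 0")
            case True
            then have "\<gamma> s = (kap, fst (g kap))" using k'(5) d s by (simp add: fresh_def)
            then have "s \<in> S kap (fst (g kap)) \<gamma>" using s(1) W_sub[of kap x] unfolding S_def by blast
            then show ?thesis using T2(5)[of kap] True s by simp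
          next
            case False
            then show ?thesis using T2(4)[of kap] s by (simp add: level_rel_def)
          qed
          then show ?thesis by (simp add: S_def)
        qed
        have nr: "near kap x \<gamma>2" unfolding near_def
        proof (intro impI ballI)
          fix s assume h: "kap < top" "s \<in> {1..n}" "s mod NN kap = kap" "s \<le> x + NN kap" "x \<le> s + NN kap"
          then have "s \<in> W kap x" by (simp add: W_def)
          then show "fst (\<gamma>2 s) = kap" using Wk h(1) by blast
        qed
        have lay2: "lay_ok \<gamma>2" unfolding lay_ok_def
        proof
          fix y assume y: "y \<in> {1..n}"
          define k where "k = fst (\<gamma>2 y)"
          define j where "j = snd (\<gamma>2 y)"
          show "\<gamma>2 y = (top, 3) \<or> kap \<le> fst (\<gamma>2 y) \<and> fst (\<gamma>2 y) < top \<and> snd (\<gamma>2 y) < 3 \<and> y mod NN (fst (\<gamma>2 y)) = fst (\<gamma>2 y)"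
          proof (cases "\<gamma>2 y = (top, 3)")
            case False
            then have k: "kap \<le> k" "k < top" "y \<in> U k" using T2(3) y False unfolding state_ok_def k_def by auto
            have "y mod NN k = k" using Uok k unfolding U_ok_def by blast
            moreover have "j < 3"
            proof -
              have yS: "y \<in> S k j \<gamma>2" using y by (simp add: S_def k_def j_def)
              have "j = fst (g k) \<or> y \<in> S k j \<gamma>"
                using yS T2(4)[of k] T2(5)[of k j] k unfolding level_rel_def by blast
              then show ?thesis
              proof
                assume "j = fst (g k)" then show ?thesis using p1 k by simp
              next
                assume "y \<in> S k j \<gamma>"
                then have "\<gamma> y = (k, j)" by (simp add: S_def)
                then show ?thesis using inv(1) y k(2) unfolding lay_ok_def by (metis fst_conv snd_conv less_irrefl)
              qed
            qed
            ultimately show ?thesis using k by (simp add: k_def j_def)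
          qed simp
        qed
        have gz: "snd z \<in> G"
        proof -
          have *: "snd (g k) + card (W k x - S k (fst (g k)) \<gamma>) \<le> NN k + 4" if "kap \<le> k" "k < top" for k
          proof -
            have "card (W k x - S k (fst (g k)) \<gamma>) \<le> 5"
              by (rule order_trans[OF card_mono card_W]) auto
            moreover have "snd (g k) < NN k" using r that by blast
            ultimately show ?thesis by linarith
          qed
          show ?thesis unfolding G_def mem_Collect_eq
          proof
            fix k
            have "if kap \<le> k \<and> k < top then fst (g k) < 3 \<and> snd (g k) \<le> NN k + 4 else g k = (0, 0)"
              using inv(4) unfolding G_def by blast
            then show "if kap \<le> k \<and> k < top then fst (snd z k) < 3 \<and> snd (snd z k) \<le> NN k + 4 else snd z k = (0, 0)"
              using z(2)[of k] d(2) * by (cases "kap \<le> k \<and> k < top") auto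
          qed
        qed
        show ?case
        proof (rule wp_bnd[OF wp_srch[OF T2(1)]], goal_cases)
          case 1 show ?case using T2(2) by (simp add: tree_ok_def)
        next
          case (2 D m3 rr)
          have g0: "ge 0 T2" by (cases T2) auto
          have m3: "m3 \<le> 1 + 22 * 2 ^ kap"
          proof -
            have "m3 \<le> 1 + lh 0 T2 + path_height x 0 T2" using 2(2) g0 unfolding srch_post_def by blast
            then show ?thesis using near_path_height[OF T2(2) order_refl _ T2(3) Uok order_refl nr x] by simp
          qed
          have "(x, \<gamma>2 x) \<in> set (ks T2)" using tree_ok_mem[OF T2(2)] x by blast
          moreover have "size T2 \<le> n + 1" using tree_ok_size[OF T2(2)] by simp
          ultimately have "rr = Some (\<gamma>2 x)" using 2(2) unfolding srch_post_def by blast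
          then have vx: "x \<in> vis T D" using 2(2) by blast
          have "T2 \<noteq> Leaf" using tree_ok_size[OF T2(2)] n1 by auto
          then obtain L a R where T2N: "T2 = Node L a R" by (cases T2) auto
          show ?case
          proof (rule wp_bnd[OF wp_opn1[OF okT_rep[OF T2(1) 2(1)]]], goal_cases)
            case (1 D' m4 w)
            obtain l rr where w: "w = VN l a rr" "rep T D' l L" "rep T D' rr R" "ky a \<in> vis T D'"
              using 1(2) unfolding T2N rep1_Node by blast
            define T3 where "T3 = Node L (ND (ky a) (st a) (ht a) (sm a) (snd z)) R"
            have "ks T3 = ks T2" by (simp add: T3_def T2N)
            then have T3: "tree_ok G \<gamma>2 {1..n} T3" using T2(2) gz unfolding tree_ok_def bst'_def by (simp add: T3_def T2N)
            have re: "rep T D' (VN l (ND (ky a) (st a) (ht a) (sm a) (snd z)) rr) T3" using w by (simp add: rep_VN T3_def)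
            have vx': "x \<in> vis T D'" using vis_monoD[OF vx 1(1)] .
            have ac: "acc x \<gamma> g \<gamma>2 (snd z) k'"
              unfolding acc_def
            proof (intro conjI allI impI)
              show "kap \<le> k'" "k' \<le> max kap top" "lay_ok \<gamma>2" using k' lay2 by blast+
              show "fresh \<gamma> g x k'" if "k' < top" using k'(5) that .
            next
              fix k assume k: "kap \<le> k \<and> k < k'"
              then show "\<not> fresh \<gamma> g x k" "level_rel x g \<gamma> \<gamma>2 k" using k'(4) T2(4) d(1) by auto
              show "snd z k = (fst (g k), snd (g k) + card (W k x - S k (fst (g k)) \<gamma>))" using z(2)[of k] k d(1) by simp
            next
              fix k assume k: "\<not> (kap \<le> k \<and> k < k')"
              show "snd z k = g k" using z(2)[of k] k d(1) by simp
              show "S k j \<gamma>2 = S k j \<gamma>" if "k < top" for j using T2(5)[of k j] k d(1) that by simp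
            qed
            have "m + (m1 + (m2 + (m3 + m4))) \<le> 170000 * 2 ^ k'"
            proof -
              have "m1 \<le> 30 * (\<Sum>j\<in>{kap..<Suc k'}. 2 ^ j)" using k'(3) by (simp only: sum_distrib_left)
              then have "m1 \<le> 30 * 2 ^ Suc k'" using sum_pow2[of kap "Suc k'"] by (meson le_trans mult_le_mono2)
              then have "m1 \<le> 60 * 2 ^ k'" by simp
              moreover have "m2 \<le> 160100 * (\<Sum>j\<in>{kap..<k'}. 2 ^ j)" using z(1) d(1) by (simp only: sum_distrib_left)
              then have "m2 \<le> 160100 * 2 ^ k'" using sum_pow2[of kap k'] by (meson le_trans mult_le_mono2)
              moreover have "(2::nat) ^ kap \<le> 2 ^ k'" using k'(1) by (intro power_increasing) auto
              moreover have "(1::nat) \<le> 2 ^ k'" by simp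
              moreover have "m \<le> 1" "m4 \<le> 1" using c1(2) 1(2) by blast+
              ultimately show ?thesis using m3 by linarith
            qed
            then show ?case unfolding wp_Ret add_0_right w(1) vt.case
              by (intro exI[of _ k'] exI[of _ \<gamma>2] exI[of _ "snd z"] exI[of _ T3] conjI re vx' T3 gz ac) (simp_all add: T3_def)
          qed
        qed
      qed
    qed
  qed
qed

end

section \<open>Invariants of the separator caches\<close>

context sep
begin

definition Inv :: "(nat \<Rightarrow> nat \<times> nat) \<Rightarrow> (nat \<Rightarrow> nat \<times> nat) \<Rightarrow> bool" where
  "Inv \<gamma> g \<longleftrightarrow> lay_ok \<gamma> \<and> cnt_ok \<gamma> g \<and> incl \<gamma> g \<and> g \<in> G"

lemma cnt_okD:
  assumes "cnt_ok \<gamma> g" "kap \<le> k" "k < top"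
  shows "fst (g k) < 3" "snd (g k) \<le> NN k + 4" "card (S k (fst (g k)) \<gamma>) = snd (g k)"
     "card (S k (prv g k) \<gamma>) \<le> NN k + 4" "card (S k (old g k) \<gamma>) \<le> NN k + 4 - 2 * snd (g k)"
  using assms unfolding cnt_ok_def by blast+

lemma flip_simps:
  assumes "kap \<le> k" "k < top" "NN k \<le> snd (g k)" "fst (g k) < 3"
  shows "fst (flip g k) = old g k" "snd (flip g k) = 0" "prv (flip g) k = fst (g k)" "old (flip g) k = prv g k"
proof -
  have "fst (g k) = 0 \<or> fst (g k) = 1 \<or> fst (g k) = 2" using assms(4) by linarith
  then show "fst (flip g k) = old g k" "snd (flip g k) = 0" "prv (flip g) k = fst (g k)" "old (flip g) k = prv g k"
    using assms by (auto simp: flip_def old_def prv_def)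
qed

lemma noflip_simps:
  assumes "\<not> (kap \<le> k \<and> k < top \<and> NN k \<le> snd (g k))"
  shows "flip g k = g k" "prv (flip g) k = prv g k" "old (flip g) k = old g k"
  using assms by (auto simp: flip_def old_def prv_def)

lemma snd_flip: "kap \<le> k \<Longrightarrow> k < top \<Longrightarrow> snd (flip g k) < NN k"
  using NN_ge2[of k] by (auto simp: flip_def)

text \<open>An age amounts to at most three phases of \<open>NN k + 4\<close> insertions, while
  \<open>NN (Suc k)\<close> is at least \<open>65536 * NN k\<close>. So a layer whose counter
  \<open>incl\<close> ties to such an age cannot be at the end of a phase.\<close>

lemma age_le:
  assumes "cnt_ok \<gamma> g" "kap \<le> k" "k < top"
  shows "5 * age \<gamma> g k s < NN (Suc k)"
proof -
  have "age \<gamma> g k s \<le> 3 * (NN k + 4)" using cnt_okD(2)[OF assms] by (auto simp: age_def)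
  moreover have "65536 * NN k \<le> NN (Suc k)" unfolding NN_Suc using NN_big[OF assms(2)] by (rule mult_le_mono1)
  ultimately show ?thesis using NN_big[OF assms(2)] unfolding distrib_left by linarith
qed

lemma lay_okD: "lay_ok \<gamma> \<Longrightarrow> y \<in> {1..n} \<Longrightarrow> fst (\<gamma> y) = k \<Longrightarrow> k < top \<Longrightarrow> kap \<le> k \<and> snd (\<gamma> y) < 3"
  unfolding lay_ok_def by (metis fst_conv less_irrefl)

lemma class_cases:
  assumes "lay_ok \<gamma>" "cnt_ok \<gamma> g" "y \<in> {1..n}" "fst (\<gamma> y) = k" "kap \<le> k" "k < top"
  obtains "snd (\<gamma> y) = fst (g k)" | "snd (\<gamma> y) = prv g k" | "snd (\<gamma> y) = old g k"
proof -
  have "snd (\<gamma> y) \<in> {0, 1, 2}" using lay_okD[OF assms(1,3,4,6)] by auto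
  then show thesis using classes(4)[of g k] cnt_okD(1)[OF assms(2,5,6)] that by auto
qed

lemma old_empty:
  assumes "cnt_ok \<gamma> g" "kap \<le> k" "k < top" "NN k \<le> snd (g k)"
  shows "S k (old g k) \<gamma> = {}"
proof -
  have "card (S k (old g k) \<gamma>) = 0" using cnt_okD(5)[OF assms(1-3)] assms(4) NN_big[OF assms(2)] by linarith
  then show ?thesis by simp
qed

text \<open>A flip resets the counter but moves the class back by one, and the added
  \<open>NN k + 4\<close> is at least the lost counter. There are no items of the oldest class at
  that moment.\<close>

lemma age_flip:
  assumes "lay_ok \<gamma>" "cnt_ok \<gamma> g" "s \<in> {1..n}" "fst (\<gamma> s) = k" "kap \<le> k" "k < top"
  shows "age \<gamma> g k s \<le> age \<gamma> (flip g) k s"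
proof (cases "NN k \<le> snd (g k)")
  case False
  then show ?thesis using noflip_simps[of k g] by (simp add: age_def)
next
  case True
  note f = flip_simps[of k g, OF assms(5,6) True cnt_okD(1)[OF assms(2,5,6)]]
  note c = classes(1-3)[of g k, OF cnt_okD(1)[OF assms(2,5,6)]] cnt_okD(2)[OF assms(2,5,6)]
  show ?thesis
  proof (rule class_cases[OF assms])
    assume "snd (\<gamma> s) = old g k"
    then have "s \<in> S k (old g k) \<gamma>" using assms(3,4) by (simp add: S_def prod_eq_iff)
    then show ?thesis using old_empty[OF assms(2,5,6) True] by simp
  qed (use f c in \<open>auto simp: age_def\<close>)
qed

text \<open>The danger is that a required neighbour of the previous class in layer
  \<open>k + 1\<close> becomes oldest. Its clause in \<open>incl\<close> together with
  \<open>age_le\<close> keeps that counter below \<open>NN (Suc k)\<close>, so this layer does not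
  flip.\<close>

lemma Inv_flip:
  assumes "Inv \<gamma> g" shows "Inv \<gamma> (flip g)"
proof -
  have i: "lay_ok \<gamma>" "cnt_ok \<gamma> g" "incl \<gamma> g" "g \<in> G" using assms by (auto simp: Inv_def)
  have "cnt_ok \<gamma> (flip g)" unfolding cnt_ok_def
  proof (intro allI impI)
    fix k assume k: "kap \<le> k \<and> k < top"
    note c = cnt_okD[OF i(2), of k]
    show "fst (flip g k) < 3 \<and> snd (flip g k) \<le> NN k + 4 \<and> card (S k (fst (flip g k)) \<gamma>) = snd (flip g k) \<and>
     card (S k (prv (flip g) k) \<gamma>) \<le> NN k + 4 \<and> card (S k (old (flip g) k) \<gamma>) \<le> NN k + 4 - 2 * snd (flip g k)"
    proof (cases "NN k \<le> snd (g k)")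
      case True
      note f = flip_simps[of k g, OF _ _ True]
      show ?thesis using f c k old_empty[OF i(2) _ _ True] by (simp add: old_def)
    next
      case False
      then show ?thesis using noflip_simps[of k g] c k by simp
    qed
  qed
  moreover have "flip g \<in> G" using i(4) unfolding G_def flip_def by (auto split: if_splits)
  moreover have "incl \<gamma> (flip g)" unfolding incl_def
  proof (intro allI impI)
    fix k s q assume h: "kap \<le> k" "Suc k < top" "s \<in> {1..n}" "fst (\<gamma> s) = k" "q \<in> {1..n}"
      "q mod NN (Suc k) = Suc k" "q \<le> s + NN (Suc k)" "s \<le> q + NN (Suc k)"
    have kk: "kap \<le> k" "k < top" "kap \<le> Suc k" using h by auto
    have "\<gamma> q = (Suc k, fst (g (Suc k))) \<or> \<gamma> q = (Suc k, prv g (Suc k)) \<and> snd (g (Suc k)) \<le> 5 * age \<gamma> g k s"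
      using i(3)[unfolded incl_def, rule_format, OF h] .
    then show "\<gamma> q = (Suc k, fst (flip g (Suc k))) \<or> \<gamma> q = (Suc k, prv (flip g) (Suc k)) \<and> snd (flip g (Suc k)) \<le> 5 * age \<gamma> (flip g) k s"
    proof (elim disjE conjE)
      assume q: "\<gamma> q = (Suc k, fst (g (Suc k)))"
      show ?thesis
      proof (cases "NN (Suc k) \<le> snd (g (Suc k))")
        case True
        then show ?thesis using q flip_simps[of "Suc k" g, OF kk(3) h(2) True cnt_okD(1)[OF i(2) kk(3) h(2)]] by simp
      next
        case False
        then show ?thesis using q noflip_simps[of "Suc k" g] by simp
      qed
    next
      assume q: "\<gamma> q = (Suc k, prv g (Suc k))" "snd (g (Suc k)) \<le> 5 * age \<gamma> g k s"
      then have "\<not> NN (Suc k) \<le> snd (g (Suc k))" using age_le[OF i(2) kk(1,2), of s] by simp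
      then show ?thesis using q noflip_simps[of "Suc k" g] age_flip[OF i(1,2) h(3,4) kk(1,2)] by auto
    qed
  qed
  ultimately show ?thesis using i by (simp add: Inv_def)
qed

text \<open>For \<open>incl\<close> there are three cases: the neighbours of a refreshed item are in
  the window of the next layer; an item of a touched layer outside the window ages by at least one;
  and if layer \<open>k\<close> is untouched, so is layer \<open>k + 1\<close>.\<close>

lemma Inv_acc:
  assumes "Inv \<gamma> g" "\<forall>k. kap \<le> k \<and> k < top \<longrightarrow> snd (g k) < NN k" "acc x \<gamma> g \<gamma>' g' k'" "g' \<in> G"
  shows "Inv \<gamma>' g'"
proof -
  have i: "lay_ok \<gamma>" "cnt_ok \<gamma> g" "incl \<gamma> g" "g \<in> G" using assms by (auto simp: Inv_def)
  have k': "kap \<le> k'" "k' \<le> max kap top" "lay_ok \<gamma>'" "k' < top \<Longrightarrow> fresh \<gamma> g x k'"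
    using assms(3) unfolding acc_def by blast+
  have af: "\<not> fresh \<gamma> g x k" "level_rel x g \<gamma> \<gamma>' k" "g' k = (fst (g k), snd (g k) + card (W k x - S k (fst (g k)) \<gamma>))"
    if "kap \<le> k" "k < k'" for k using assms(3) that unfolding acc_def by blast+
  have un: "g' k = g k" "k < top \<Longrightarrow> S k j \<gamma>' = S k j \<gamma>" if "\<not> (kap \<le> k \<and> k < k')" for k j
    using assms(3) that unfolding acc_def by blast+
  have fg: "fst (g' k) = fst (g k)" "prv g' k = prv g k" "old g' k = old g k" for k
    using af(3)[of k] un(1)[of k] by (cases "kap \<le> k \<and> k < k'"; simp add: prv_def old_def)+
  have m: "card (W k x - S k j \<gamma>) \<le> 5" for k j
    by (rule order_trans[OF card_mono card_W]) auto
  have m1: "1 \<le> card (W k x - S k (fst (g k)) \<gamma>)" if kk: "kap \<le> k" "k < k'" for k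
  proof -
    obtain s where "s \<in> W k x" "\<gamma> s \<noteq> (k, fst (g k))" using af(1)[OF kk] by (auto simp: fresh_def)
    then have "s \<in> W k x - S k (fst (g k)) \<gamma>" by (auto simp: S_def)
    moreover have "finite (W k x - S k (fst (g k)) \<gamma>)" by simp
    ultimately have "0 < card (W k x - S k (fst (g k)) \<gamma>)" by (subst card_gt_0_iff) blast
    then show ?thesis by linarith
  qed
  have "cnt_ok \<gamma>' g'" unfolding cnt_ok_def
  proof (intro allI impI)
    fix k assume "kap \<le> k \<and> k < top"
    then have k: "kap \<le> k" "k < top" by auto
    note c = cnt_okD[OF i(2) k]
    show "fst (g' k) < 3 \<and> snd (g' k) \<le> NN k + 4 \<and> card (S k (fst (g' k)) \<gamma>') = snd (g' k) \<and>
     card (S k (prv g' k) \<gamma>') \<le> NN k + 4 \<and> card (S k (old g' k) \<gamma>') \<le> NN k + 4 - 2 * snd (g' k)"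
    proof (cases "k < k'")
      case True
      define mm where "mm = card (W k x - S k (fst (g k)) \<gamma>)"
      have lr: "S k (fst (g k)) \<gamma>' = S k (fst (g k)) \<gamma> \<union> W k x" "S k (prv g k) \<gamma>' = S k (prv g k) \<gamma> - W k x"
         "card (S k (old g k) \<gamma>') \<le> card (S k (old g k) \<gamma>) - 10"
        using af(2)[OF k(1) True] unfolding level_rel_def by blast+
      have s: "snd (g' k) = snd (g k) + mm" using af(3)[OF k(1) True] by (simp add: mm_def)
      have "S k (fst (g k)) \<gamma> \<union> W k x = S k (fst (g k)) \<gamma> \<union> (W k x - S k (fst (g k)) \<gamma>)" by blast
      then have 1: "card (S k (fst (g k)) \<gamma>') = snd (g k) + mm"
        unfolding lr(1) using card_Un_disjoint[of "S k (fst (g k)) \<gamma>" "W k x - S k (fst (g k)) \<gamma>"] c(3) by (auto simp: mm_def)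
      have 2: "card (S k (prv g k) \<gamma>') \<le> NN k + 4" unfolding lr(2) by (rule order_trans[OF card_mono c(4)]) auto
      have "mm \<le> 5" using m by (simp add: mm_def)
      moreover have "snd (g k) < NN k" using assms(2) k by blast
      ultimately have "snd (g k) + mm \<le> NN k + 4" by linarith
      moreover have "card (S k (old g k) \<gamma>') \<le> NN k + 4 - 2 * (snd (g k) + mm)"
      proof -
        have "card (S k (old g k) \<gamma>') \<le> NN k + 4 - 2 * snd (g k) - 10" using lr(3) diff_le_mono[OF c(5), of 10] by linarith
        also have "\<dots> \<le> NN k + 4 - 2 * snd (g k) - 2 * mm" using \<open>mm \<le> 5\<close> by (intro diff_le_mono2) simp
        finally show ?thesis by simp
      qed
      ultimately have "snd (g k) + mm \<le> NN k + 4" "card (S k (old g k) \<gamma>') \<le> NN k + 4 - 2 * (snd (g k) + mm)" by blast+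
      then show ?thesis using 1 2 c(1) unfolding fg s by blast
    next
      case False
      then show ?thesis using un[of k] k c unfolding fg by simp
    qed
  qed
  moreover have "incl \<gamma>' g'" unfolding incl_def fg
  proof (intro allI impI)
    fix k s q assume h: "kap \<le> k" "Suc k < top" "s \<in> {1..n}" "fst (\<gamma>' s) = k" "q \<in> {1..n}"
      "q mod NN (Suc k) = Suc k" "q \<le> s + NN (Suc k)" "s \<le> q + NN (Suc k)"
    define j where "j = snd (\<gamma>' s)"
    have sj: "s \<in> S k j \<gamma>'" using h by (simp add: S_def j_def prod_eq_iff)
    have tr: "fst (\<gamma> s) = k \<and> snd (\<gamma> s) = j" if "s \<in> S k j \<gamma>" using that by (simp add: S_def)
    have old: "\<gamma> q = (Suc k, fst (g (Suc k))) \<or> \<gamma> q = (Suc k, prv g (Suc k)) \<and> snd (g (Suc k)) \<le> 5 * age \<gamma> g k s"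
      if "s \<in> S k j \<gamma>"
      using i(3)[unfolded incl_def, rule_format, OF h(1-3) _ h(5-8)] tr[OF that] by blast
    have un1: "\<gamma>' q = (Suc k, c)" if "\<gamma> q = (Suc k, c)" "\<not> Suc k < k'" for c
    proof -
      have "q \<in> S (Suc k) c \<gamma>" using that h(5) by (simp add: S_def)
      then have "q \<in> S (Suc k) c \<gamma>'" using un(2)[of "Suc k" c] that(2) h(2) by simp
      then show ?thesis by (simp add: S_def)
    qed
    show "\<gamma>' q = (Suc k, fst (g (Suc k))) \<or> \<gamma>' q = (Suc k, prv g (Suc k)) \<and> snd (g' (Suc k)) \<le> 5 * age \<gamma>' g' k s"
    proof (cases "k < k'")
      case True
      note lr = af(2)[OF h(1) True, unfolded level_rel_def]
      show ?thesis
      proof (cases "s \<in> W k x")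
        case w: True
        have qW: "q \<in> W (Suc k) x" using W_near[OF w h(5-8)] .
        show ?thesis
        proof (cases "Suc k < k'")
          case t: True
          have "q \<in> S (Suc k) (fst (g (Suc k))) \<gamma>'" using af(2)[of "Suc k"] h(1) t qW unfolding level_rel_def by auto
          then show ?thesis by (simp add: S_def)
        next
          case False
          then have "Suc k = k'" using True by simp
          then have "\<gamma> q = (Suc k, fst (g (Suc k)))" using k'(4) h(2) qW by (simp add: fresh_def)
          then show ?thesis using un1 False by blast
        qed
      next
        case nw: False
        have sS: "s \<in> S k j \<gamma>" using sj lr nw by (cases "j = fst (g k)") auto
        \<comment> \<open>Layer \<open>k\<close> was not fresh, so its counter grew; five times this
          growth pays for the at most five insertions into layer \<open>k + 1\<close>.\<close>
        have ag: "age \<gamma>' g' k s \<ge> age \<gamma> g k s + 1"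
          using tr[OF sS] af(3)[OF h(1) True] m1[OF h(1) True] j_def unfolding age_def fg by simp
        show ?thesis
        proof (cases "Suc k < k'")
          case t: True
          note lr' = af(2)[of "Suc k", unfolded level_rel_def]
          have k1: "kap \<le> Suc k" using h(1) by simp
          show ?thesis
          proof (cases "q \<in> W (Suc k) x \<or> \<gamma> q = (Suc k, fst (g (Suc k)))")
            case True
            then have "q \<in> S (Suc k) (fst (g (Suc k))) \<gamma>'" using lr' k1 t h(5) by (auto simp: S_def)
            then show ?thesis by (simp add: S_def)
          next
            case False
            then have q: "\<gamma> q = (Suc k, prv g (Suc k))" "snd (g (Suc k)) \<le> 5 * age \<gamma> g k s" using old[OF sS] by auto
            then have "q \<in> S (Suc k) (prv g (Suc k)) \<gamma>'" using lr' k1 t h(5) False by (auto simp: S_def)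
            then have "\<gamma>' q = (Suc k, prv g (Suc k))" by (simp add: S_def)
            moreover have "snd (g' (Suc k)) \<le> snd (g (Suc k)) + 5" using af(3)[OF k1 t] m by simp
            ultimately show ?thesis using q(2) ag by linarith
          qed
        next
          case False
          have "g' (Suc k) = g (Suc k)" using un(1)[of "Suc k"] False by simp
          then show ?thesis using old[OF sS] un1[OF _ False] ag by (metis (no_types, lifting) add_leD1 le_trans mult_le_mono2)
        qed
      qed
    next
      case False
      have sS: "s \<in> S k j \<gamma>" using sj un(2)[of k j] False h(2) by simp
      have "age \<gamma>' g' k s = age \<gamma> g k s" using tr[OF sS] un(1)[of k] False j_def unfolding age_def fg by simp
      moreover have "g' (Suc k) = g (Suc k)" "\<not> Suc k < k'" using un(1)[of "Suc k"] False by simp_all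
      ultimately show ?thesis using old[OF sS] un1 by auto
    qed
  qed
  ultimately show ?thesis using k' assms(4) by (simp add: Inv_def)
qed

end

section \<open>Amortised analysis\<close>

locale accs = sep +
  fixes xs :: "nat \<Rightarrow> nat"
  assumes xs: "xs i \<in> {1..n}"
begin

definition expensive :: "nat \<Rightarrow> nat \<Rightarrow> bool" where
  "expensive k j \<longleftrightarrow> (\<forall>y\<in>{1..n}. real (NN (k - 1)) < real (wset n xs j y) + \<bar>real (xs j) - real y\<bar>)"

text \<open>Integers prevent truncation at the left end, so all windows have equal size. Radius
  \<open>3 * NN k\<close> leaves room for a block of length \<open>NN k\<close> starting at any
  separator within \<open>2 * NN k\<close> of the access.\<close>

definition window :: "nat \<Rightarrow> nat \<Rightarrow> int set" where
  "window N y = {int y - 3 * int N..int y + 3 * int N}"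

lemma card_window: "card (window N y) = 6 * N + 1" and finite_window [simp]: "finite (window N y)"
  by (simp_all add: window_def)

definition recent :: "nat \<Rightarrow> nat \<Rightarrow> nat set" where
  "recent M t = {y. \<exists>p<t. xs p = y \<and> (\<forall>j. p < j \<and> j < t \<longrightarrow> xs j \<noteq> y) \<and> card (xs ` {p<..<t}) \<le> M}"

lemma finite_recent [simp]: "finite (recent M t)"
  by (rule finite_subset[of _ "xs ` {..<t}"]) (auto simp: recent_def)

text \<open>Let \<open>y0\<close> be the recent key with the earliest last access. All other recent
  keys occur after that access, among at most \<open>M\<close> distinct keys.\<close>

lemma card_recent: "card (recent M t) \<le> (if t = 0 then 0 else M + 1)"
proof (cases "recent M t = {}")
  case False
  define lst where "lst y = (SOME p. p < t \<and> xs p = y \<and> (\<forall>j. p < j \<and> j < t \<longrightarrow> xs j \<noteq> y) \<and> card (xs ` {p<..<t}) \<le> M)" for y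
  have l: "lst y < t \<and> xs (lst y) = y \<and> (\<forall>j. lst y < j \<and> j < t \<longrightarrow> xs j \<noteq> y) \<and> card (xs ` {lst y<..<t}) \<le> M" if "y \<in> recent M t" for y
    using that unfolding recent_def lst_def mem_Collect_eq by (rule someI_ex)
  obtain y0 where y0: "y0 \<in> recent M t" "\<And>y. y \<in> recent M t \<Longrightarrow> lst y0 \<le> lst y"
    using ex_min_if_finite[of "lst ` recent M t"] False by (auto simp: not_less)
  have "recent M t - {y0} \<subseteq> xs ` {lst y0<..<t}"
  proof
    fix y assume y: "y \<in> recent M t - {y0}"
    then have "lst y0 \<noteq> lst y" using l[of y] l[of y0] y0(1) by auto
    then have "lst y0 < lst y" using y0(2)[of y] y by auto
    then show "y \<in> xs ` {lst y0<..<t}" using l[of y] y by force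
  qed
  then have "card (recent M t - {y0}) \<le> card (xs ` {lst y0<..<t})" by (intro card_mono) auto
  then have "card (recent M t - {y0}) \<le> M" using l[OF y0(1)] by linarith
  moreover have "t \<noteq> 0" using l[OF y0(1)] by auto
  ultimately show ?thesis using y0(1) by (simp add: card_Diff_singleton)
qed auto

text \<open>The default working-set number \<open>n\<close> exceeds \<open>NN (k - 1)\<close>, so
  the witness \<open>y\<close> has been accessed before; \<open>p\<close> is its last
  access.\<close>

lemma cheap_source:
  assumes "\<not> expensive k i" "1 \<le> k" "k < top" "1 \<le> k - 1"
  obtains p where "p < i" "xs i \<le> xs p + NN (k - 1)" "xs p \<le> xs i + NN (k - 1)"
    "\<forall>j. p < j \<and> j < i \<longrightarrow> xs j \<noteq> xs p" "card (xs ` {p<..<i}) \<le> NN (k - 1)"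
proof -
  obtain y where y: "y \<in> {1..n}" "real (wset n xs i y) + \<bar>real (xs i) - real y\<bar> \<le> real (NN (k - 1))"
    using assms(1) by (auto simp: expensive_def not_less)
  then have w: "wset n xs i y \<le> NN (k - 1)" and d: "xs i \<le> y + NN (k - 1)" "y \<le> xs i + NN (k - 1)" by linarith+
  have "NN (k - 1) < n" using NN_less_n[of "k - 1"] assms by simp
  then have expensive_count: "\<exists>j<i. xs j = y" using w by (auto simp: wset_def split: if_splits)
  define p where "p = (GREATEST j. j < i \<and> xs j = y)"
  have p: "p < i \<and> xs p = y"
    unfolding p_def by (rule GreatestI_ex_nat[of _ i]) (use expensive_count in auto)
  have "j \<le> p" if "j < i" "xs j = y" for j
    unfolding p_def by (rule Greatest_le_nat[of _ _ i]) (use that in auto)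
  then have "\<forall>j. p < j \<and> j < i \<longrightarrow> xs j \<noteq> xs p" using p by force
  moreover have "card (xs ` {p<..<i}) \<le> NN (k - 1)" using w expensive_count by (simp add: wset_def p_def)
  ultimately show thesis using that[of p] p d by simp
qed

text \<open>Counts the separators handled in a phase that began at time \<open>t\<close>. The windows of keys that were recently accessed at
  time \<open>t\<close> are included from the start, so that only expensive accesses contribute a whole window.\<close>
definition area :: "nat \<Rightarrow> nat \<Rightarrow> nat \<Rightarrow> int set" where
  "area k t i = (\<Union>y\<in>recent (NN (k - 1)) t. window (NN k) y) \<union> (\<Union>j\<in>{t..<i}. window (NN k) (xs j))"

lemma card_area:
  assumes "2 \<le> k" "k < top" "t \<le> i"
  shows "card (area k t i) \<le> (card {j \<in> {t..<i}. expensive k j} + card (recent (NN (k - 1)) t)) * (6 * NN k + 1) + (i - t) * NN (k - 1)"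
  using assms(3)
proof (induction i rule: dec_induct)
  case base
  have "card (area k t t) \<le> (\<Sum>y\<in>recent (NN (k - 1)) t. card (window (NN k) y))"
    unfolding area_def by (simp add: card_UN_le)
  then show ?case by (simp add: card_window)
next
  case (step i)
  have k1: "1 \<le> k" "1 \<le> k - 1" using assms(1) by auto
  define e where "e = card {j \<in> {t..<i}. expensive k j}"
  define R where "R = card (recent (NN (k - 1)) t)"
  define d where "d = i - t"
  have IH: "card (area k t i) \<le> (e + R) * (6 * NN k + 1) + d * NN (k - 1)" using step(3) by (simp add: e_def R_def d_def)
  have Sd: "Suc i - t = Suc d" using step(1) by (simp add: d_def Suc_diff_le)
  have fin: "finite (area k t i)" by (simp add: area_def)
  have A: "area k t (Suc i) = area k t i \<union> (window (NN k) (xs i) - area k t i)"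
    using step(1) by (auto simp: area_def atLeastLessThanSuc)
  have cA: "card (area k t (Suc i)) \<le> card (area k t i) + card (window (NN k) (xs i) - area k t i)"
    unfolding A by (rule card_Un_le)
  have E: "{j \<in> {t..<Suc i}. expensive k j} = (if expensive k i then insert i {j \<in> {t..<i}. expensive k j} else {j \<in> {t..<i}. expensive k j})"
    using step(1) by (auto simp: less_Suc_eq)
  show ?case
  proof (cases "expensive k i")
    case True
    have "card (window (NN k) (xs i) - area k t i) \<le> 6 * NN k + 1"
      using card_mono[of "window (NN k) (xs i)" "window (NN k) (xs i) - area k t i"] by (simp add: card_window)
    then have "card (area k t (Suc i)) \<le> (e + R) * (6 * NN k + 1) + d * NN (k - 1) + (6 * NN k + 1)"
      using cA IH by linarith
    also have "\<dots> \<le> (Suc e + R) * (6 * NN k + 1) + Suc d * NN (k - 1)" by simp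
    finally show ?thesis unfolding Sd using True E by (simp add: R_def e_def)
  next
    case False
    obtain p where p: "p < i" "xs i \<le> xs p + NN (k - 1)" "xs p \<le> xs i + NN (k - 1)"
      "\<forall>j. p < j \<and> j < i \<longrightarrow> xs j \<noteq> xs p" "card (xs ` {p<..<i}) \<le> NN (k - 1)"
      using cheap_source[OF False k1(1) assms(2) k1(2)] by blast
    \<comment> \<open>Either \<open>p\<close> falls into this phase or its key was recent at time
      \<open>t\<close>. Hence only a strip as wide as the distance of \<open>xs i\<close> and
      \<open>xs p\<close> is new.\<close>
    have "window (NN k) (xs p) \<subseteq> area k t i"
    proof (cases "t \<le> p")
      case True
      then show ?thesis using p(1) by (auto simp: area_def)
    next
      case False
      have "card (xs ` {p<..<t}) \<le> card (xs ` {p<..<i})" using step(1) by (intro card_mono image_mono) auto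
      then have "xs p \<in> recent (NN (k - 1)) t"
        unfolding recent_def using False p(4,5) step(1) by (auto intro!: exI[of _ p])
      then show ?thesis by (auto simp: area_def)
    qed
    then have "card (window (NN k) (xs i) - area k t i) \<le> card (window (NN k) (xs i) - window (NN k) (xs p))"
      by (intro card_mono) auto
    also have "\<dots> \<le> NN (k - 1)"
    proof (cases "xs p \<le> xs i")
      case True
      have "window (NN k) (xs i) - window (NN k) (xs p) \<subseteq> {int (xs p) + 3 * int (NN k)<..int (xs i) + 3 * int (NN k)}"
        using True by (auto simp: window_def)
      then have "card (window (NN k) (xs i) - window (NN k) (xs p)) \<le> card {int (xs p) + 3 * int (NN k)<..int (xs i) + 3 * int (NN k)}"
        by (intro card_mono) auto
      then show ?thesis using p(2) by simp
    next
      case False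
      have "window (NN k) (xs i) - window (NN k) (xs p) \<subseteq> {int (xs i) - 3 * int (NN k)..<int (xs p) - 3 * int (NN k)}"
        using False by (auto simp: window_def)
      then have "card (window (NN k) (xs i) - window (NN k) (xs p)) \<le> card {int (xs i) - 3 * int (NN k)..<int (xs p) - 3 * int (NN k)}"
        by (intro card_mono) auto
      then show ?thesis using p(3) by simp
    qed
    finally have "card (area k t (Suc i)) \<le> (e + R) * (6 * NN k + 1) + d * NN (k - 1) + NN (k - 1)"
      using cA IH by linarith
    also have "\<dots> \<le> (e + R) * (6 * NN k + 1) + Suc d * NN (k - 1)" by simp
    finally show ?thesis unfolding Sd using False E by (simp add: R_def e_def)
  qed
qed

section \<open>Insertions per phase\<close>

definition cover :: "nat \<Rightarrow> nat \<Rightarrow> nat \<Rightarrow> nat set \<Rightarrow> bool" where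
  "cover k t i F \<longleftrightarrow> finite F \<and> (\<forall>s\<in>F. s mod NN k = k \<and> (\<exists>j\<in>{t..<i}. s \<le> xs j + 2 * NN k \<and> xs j \<le> s + 2 * NN k))"

text \<open>Separators of one level are at least \<open>NN k\<close> apart, so the blocks of that
  length starting at them are disjoint parts of the area.\<close>

lemma card_cover:
  assumes "cover k t i F" shows "card F * NN k \<le> card (area k t i)"
proof -
  let ?J = "\<lambda>s. {int s..<int s + int (NN k)}"
  have dis: "?J s \<inter> ?J s' = {}" if "s \<in> F" "s' \<in> F" "s \<noteq> s'" for s s'
  proof (rule ccontr)
    assume "?J s \<inter> ?J s' \<noteq> {}"
    then have "s < s' + NN k" "s' < s + NN k" by auto
    moreover have "s mod NN k = s' mod NN k" using that assms by (simp add: cover_def)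
    ultimately show False using residue_eq[of s "NN k" s'] that(3) by simp
  qed
  have "card (\<Union>s\<in>F. ?J s) = (\<Sum>s\<in>F. card (?J s))"
    by (rule card_UN_disjoint) (use assms dis in \<open>auto simp: cover_def\<close>)
  then have "card (\<Union>s\<in>F. ?J s) = card F * NN k" by simp
  moreover have "(\<Union>s\<in>F. ?J s) \<subseteq> area k t i"
  proof
    fix z assume "z \<in> (\<Union>s\<in>F. ?J s)"
    then obtain s where s: "s \<in> F" "int s \<le> z" "z < int s + int (NN k)" by auto
    then obtain j where j: "j \<in> {t..<i}" "s \<le> xs j + 2 * NN k" "xs j \<le> s + 2 * NN k" using assms unfolding cover_def by blast
    have "z \<in> window (NN k) (xs j)" using s j unfolding window_def by auto
    then show "z \<in> area k t i" using j(1) by (auto simp: area_def)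
  qed
  then have "card (\<Union>s\<in>F. ?J s) \<le> card (area k t i)" by (rule card_mono[rotated]) (simp add: area_def)
  ultimately show ?thesis by simp
qed

definition expensive_count :: "nat \<Rightarrow> nat \<Rightarrow> nat" where
  "expensive_count k i = card {j \<in> {..<i}. expensive k j}"

lemma expensive_count_split:
  assumes "t \<le> i" shows "expensive_count k i = expensive_count k t + card {j \<in> {t..<i}. expensive k j}"
proof -
  have e: "{j \<in> {..<i}. expensive k j} = {j \<in> {..<t}. expensive k j} \<union> {j \<in> {t..<i}. expensive k j}" using assms by auto
  have "card ({j \<in> {..<t}. expensive k j} \<union> {j \<in> {t..<i}. expensive k j}) = card {j \<in> {..<t}. expensive k j} + card {j \<in> {t..<i}. expensive k j}"
    by (rule card_Un_disjoint) auto
  then show ?thesis unfolding expensive_count_def e .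
qed

lemma pow_NN: "4 \<le> k \<Longrightarrow> 2 ^ k * NN (k - 1) \<le> NN k"
proof -
  assume k: "4 \<le> k"
  then have e: "NN k = NN (k - 1) * NN (k - 1)" using NN_Suc[of "k - 1"] by simp
  have "k \<le> 2 ^ (k - 1)" using less_exp[of "k - 1"] k by linarith
  then have "2 ^ k \<le> NN (k - 1)" unfolding NN_def by (rule power_increasing) simp
  then show ?thesis unfolding e by (rule mult_le_mono1)
qed

text \<open>The area bound divided by \<open>NN k\<close>: an expensive access or a recent key
  accounts for at most seven separators, a cheap access for \<open>NN (k - 1) / NN k\<close>, which
  is at most \<open>1 / 2 ^ k\<close>.\<close>

lemma cover_bound:
  assumes "cover k t i F" "4 \<le> k" "k < top" "t \<le> i"
  shows "2 ^ k * card F \<le> 7 * 2 ^ k * (card {j \<in> {t..<i}. expensive k j} + (if t = 0 then 0 else NN (k - 1) + 1)) + (i - t)"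
proof -
  define e where "e = card {j \<in> {t..<i}. expensive k j}"
  define R where "R = (if t = 0 then 0 else NN (k - 1) + 1)"
  have N: "1 \<le> NN k" using NN_ge2[of k] by simp
  have "card F * NN k \<le> (e + card (recent (NN (k - 1)) t)) * (6 * NN k + 1) + (i - t) * NN (k - 1)"
    using card_cover[OF assms(1)] card_area[of k t i] assms by (simp add: e_def)
  also have "\<dots> \<le> (e + R) * (7 * NN k) + (i - t) * NN (k - 1)"
    using card_recent[of "NN (k - 1)" t] N by (intro add_right_mono mult_le_mono) (auto simp: R_def)
  finally have "2 ^ k * (card F * NN k) \<le> 2 ^ k * ((e + R) * (7 * NN k) + (i - t) * NN (k - 1))" by (rule mult_le_mono2)
  also have "\<dots> = 7 * 2 ^ k * (e + R) * NN k + (i - t) * (2 ^ k * NN (k - 1))" by (simp add: algebra_simps)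
  also have "\<dots> \<le> 7 * 2 ^ k * (e + R) * NN k + (i - t) * NN k"
    using pow_NN[OF assms(2)] by (intro add_left_mono mult_le_mono2)
  finally have "(2 ^ k * card F) * NN k \<le> (7 * 2 ^ k * (e + R) + (i - t)) * NN k" by (simp add: algebra_simps)
  then show ?thesis using N unfolding e_def R_def by (simp only: mult_le_cancel2) 
qed

text \<open>Twice the bound of \<open>cover_bound\<close> without its term for recent keys, which
  the doubling absorbs.\<close>

definition Bd :: "nat \<Rightarrow> nat \<Rightarrow> nat" where
  "Bd k i = 14 * 2 ^ k * expensive_count k i + 2 * i"

text \<open>\<open>I\<close> counts the insertions into layer \<open>k\<close> so far, of which \<open>r\<close>, of the separators in \<open>F\<close>,
  belong to the current phase, which began at time \<open>t\<close>.\<close>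
definition amort :: "nat \<Rightarrow> nat \<Rightarrow> nat \<Rightarrow> nat \<Rightarrow> nat set \<Rightarrow> bool" where
  "amort k i I r F \<longleftrightarrow> card F = r \<and> (\<exists>t b. I = b + r \<and> t \<le> i \<and> cover k t i F \<and> 2 ^ k * b \<le> Bd k t \<and> (t = 0 \<and> b = 0 \<or> NN k \<le> b))"

lemma NN14: "4 \<le> k \<Longrightarrow> 14 * (NN (k - 1) + 1) \<le> NN k"
proof -
  assume k: "4 \<le> k"
  then have e: "NN k = NN (k - 1) * NN (k - 1)" using NN_Suc[of "k - 1"] by simp
  have "NN 3 \<le> NN (k - 1)" using k by (intro NN_mono) simp
  then have "256 \<le> NN (k - 1)" by (simp add: NN_def)
  then have "256 * NN (k - 1) \<le> NN k" unfolding e by (rule mult_le_mono1)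
  then show ?thesis using \<open>256 \<le> NN (k - 1)\<close> unfolding distrib_left by linarith
qed

text \<open>\<open>Q\<close> stands for the keys recent at the start of a phase. A full phase has
  \<open>14 * Q \<le> X\<close>, so half of \<open>X\<close> absorbs them; an unfinished phase
  charges them to \<open>Y\<close>, the insertions of earlier phases.\<close>

lemma phase_arith: "\<lbrakk>X \<le> 7 * P + (if B then 0 else 7 * Q) + d; 14 * Q \<le> X\<rbrakk> \<Longrightarrow> X \<le> 14 * P + 2 * (d::nat)"
  and phase_arith': "\<lbrakk>X \<le> 7 * P + (if B then 0 else 7 * Q) + d; B \<or> 14 * Q \<le> Y\<rbrakk> \<Longrightarrow> X \<le> 14 * P + 2 * d + (Y::nat)"
  by (auto split: if_splits)

lemma amort_flip:
  assumes "amort k i I r F" "4 \<le> k" "k < top" "NN k \<le> r"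
  shows "amort k i I 0 {}"
proof -
  obtain t b where a: "card F = r" "I = b + r" "t \<le> i" "cover k t i F" "2 ^ k * b \<le> Bd k t" using assms(1) unfolding amort_def by blast
  define e where "e = card {j \<in> {t..<i}. expensive k j}"
  have "2 ^ k * r \<le> 7 * 2 ^ k * (e + (if t = 0 then 0 else NN (k - 1) + 1)) + (i - t)"
    using cover_bound[OF a(4) assms(2,3) a(3)] by (simp only: a(1) e_def)
  then have c: "2 ^ k * r \<le> 7 * (2 ^ k * e) + (if t = 0 then 0 else 7 * (2 ^ k * (NN (k - 1) + 1))) + (i - t)"
    by (cases "t = 0") (simp_all only: simp_thms if_True if_False add_0_right mult_0_right distrib_left mult.assoc)
  have "2 ^ k * (14 * (NN (k - 1) + 1)) \<le> 2 ^ k * r"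
    by (rule mult_le_mono2[OF order_trans[OF NN14[OF assms(2)] assms(4)]])
  then have "14 * (2 ^ k * (NN (k - 1) + 1)) \<le> 2 ^ k * r" by (simp only: mult.left_commute)
  from c this have r: "2 ^ k * r \<le> 14 * (2 ^ k * e) + 2 * (i - t)"
    by (rule phase_arith)
  have "2 ^ k * I = 2 ^ k * b + 2 ^ k * r" by (simp only: a(2) distrib_left)
  then have "2 ^ k * I \<le> Bd k t + 14 * (2 ^ k * e) + 2 * (i - t)" using a(5) r by linarith
  also have "\<dots> = Bd k i" using a(3) expensive_count_split[OF a(3), of k] by (simp add: Bd_def e_def algebra_simps)
  finally have "2 ^ k * I \<le> Bd k i" .
  then show ?thesis unfolding amort_def using a assms(4) by (intro conjI exI[of _ i] exI[of _ I]) (auto simp: cover_def)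
qed

lemma amort_final:
  assumes "amort k i I r F" "4 \<le> k" "k < top"
  shows "2 ^ k * I \<le> 2 * Bd k i"
proof -
  obtain t b where a: "card F = r" "I = b + r" "t \<le> i" "cover k t i F" "2 ^ k * b \<le> Bd k t" "t = 0 \<and> b = 0 \<or> NN k \<le> b"
    using assms(1) unfolding amort_def by blast
  define e where "e = card {j \<in> {t..<i}. expensive k j}"
  have "2 ^ k * r \<le> 7 * 2 ^ k * (e + (if t = 0 then 0 else NN (k - 1) + 1)) + (i - t)"
    using cover_bound[OF a(4) assms(2,3) a(3)] by (simp only: a(1) e_def)
  then have c: "2 ^ k * r \<le> 7 * (2 ^ k * e) + (if t = 0 then 0 else 7 * (2 ^ k * (NN (k - 1) + 1))) + (i - t)"
    by (cases "t = 0") (simp_all only: simp_thms if_True if_False add_0_right mult_0_right distrib_left mult.assoc)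
  have B: "Bd k i = Bd k t + 14 * 2 ^ k * e + 2 * (i - t)" using a(3) expensive_count_split[OF a(3), of k] by (simp add: Bd_def e_def algebra_simps)
  have t: "t = 0 \<or> 14 * (2 ^ k * (NN (k - 1) + 1)) \<le> 2 ^ k * b"
  proof (cases "t = 0")
    case False
    then have "14 * (NN (k - 1) + 1) \<le> b" using a(6) order_trans[OF NN14[OF assms(2)]] by blast
    then have "2 ^ k * (14 * (NN (k - 1) + 1)) \<le> 2 ^ k * b" by (rule mult_le_mono2)
    then show ?thesis by (simp only: mult.left_commute simp_thms)
  qed simp
  have r: "2 ^ k * r \<le> 14 * (2 ^ k * e) + 2 * (i - t) + 2 ^ k * b"
    by (rule phase_arith'[OF c t])
  have "2 ^ k * I = 2 ^ k * b + 2 ^ k * r" by (simp only: a(2) distrib_left)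
  moreover have "Bd k i = Bd k t + 14 * (2 ^ k * e) + 2 * (i - t)" using B by (simp only: mult.assoc)
  ultimately have "2 * (2 ^ k * I) \<le> 4 * Bd k i" using a(5) r by linarith
  then show ?thesis by linarith
qed

lemma cover_mono: "cover k t i F \<Longrightarrow> cover k t (Suc i) F"
  unfolding cover_def by (meson atLeastLessThan_iff less_SucI)

lemma amort_mono: "amort k i I r F \<Longrightarrow> amort k (Suc i) I r F"
  unfolding amort_def using cover_mono le_SucI by blast

lemma amort_insert:
  assumes "amort k i I r F" "card (F \<union> W k (xs i)) = r + m"
  shows "amort k (Suc i) (I + m) (r + m) (F \<union> W k (xs i))"
proof -
  obtain t b where a: "card F = r" "I = b + r" "t \<le> i" "cover k t i F" "2 ^ k * b \<le> Bd k t" "t = 0 \<and> b = 0 \<or> NN k \<le> b"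
    using assms(1) unfolding amort_def by blast
  have "cover k t (Suc i) (F \<union> W k (xs i))" unfolding cover_def
  proof (intro conjI ballI)
    show "finite (F \<union> W k (xs i))" using a(4) by (simp add: cover_def)
    fix s assume "s \<in> F \<union> W k (xs i)"
    then consider "s \<in> F" | "s \<in> W k (xs i)" by blast
    then show "s mod NN k = k" "\<exists>j\<in>{t..<Suc i}. s \<le> xs j + 2 * NN k \<and> xs j \<le> s + 2 * NN k"
    proof (atomize (full), cases)
      case 1
      then show "s mod NN k = k \<and> (\<exists>j\<in>{t..<Suc i}. s \<le> xs j + 2 * NN k \<and> xs j \<le> s + 2 * NN k)"
        using a(4) unfolding cover_def by force
    next
      case 2
      then show "s mod NN k = k \<and> (\<exists>j\<in>{t..<Suc i}. s \<le> xs j + 2 * NN k \<and> xs j \<le> s + 2 * NN k)"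
        using a(3) unfolding W_def by force
    qed
  qed
  then show ?thesis unfolding amort_def using assms(2) a by (intro conjI exI[of _ t] exI[of _ b]) auto
qed

section \<open>Comparison with the unified bound\<close>

lemma UB_ge_1: "1 \<le> UB n xs j"
proof -
  have "1 \<le> lg (real (wset n xs j y) + \<bar>real (xs j) - real y\<bar>)" for y
  proof -
    have "log 2 2 \<le> log 2 (real (wset n xs j y) + \<bar>real (xs j) - real y\<bar> + 2)" by (subst log_le_cancel_iff) auto
    then show ?thesis by (simp add: lg_def)
  qed
  then show ?thesis unfolding UB_def using n1 by (subst Min_ge_iff) auto
qed

lemma UB_expensive:
  assumes "expensive k j" "1 \<le> k" shows "2 ^ k \<le> 2 * UB n xs j"
proof -
  have "2 ^ (k - 1) \<le> lg (real (wset n xs j y) + \<bar>real (xs j) - real y\<bar>)" if "y \<in> {1..n}" for y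
  proof -
    have "real (NN (k - 1)) < real (wset n xs j y) + \<bar>real (xs j) - real y\<bar>" using assms(1) that by (simp add: expensive_def)
    then have "log 2 (real (NN (k - 1))) \<le> log 2 (real (wset n xs j y) + \<bar>real (xs j) - real y\<bar> + 2)"
      using NN_ge2[of "k - 1"] by (subst log_le_cancel_iff) auto
    moreover have "log 2 (real (NN (k - 1))) = 2 ^ (k - 1)" by (simp add: NN_def log_nat_power)
    ultimately show ?thesis by (simp add: lg_def)
  qed
  then have "2 ^ (k - 1) \<le> UB n xs j" unfolding UB_def using n1 by (subst Min_ge_iff) auto
  moreover have "(2::real) ^ k = 2 * 2 ^ (k - 1)" using assms(2) by (cases k) auto
  ultimately show ?thesis by simp
qed

text \<open>The geometric sum is dominated by the largest level \<open>m\<close> at which the access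
  is expensive, and there \<open>2 ^ m \<le> 2 * UB n xs j\<close>.\<close>

lemma sum_expensive: "(\<Sum>k\<in>{kap..<top}. if expensive k j then (2::real) ^ k else 0) \<le> 4 * UB n xs j"
proof -
  define X where "X = {k \<in> {kap..<top}. expensive k j}"
  have s: "(\<Sum>k\<in>{kap..<top}. if expensive k j then (2::real) ^ k else 0) = (\<Sum>k\<in>X. 2 ^ k)"
    unfolding X_def by (subst sum.inter_filter[symmetric]) auto
  show ?thesis
  proof (cases "X = {}")
    case True
    then show ?thesis using s UB_ge_1[of j] by simp
  next
    case False
    have fX: "finite X" by (simp add: X_def)
    define m where "m = Max X"
    have m: "m \<in> X" using False fX by (simp add: m_def)
    have "X \<subseteq> {0..<Suc m}" using fX by (auto simp: m_def less_Suc_eq_le)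
    then have "(\<Sum>k\<in>X. (2::nat) ^ k) \<le> (\<Sum>k\<in>{0..<Suc m}. 2 ^ k)" by (intro sum_mono2) auto
    also have "\<dots> \<le> 2 ^ Suc m" by (rule sum_pow2)
    finally have "real (\<Sum>k\<in>X. 2 ^ k) \<le> real (2 ^ Suc m)" by (rule of_nat_mono)
    then have "(\<Sum>k\<in>X. (2::real) ^ k) \<le> 2 * 2 ^ m" by simp
    also have "\<dots> \<le> 4 * UB n xs j" using UB_expensive[of m j] m kap(1) by (simp add: X_def)
    finally show ?thesis using s by simp
  qed
qed

lemma sum_ex: "(\<Sum>k\<in>{kap..<top}. 2 ^ k * real (expensive_count k i)) \<le> 4 * (\<Sum>j<i. UB n xs j)"
proof -
  have e: "2 ^ k * real (expensive_count k i) = (\<Sum>j<i. if expensive k j then (2::real) ^ k else 0)" for k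
  proof -
    have "(\<Sum>j<i. if expensive k j then (2::real) ^ k else 0) = (\<Sum>j\<in>{j \<in> {..<i}. expensive k j}. 2 ^ k)"
      by (rule sum.inter_filter[symmetric]) simp
    then show ?thesis by (simp add: expensive_count_def)
  qed
  have "(\<Sum>k\<in>{kap..<top}. 2 ^ k * real (expensive_count k i)) = (\<Sum>j<i. \<Sum>k\<in>{kap..<top}. if expensive k j then (2::real) ^ k else 0)"
    unfolding e by (rule sum.swap)
  also have "\<dots> \<le> (\<Sum>j<i. 4 * UB n xs j)" by (rule sum_mono) (rule sum_expensive)
  finally show ?thesis by (simp add: sum_distrib_left)
qed

end

section \<open>Sizes of the extreme levels\<close>

context sep
begin

lemma pow_top: "2 ^ top \<le> 2 * lg (real n)" and top_le: "real top \<le> 1 + lg (lg (real n))" and lg_ge1: "1 \<le> lg (real n)" "1 \<le> lg (lg (real n))"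
proof -
  have l1: "1 \<le> lg y" if "0 \<le> y" for y
    using that log_le_cancel_iff[of 2 2 "y + 2"] by (simp add: lg_def)
  show n1': "1 \<le> lg (real n)" by (rule l1) simp
  show "1 \<le> lg (lg (real n))" by (rule l1) (use n1' in simp)
  show "2 ^ top \<le> 2 * lg (real n)"
  proof (cases "top = 1")
    case False
    then have t: "1 \<le> top - 1" "top - 1 < top" using top(1) by auto
    have "real (NN (top - 1)) \<le> real n + 2" using NN_less_n[OF t] by simp
    then have "log 2 (real (NN (top - 1))) \<le> lg (real n)" using NN_ge2[of "top - 1"] by (simp add: lg_def)
    then have "2 ^ (top - 1) \<le> lg (real n)" by (simp add: NN_def log_nat_power)
    moreover have "(2::real) ^ top = 2 * 2 ^ (top - 1)" using top(1) by (cases top) auto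
    ultimately show ?thesis by simp
  qed (use n1' in simp)
  then have "2 ^ top \<le> 2 * (lg (real n) + 2)" by simp
  then have "log 2 (2 ^ top) \<le> log 2 (2 * (lg (real n) + 2))" using n1' by (subst log_le_cancel_iff) auto
  moreover have "log 2 (2 * (lg (real n) + 2)) = log 2 2 + log 2 (lg (real n) + 2)" using n1' by (subst log_mult) auto
  ultimately have "real top \<le> log 2 2 + log 2 (lg (real n) + 2)" by (simp only: log_pow_cancel)
  then show "real top \<le> 1 + lg (lg (real n))" by (simp add: lg_def)
qed

text \<open>Minimality of \<open>L\<close> gives
  \<open>2 ^ kap \<le> 16 + 2 ^ L \<le> 18 + 2 * top\<close>, which is at most
  \<open>20 + 2 * lg (lg n)\<close>; the \<open>20\<close> is absorbed since
  \<open>lg (lg n)\<close> is at least one.\<close>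

lemma pow_kap: "2 ^ kap \<le> 22 * lg (lg (real n))"
proof -
  define L where "L = (LEAST j. top + 1 \<le> 2 ^ j)"
  have "2 ^ L \<le> 2 * (top + 1)"
  proof (cases L)
    case (Suc l)
    have "\<not> top + 1 \<le> 2 ^ l" using not_less_Least[of l "\<lambda>j. top + 1 \<le> 2 ^ j"] Suc by (simp add: L_def)
    then show ?thesis using Suc by simp
  qed simp
  moreover have "2 ^ kap \<le> 16 + (2::nat) ^ L" 
  proof -
    have "kap = max 4 L" by (simp add: kap_def L_def)
    then show ?thesis by (cases "4 \<le> L") (auto simp: max_def)
  qed
  ultimately have "(2::nat) ^ kap \<le> 18 + 2 * top" unfolding distrib_left by linarith
  then have "real (2 ^ kap) \<le> real (18 + 2 * top)" by (rule of_nat_mono)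
  then show ?thesis using top_le lg_ge1(2) by simp
qed

lemma lglg_le: "lg (lg (real n)) \<le> 2 * lg (real n)"
proof -
  have "log 2 (lg (real n) + 2) \<le> lg (real n) + 1"
  proof -
    have "lg (real n) + 2 \<le> 2 powr (lg (real n) + 1)"
    proof -
      have "2 powr (lg (real n)) = real n + 2" by (simp add: lg_def)
      moreover have "lg (real n) \<le> real n + 1"
      proof -
        have "log 2 (real (n + 2)) \<le> real (n + 1)"
        proof -
          have "n + 2 \<le> 2 ^ (n + 1)" by (induction n) auto
          then have "real (n + 2) \<le> 2 ^ (n + 1)" by (metis of_nat_le_iff of_nat_numeral of_nat_power)
          then have "log 2 (real (n + 2)) \<le> log 2 (2 ^ (n + 1))" by (subst log_le_cancel_iff) auto
          then show ?thesis by (simp only: log_pow_cancel numeral_One)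
        qed
        then show ?thesis by (simp add: lg_def algebra_simps)
      qed
      ultimately show ?thesis by (simp add: powr_add)
    qed
    then have "log 2 (lg (real n) + 2) \<le> log 2 (2 powr (lg (real n) + 1))" using lg_ge1(1) by (subst log_le_cancel_iff) auto
    then show ?thesis by simp
  qed
  then show ?thesis using lg_ge1(1) unfolding lg_def by linarith
qed

end

section \<open>Initial tree and encoding of nodes\<close>

text \<open>The height reached by repeated halving. One more node raises it by at most one, so the
  halves of the initial tree satisfy the AVL condition.\<close>

fun bheight :: "nat \<Rightarrow> nat" where
  "bheight m = (if m = 0 then 0 else Suc (bheight (m div 2)))"

declare bheight.simps [simp del]

lemma bheight_0 [simp]: "bheight 0 = 0" and bheight_pos: "0 < m \<Longrightarrow> bheight m = Suc (bheight (m div 2))"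
  by (subst bheight.simps, simp)+

lemma bheight_Suc: "bheight m \<le> bheight (Suc m) \<and> bheight (Suc m) \<le> Suc (bheight m)"
proof (induction m rule: less_induct)
  case (less m)
  show ?case
  proof (cases "m = 0")
    case True
    then show ?thesis by (simp add: bheight_pos)
  next
    case False
    then have "Suc m div 2 = m div 2 \<or> Suc m div 2 = Suc (m div 2)" "m div 2 < m" by linarith+
    then show ?thesis using less.IH[of "m div 2"] False bheight_pos[of m] bheight_pos[of "Suc m"] by auto
  qed
qed

lemma ex_balanced:
  assumes "g \<in> G"
  shows "\<exists>T. wf G T \<and> ge (fst s) T \<and> lh (fst s) T = bheight (length xs) \<and> map ky (inorder T) = xs \<and>
     (\<forall>a\<in>set_tree T. st a = s \<and> gl a = g)"
proof (induction xs rule: length_induct)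
  case (1 xs)
  show ?case
  proof (cases "xs = []")
    case True
    then show ?thesis by (intro exI[of _ Leaf]) simp
  next
    case False
    define m where "m = length xs div 2"
    have m: "m < length xs" using False by (simp add: m_def)
    define ys where "ys = take m xs"
    define zs where "zs = drop (Suc m) xs"
    have xs: "xs = ys @ xs ! m # zs" using m by (simp add: ys_def zs_def id_take_nth_drop)
    have len: "length ys = m" "length zs = length xs - Suc m" using m by (auto simp: ys_def zs_def)
    have "length ys < length xs" "length zs < length xs" using m len by auto
    then obtain l r where
      l: "wf G l" "ge (fst s) l" "lh (fst s) l = bheight m" "map ky (inorder l) = ys" "\<forall>a\<in>set_tree l. st a = s \<and> gl a = g" and
      r: "wf G r" "ge (fst s) r" "lh (fst s) r = bheight (length xs - Suc m)" "map ky (inorder r) = zs" "\<forall>a\<in>set_tree r. st a = s \<and> gl a = g"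
      using "1" len by metis
    have "length xs - Suc m = m \<or> Suc (length xs - Suc m) = m" unfolding m_def using m by linarith
    then have b: "bheight (length xs - Suc m) \<le> bheight m" "bheight m \<le> bheight (length xs - Suc m) + 1"
      using bheight_Suc[of "length xs - Suc m"] by auto
    have h: "bheight (length xs) = Suc (bheight m)" using m unfolding m_def by (intro bheight_pos) auto
    define a where "a = ND (xs ! m) s (1 + bheight m) (insert s (sms l \<union> sms r)) g"
    have "wf G (Node l a r)" using l r b assms by (simp add: a_def)
    moreover have "map ky (inorder (Node l a r)) = xs" using l r xs by (simp add: a_def)
    ultimately show ?thesis using l r h by (intro exI[of _ "Node l a r"]) (simp add: a_def ball_Un)
  qed
qed

lemma node_bounds:
  assumes "wf G T" "a \<in> set_tree T"
  shows "gl a \<in> G \<and> sm a \<subseteq> snd ` set (ks T) \<and> ht a \<le> size T"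
  using assms
proof (induction T)
  case (Node l b r)
  then consider "a = b" | "a \<in> set_tree l" | "a \<in> set_tree r" by auto
  then show ?case
  proof cases
    case 1
    have "ht b \<le> size (Node l b r)" using lh_le_size[of G "Node l b r" "ly b"] Node.prems by simp
    then show ?thesis using 1 Node.prems sms_ks[of G "Node l b r"] by simp
  next
    case 2
    then have "gl a \<in> G \<and> sm a \<subseteq> snd ` set (ks l) \<and> ht a \<le> size l" using Node.IH(1) Node.prems(1) by simp
    then show ?thesis by (auto simp: image_Un)
  next
    case 3
    then have "gl a \<in> G \<and> sm a \<subseteq> snd ` set (ks r) \<and> ht a \<le> size r" using Node.IH(2) Node.prems(1) by simp
    then show ?thesis by (auto simp: image_Un)
  qed
qed simp

section \<open>Encoding node contents as numbers\<close>

context sep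
begin

definition statuses :: "(nat \<times> nat) set" where
  "statuses = {..top} \<times> {..3}"

definition contents :: "((nat \<times> nat) \<times> nat \<times> (nat \<times> nat) set \<times> (nat \<Rightarrow> nat \<times> nat)) set" where
  "contents = statuses \<times> {..n} \<times> Pow statuses \<times> G"

definition content :: "nd \<Rightarrow> (nat \<times> nat) \<times> nat \<times> (nat \<times> nat) set \<times> (nat \<Rightarrow> nat \<times> nat)" where
  "content a = (st a, ht a, sm a, gl a)"

lemma two_pow_top: "2 ^ top \<le> 2 * (n + 2)"
proof (cases "top = 1")
  case False
  then have "NN (top - 1) < n" using top(1) by (intro NN_less_n) auto
  moreover have "2 ^ (top - 1) < NN (top - 1)" unfolding NN_def by (rule less_exp)
  moreover have "(2::nat) ^ top = 2 * 2 ^ (top - 1)" using top(1) by (cases top) auto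
  ultimately show ?thesis unfolding distrib_left by linarith
qed simp

text \<open>As \<open>NN\<close> squares from level to level, the product of all factors
  \<open>3 * (NN k + 5)\<close> below \<open>top\<close> is at most
  \<open>NN (Suc top) = NN (top - 1) ^ 4\<close>, where \<open>NN (top - 1) < n\<close>.\<close>

lemma finite_card_G: "finite G \<and> card G \<le> (n + 2) ^ 4"
proof -
  define P where "P = PiE {kap..<top} (\<lambda>k. {..<3::nat} \<times> {..NN k + 4})"
  have mem: "if kap \<le> k \<and> k < top then fst (g k) < 3 \<and> snd (g k) \<le> NN k + 4 else g k = (0, 0)" if "g \<in> G" for g k
    using that unfolding G_def by blast
  have fP: "finite P" unfolding P_def by (intro finite_PiE) auto
  have inj: "inj_on (\<lambda>g. restrict g {kap..<top}) G"
  proof (rule inj_onI, rule ext)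
    fix g g' k assume a: "g \<in> G" "g' \<in> G" "restrict g {kap..<top} = restrict g' {kap..<top}"
    show "g k = g' k"
    proof (cases "kap \<le> k \<and> k < top")
      case True
      then show ?thesis using fun_cong[OF a(3), of k] by simp
    next
      case False
      then show ?thesis using mem[OF a(1), of k] mem[OF a(2), of k] by (simp only: if_False)
    qed
  qed
  have sub: "(\<lambda>g. restrict g {kap..<top}) ` G \<subseteq> P"
  proof (rule image_subsetI)
    fix g assume "g \<in> G"
    then have "fst (g k) < 3 \<and> snd (g k) \<le> NN k + 4" if "k \<in> {kap..<top}" for k using mem[of g k] that by simp
    then show "restrict g {kap..<top} \<in> P" unfolding P_def restrict_PiE_iff by (simp add: mem_Times_iff)
  qed
  have "finite G" using finite_imageD[OF finite_subset[OF sub fP] inj] .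
  have prod: "(\<Prod>k\<in>{kap..<b}. 3 * (NN k + 5)) \<le> NN (Suc b)" for b
  proof (induction b)
    case (Suc b)
    show ?case
    proof (cases "kap \<le> b")
      case True
      have "3 * (NN b + 5) \<le> 65536 * NN b" using NN_big[OF True] unfolding distrib_left by linarith
      also have "\<dots> \<le> NN (Suc b)" unfolding NN_Suc using NN_big[OF True] by (rule mult_le_mono1)
      finally have "(\<Prod>k\<in>{kap..<b}. 3 * (NN k + 5)) * (3 * (NN b + 5)) \<le> NN (Suc b) * NN (Suc b)"
        by (rule mult_le_mono[OF Suc])
      then show ?thesis using True by (simp only: prod.atLeastLessThan_Suc NN_Suc[of "Suc b"])
    next
      case False
      then show ?thesis using NN_ge2[of "Suc (Suc b)"] by simp
    qed
  qed (use NN_ge2[of "Suc 0"] in simp)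
  have "card G \<le> card P" using card_inj_on_le[OF inj sub fP] .
  also have "card P = (\<Prod>k\<in>{kap..<top}. 3 * (NN k + 5))"
    unfolding P_def by (simp add: card_PiE card_cartesian_product algebra_simps)
  also have "\<dots> \<le> (n + 2) ^ 4"
  proof (cases "kap < top")
    case True
    then have t: "1 \<le> top - 1" "top - 1 < top" "top = Suc (top - 1)" using kap(1) by auto
    have "(\<Prod>k\<in>{kap..<top}. 3 * (NN k + 5)) \<le> NN (Suc top)" by (rule prod)
    also have "\<dots> = NN (top - 1) ^ 4" using NN_Suc[of top] NN_Suc[of "top - 1"] t(3) by (simp add: power4_eq_xxxx)
    also have "\<dots> \<le> (n + 2) ^ 4" using NN_less_n[OF t(1,2)] by (intro power_mono) auto
    finally show ?thesis .
  qed simp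
  finally show ?thesis using \<open>finite G\<close> by simp
qed

text \<open>The exponents are \<open>3 + 1 + 12 + 4 = 20\<close> for status, height, summary and
  globals. Summaries are arbitrary sets of statuses, but there are only \<open>4 * (top + 1)\<close>
  statuses, so even the crude \<open>2 ^ top \<le> 2 * (n + 2)\<close> gives a polynomial.\<close>

lemma finite_card_contents: "finite contents" "card contents \<le> (n + 2) ^ 21"
proof -
  define m where "m = n + 2"
  have m3: "3 \<le> m" using n1 by (simp add: m_def)
  have fs: "finite statuses" by (simp add: statuses_def)
  show "finite contents" unfolding contents_def using fs finite_card_G by simp
  have t: "Suc top \<le> 2 ^ top" using less_exp[of top] by linarith
  have t2: "2 ^ top \<le> 2 * m" using two_pow_top by (simp add: m_def)
  have cs: "card statuses = 4 * Suc top" by (simp add: statuses_def card_cartesian_product)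
  have "4 * Suc top \<le> 8 * m" using mult_le_mono2[OF order_trans[OF t t2], of 4] by simp
  also have "8 * m \<le> m ^ 2 * m" using power_mono[OF m3, of 2] by (intro mult_le_mono1) simp
  finally have 1: "card statuses \<le> m ^ 3" unfolding cs by (simp add: power_numeral_reduce)
  have "card (Pow statuses) = 2 ^ (4 * Suc top)" using fs by (simp add: card_Pow cs)
  also have "\<dots> = (2 * 2 ^ top) ^ 4" by (simp only: power_mult[symmetric] power_Suc[symmetric] mult.commute[of 4])
  also have "\<dots> \<le> (4 * m) ^ 4" using t2 by (intro power_mono) auto
  also have "\<dots> \<le> (m ^ 2 * m) ^ 4" using power_mono[OF m3, of 2] by (intro power_mono mult_le_mono1) auto
  also have "\<dots> = m ^ 12" by (simp add: power_mult[symmetric] power_Suc2[symmetric] del: power_Suc2)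
  finally have 2: "card (Pow statuses) \<le> m ^ 12" .
  have "card contents = card statuses * (card {..n} * (card (Pow statuses) * card G))"
    by (simp only: contents_def card_cartesian_product)
  also have "\<dots> \<le> m ^ 3 * (m ^ 1 * (m ^ 12 * m ^ 4))"
    using 1 2 finite_card_G by (intro mult_le_mono) (auto simp: m_def)
  also have "\<dots> = m ^ 20" by (simp only: power_add[symmetric]) simp
  also have "\<dots> \<le> m ^ 21" using m3 by (intro power_increasing) auto
  finally show "card contents \<le> (n + 2) ^ 21" by (simp add: m_def)
qed

definition code :: "(nat \<times> nat) \<times> nat \<times> (nat \<times> nat) set \<times> (nat \<Rightarrow> nat \<times> nat) \<Rightarrow> nat" where
  "code = (SOME f. bij_betw f contents {0..<card contents})"

lemma code: "bij_betw code contents {0..<card contents}"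
  unfolding code_def by (rule someI_ex[where P = "\<lambda>f. bij_betw f contents {0..<card contents}"]) (rule ex_bij_betw_finite_nat[OF finite_card_contents(1)])

text \<open>One number holds all contents. The zeros pad to \<open>21\<close> fields, because
  \<open>fields_ok\<close> has a single constant for the number of fields and for the
  exponent.\<close>

definition enc :: "nd \<Rightarrow> node" where
  "enc a = (ky a, code (content a) # replicate 20 0)"

definition dcd :: "node \<Rightarrow> nd" where
  "dcd b = (case inv_into contents code (hd (snd b)) of (s, h, m, g) \<Rightarrow> ND (fst b) s h m g)"

sublocale encoded enc dcd "\<lambda>a. content a \<in> contents"
proof
  fix a assume "content a \<in> contents"
  then have "inv_into contents code (code (content a)) = content a"
    using code by (intro inv_into_f_f) (auto simp: bij_betw_def)
  then show "dcd (enc a) = a" by (simp add: dcd_def enc_def content_def)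
qed (simp add: enc_def)

definition state_inv :: "nd tree \<Rightarrow> (nat \<Rightarrow> nat \<times> nat) \<Rightarrow> bool" where
  "state_inv T \<gamma> \<longleftrightarrow> tree_ok G \<gamma> {1..n} T \<and> Inv \<gamma> (rgl T)"

lemma tree_ok_inorder:
  assumes "tree_ok G \<gamma> {1..n} T" shows "map ky (inorder T) = [1..<n + 1]"
proof -
  have "sorted_wrt (<) (map fst (ks T))" "set (map fst (ks T)) = set [1..<n + 1]"
    using assms by (auto simp: tree_ok_def bst'_def image_image)
  then have "map fst (ks T) = [1..<n + 1]" by (intro strict_sorted_equal[OF sorted_wrt_upt]) simp_all
  then show ?thesis by (simp add: ks_def comp_def)
qed

lemma contents_ok:
  assumes "state_inv T \<gamma>" "a \<in> set_tree T" shows "content a \<in> contents"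
proof -
  have T: "wf G T" "set (ks T) = (\<lambda>y. (y, \<gamma> y)) ` {1..n}" "lay_ok \<gamma>" using assms by (auto simp: state_inv_def tree_ok_def Inv_def)
  have k: "map ky (inorder T) = [1..<n + 1]" using assms tree_ok_inorder by (auto simp: state_inv_def)
  have s: "\<gamma> y \<in> statuses" if "y \<in> {1..n}" for y
    using T(3) that unfolding lay_ok_def statuses_def by (fastforce simp: mem_Times_iff)
  have ks: "snd ` set (ks T) \<subseteq> statuses" using T(2) s by auto
  have "(ky a, st a) \<in> set (ks T)" using assms(2) by (auto simp: ks_def)
  then have "st a \<in> statuses" using ks by force
  moreover have "size T = n" using arg_cong[OF k, of length] by (simp add: length_inorder)
  ultimately show ?thesis using node_bounds[OF T(1) assms(2)] ks
    by (simp add: contents_def content_def subset_trans[of "sm a" "snd ` set (ks T)" statuses])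
qed

lemma real_ok:
  assumes "state_inv T \<gamma>" shows "bst_on n (real_tree T)" "fields_ok 21 n (real_tree T)"
proof -
  have "map fst (inorder (real_tree T)) = map ky (inorder T)"
    by (simp add: real_tree_def comp_def enc_def inorder_map)
  then show "bst_on n (real_tree T)" using assms tree_ok_inorder[of \<gamma> T] by (simp only: bst_on_def state_inv_def)
  have "code (content a) < (n + 2) ^ 21" if "a \<in> set_tree T" for a
    using bij_betwE[OF code] contents_ok[OF assms that] finite_card_contents(2) by fastforce
  then show "fields_ok 21 n (real_tree T)"
    by (auto simp: fields_ok_def real_tree_def tree.set_map enc_def)
qed

lemma ex_initial: "\<exists>T. state_inv T (\<lambda>_. (top, 3)) \<and> rgl T = (\<lambda>_. (0, 0))"
proof -
  define g :: "nat \<Rightarrow> nat \<times> nat" where "g = (\<lambda>_. (0, 0))"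
  define \<gamma> :: "nat \<Rightarrow> nat \<times> nat" where "\<gamma> = (\<lambda>_. (top, 3))"
  have g: "g \<in> G" by (simp add: G_def g_def)
  then obtain T where T: "wf G T" "map ky (inorder T) = [1..<n + 1]" "\<forall>a\<in>set_tree T. st a = (top, 3) \<and> gl a = g"
    using ex_balanced[OF g, of "(top, 3)" "[1..<n + 1]"] by blast
  have "ks T = map (\<lambda>a. (ky a, (top, 3))) (inorder T)" using T(3) by (simp add: ks_def)
  also have "\<dots> = map (\<lambda>y. (y, (top, 3))) (map ky (inorder T))" by simp
  finally have ks: "ks T = map (\<lambda>y. (y, \<gamma> y)) [1..<n + 1]" unfolding T(2) \<gamma>_def .
  have f: "map fst (ks T) = [1..<n + 1]" unfolding ks map_map comp_def fst_conv by (rule list.map_ident)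
  have "set (ks T) = (\<lambda>y. (y, \<gamma> y)) ` {1..n}" unfolding ks set_map by (simp only: set_upt atLeastLessThanSuc_atLeastAtMost Suc_eq_plus1[symmetric])
  then have "tree_ok G \<gamma> {1..n} T" unfolding tree_ok_def bst'_def f using T(1) sorted_wrt_upt by blast
  moreover have "rgl T = g" using T(3) by (cases T) (auto simp: g_def)
  moreover have "S k j \<gamma> = {}" if "k < top" for k j using that by (auto simp: S_def \<gamma>_def)
  then have "Inv \<gamma> g" using g
    by (auto simp: Inv_def lay_ok_def cnt_ok_def incl_def \<gamma>_def[symmetric]) (auto simp: \<gamma>_def g_def)
  ultimately show ?thesis by (auto simp: state_inv_def \<gamma>_def g_def)
qed

end

section \<open>The sequence of accesses\<close>

context sep
begin

definition decide :: decider where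
  "decide x = dec_of (prog x)"

lemma access_step:
  assumes "state_inv T \<gamma>" "x \<in> {1..n}"
  obtains k' \<gamma>' T' v out where "access decide n (real_tree T) x = Some (v, out)"
    "x \<in> fst ` set (vnodes v)" "nholes out = nholes v" "new_tree (real_tree T) v out = real_tree T'"
    "length (vnodes v) \<le> 170001 * 2 ^ k'" "state_inv T' \<gamma>'" "acc x \<gamma> (flip (rgl T)) \<gamma>' (rgl T') k'"
proof -
  have T: "tree_ok G \<gamma> {1..n} T" "Inv \<gamma> (rgl T)" using assms(1) by (auto simp: state_inv_def)
  have I: "Inv \<gamma> (flip (rgl T))" by (rule Inv_flip[OF T(2)])
  have s: "\<forall>k. kap \<le> k \<and> k < top \<longrightarrow> snd (flip (rgl T) k) < NN k" using snd_flip by blast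
  have i: "lay_ok \<gamma>" "cnt_ok \<gamma> (flip (rgl T))" "incl \<gamma> (flip (rgl T))" "flip (rgl T) \<in> G"
    using I unfolding Inv_def by blast+
  note w = wp_prog[OF T(1) refl i s assms(2)]
  then obtain k' \<gamma>' g' T' where a: "tree_ok G \<gamma>' {1..n} T'" "rgl T' = g'" "g' \<in> G" "acc x \<gamma> (flip (rgl T)) \<gamma>' g' k'"
    and w': "wp T {} (prog x) (\<lambda>B m u. m \<le> 170000 * 2 ^ k' \<and> rep T B u T' \<and> x \<in> vis T B)"
    unfolding wp_def by blast
  have "Inv \<gamma>' g'" by (rule Inv_acc[OF I s a(4,3)])
  then have O: "state_inv T' \<gamma>'" using a by (simp add: state_inv_def)
  have k: "map ky (inorder T) = [1..<n + 1]" "map ky (inorder T') = [1..<n + 1]"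
    using tree_ok_inorder T(1) a(1) by blast+
  have sz: "size T = n" using arg_cong[OF k(1), of length] by (simp only: length_map length_inorder length_upt)
  then have ne: "T \<noteq> Leaf" using n1 by auto
  have d: "distinct (map ky (inorder T))" unfolding k by (rule distinct_upt)
  have okn: "\<forall>a\<in>set_tree T. content a \<in> contents" using contents_ok[OF assms(1)] by blast
  have dx: "decide x = dec_of (prog x)" by (rule decide_def)
  show thesis
  proof (rule access_dec_of[where t = T and T = T' and dec = decide and x = x, OF w' trans[OF k(2) k(1)[symmetric]] d okn ne eq_refl[OF sz] dx])
    fix v out
    assume v: "access decide n (real_tree T) x = Some (v, out)" "x \<in> fst ` set (vnodes v)" "nholes out = nholes v"
      "new_tree (real_tree T) v out = real_tree T'" "length (vnodes v) \<le> Suc (170000 * 2 ^ k')"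
    have "Suc (170000 * 2 ^ k') \<le> 170001 * 2 ^ k'" by (induction k') auto
    then have "length (vnodes v) \<le> 170001 * 2 ^ k'" using v(5) by (rule order_trans[rotated])
    then show thesis by (rule that[OF v(1-4) _ O]) (use a(2,4) in simp)
  qed
qed

definition start :: "nd tree" where
  "start = (SOME T. state_inv T (\<lambda>_. (top, 3)) \<and> rgl T = (\<lambda>_. (0, 0)))"

lemma start: "state_inv start (\<lambda>_. (top, 3))" "rgl start = (\<lambda>_. (0, 0))"
  using someI_ex[OF ex_initial] unfolding start_def by blast+

end

context accs
begin

text \<open>An access stopping at \<open>k'\<close> inserts at least one item into every layer from
  \<open>kap\<close> to \<open>k' - 1\<close>, and
  \<open>2 ^ k' = 2 ^ kap + (\<Sum>k\<in>{kap..<k'}. 2 ^ k)\<close>. So beyond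
  \<open>2 ^ kap\<close> its cost is paid by the insertions it makes, weighted with
  \<open>2 ^ k\<close>.\<close>

lemma amort_acc:
  assumes I: "Inv \<gamma> g" and acc: "acc (xs i) \<gamma> (flip g) \<gamma>' g' k'"
    and am: "\<And>k. kap \<le> k \<Longrightarrow> k < top \<Longrightarrow> amort k i (I k) (snd (g k)) (S k (fst (g k)) \<gamma>)"
  shows "\<exists>I'. (\<forall>k. kap \<le> k \<and> k < top \<longrightarrow> amort k (Suc i) (I' k) (snd (g' k)) (S k (fst (g' k)) \<gamma>')) \<and>
     2 ^ k' + (\<Sum>k\<in>{kap..<top}. 2 ^ k * I k) \<le> 2 ^ kap + (\<Sum>k\<in>{kap..<top}. 2 ^ k * I' k)"
proof -
  have c: "cnt_ok \<gamma> g" using I unfolding Inv_def by blast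
  have k': "kap \<le> k'" "k' \<le> max kap top" using acc unfolding acc_def by blast+
  have hit: "\<not> fresh \<gamma> (flip g) (xs i) k" "level_rel (xs i) (flip g) \<gamma> \<gamma>' k"
      "g' k = (fst (flip g k), snd (flip g k) + card (W k (xs i) - S k (fst (flip g k)) \<gamma>))" if "kap \<le> k" "k < k'" for k
    using acc that unfolding acc_def by blast+
  have miss: "g' k = flip g k" "S k j \<gamma>' = S k j \<gamma>" if "k' \<le> k" "k < top" for k j
    using acc that unfolding acc_def by (meson leD)+
  define m where "m k = (if k < k' then card (W k (xs i) - S k (fst (flip g k)) \<gamma>) else 0)" for k
  have fl: "amort k i (I k) (snd (flip g k)) (S k (fst (flip g k)) \<gamma>)" if k: "kap \<le> k" "k < top" for k
  proof (cases "NN k \<le> snd (g k)")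
    case True
    note f = flip_simps[of k g, OF k True cnt_okD(1)[OF c k]]
    show ?thesis unfolding f old_empty[OF c k True]
      by (rule amort_flip[OF am[OF k] _ k(2) True]) (use kap(1) k(1) in simp)
  next
    case False
    then have "flip g k = g k" by (intro noflip_simps(1)) blast
    then show ?thesis using am[OF k] by simp
  qed
  have am': "amort k (Suc i) (I k + m k) (snd (g' k)) (S k (fst (g' k)) \<gamma>')" if k: "kap \<le> k" "k < top" for k
  proof (cases "k < k'")
    case True
    define F where "F = S k (fst (flip g k)) \<gamma>"
    have F: "card F = snd (flip g k)" using fl[OF k] by (simp add: amort_def F_def)
    have "card (F \<union> W k (xs i)) = card (F \<union> (W k (xs i) - F))" by simp
    also have "\<dots> = snd (flip g k) + m k" using True F by (subst card_Un_disjoint) (auto simp: F_def m_def)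
    finally have "card (F \<union> W k (xs i)) = snd (flip g k) + m k" .
    from amort_insert[OF fl[OF k, folded F_def] this]
    have "amort k (Suc i) (I k + m k) (snd (flip g k) + m k) (F \<union> W k (xs i))" .
    moreover have "S k (fst (g' k)) \<gamma>' = F \<union> W k (xs i)" "snd (g' k) = snd (flip g k) + m k"
      using hit[OF k(1) True] True by (simp_all add: level_rel_def F_def m_def)
    ultimately show ?thesis by simp
  next
    case False
    then show ?thesis using miss[of k] k amort_mono[OF fl[OF k]] by (simp add: m_def)
  qed
  have sub: "{kap..<k'} \<subseteq> {kap..<top}" using k' by auto
  have "(\<Sum>k\<in>{kap..<k'}. 2 ^ k) \<le> (\<Sum>k\<in>{kap..<k'}. 2 ^ k * m k)"
  proof (rule sum_mono)
    fix k assume "k \<in> {kap..<k'}"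
    then have k: "kap \<le> k" "k < k'" by auto
    obtain s where "s \<in> W k (xs i)" "\<gamma> s \<noteq> (k, fst (flip g k))" using hit(1)[OF k] unfolding fresh_def by blast
    then have "s \<in> W k (xs i) - S k (fst (flip g k)) \<gamma>" by (simp add: S_def)
    then have "m k \<noteq> 0" using k by (auto simp: m_def)
    then show "(2::nat) ^ k \<le> 2 ^ k * m k" by simp
  qed
  also have "\<dots> \<le> (\<Sum>k\<in>{kap..<top}. 2 ^ k * m k)" using sub by (intro sum_mono2) auto
  finally have "(\<Sum>k\<in>{kap..<k'}. 2 ^ k) \<le> (\<Sum>k\<in>{kap..<top}. 2 ^ k * m k)" .
  moreover have "2 ^ k' = 2 ^ kap + (\<Sum>k\<in>{kap..<k'}. (2::nat) ^ k)" using k'(1)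
    by (induction rule: dec_induct) simp_all
  ultimately have "2 ^ k' + (\<Sum>k\<in>{kap..<top}. 2 ^ k * I k) \<le> 2 ^ kap + (\<Sum>k\<in>{kap..<top}. 2 ^ k * (I k + m k))"
    by (simp add: distrib_left sum.distrib)
  then show ?thesis using am' by (intro exI[of _ "\<lambda>k. I k + m k"]) blast
qed

lemma run_invariant:
  "\<exists>T \<gamma> I. run decide (real_tree start) n xs i = real_tree T \<and> state_inv T \<gamma> \<and>
     (\<forall>k. kap \<le> k \<and> k < top \<longrightarrow> amort k i (I k) (snd (rgl T k)) (S k (fst (rgl T k)) \<gamma>)) \<and>
     (\<Sum>j<i. cost decide (real_tree start) n xs j) \<le> 170001 * (i * 2 ^ kap + (\<Sum>k\<in>{kap..<top}. 2 ^ k * I k))"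
proof (induction i)
  case 0
  have "S k j (\<lambda>_. (top, 3)) = {}" if "k < top" for k j using that by (auto simp: S_def)
  then have "amort k 0 0 (snd (rgl start k)) (S k (fst (rgl start k)) (\<lambda>_. (top, 3)))" if "k < top" for k
    using that start by (simp add: amort_def cover_def)
  then show ?case using start by (intro exI[of _ start] exI[of _ "\<lambda>_. (top, 3)"] exI[of _ "\<lambda>_. 0"]) simp
next
  case (Suc i)
  let ?c = "cost decide (real_tree start) n xs"
  obtain T \<gamma> I where IH: "run decide (real_tree start) n xs i = real_tree T" "state_inv T \<gamma>"
     "\<forall>k. kap \<le> k \<and> k < top \<longrightarrow> amort k i (I k) (snd (rgl T k)) (S k (fst (rgl T k)) \<gamma>)"
     "(\<Sum>j<i. ?c j) \<le> 170001 * (i * 2 ^ kap + (\<Sum>k\<in>{kap..<top}. 2 ^ k * I k))"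
    using Suc.IH by blast
  from access_step[OF IH(2) xs[of i]] obtain k' \<gamma>' T' v out where st: "access decide n (real_tree T) (xs i) = Some (v, out)"
    "new_tree (real_tree T) v out = real_tree T'"
    "length (vnodes v) \<le> 170001 * 2 ^ k'" "state_inv T' \<gamma>'" "acc (xs i) \<gamma> (flip (rgl T)) \<gamma>' (rgl T') k'" by metis
  have "Inv \<gamma> (rgl T)" using IH(2) by (simp add: state_inv_def)
  then obtain I' where I': "\<forall>k. kap \<le> k \<and> k < top \<longrightarrow> amort k (Suc i) (I' k) (snd (rgl T' k)) (S k (fst (rgl T' k)) \<gamma>')"
     "2 ^ k' + (\<Sum>k\<in>{kap..<top}. 2 ^ k * I k) \<le> 2 ^ kap + (\<Sum>k\<in>{kap..<top}. 2 ^ k * I' k)"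
    using amort_acc[OF _ st(5)] IH(3) by blast
  have "(\<Sum>j<Suc i. ?c j) = (\<Sum>j<i. ?c j) + length (vnodes v)" using st(1) IH(1) by (simp add: cost_def)
  also have "\<dots> \<le> 170001 * (i * 2 ^ kap + (\<Sum>k\<in>{kap..<top}. 2 ^ k * I k)) + 170001 * 2 ^ k'"
    by (rule add_mono[OF IH(4) st(3)])
  also have "\<dots> = 170001 * (i * 2 ^ kap + (2 ^ k' + (\<Sum>k\<in>{kap..<top}. 2 ^ k * I k)))"
    by (simp only: distrib_left[symmetric] add.assoc add.commute[of _ "2 ^ k'"] add.left_commute[of _ "2 ^ k'"])
  also have "\<dots> \<le> 170001 * (i * 2 ^ kap + (2 ^ kap + (\<Sum>k\<in>{kap..<top}. 2 ^ k * I' k)))"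
    using I'(2) by (intro mult_le_mono2 add_left_mono)
  also have "\<dots> = 170001 * (Suc i * 2 ^ kap + (\<Sum>k\<in>{kap..<top}. 2 ^ k * I' k))" by simp
  finally have "(\<Sum>j<Suc i. ?c j) \<le> 170001 * (Suc i * 2 ^ kap + (\<Sum>k\<in>{kap..<top}. 2 ^ k * I' k))" .
  moreover have "run decide (real_tree start) n xs (Suc i) = real_tree T'" using IH(1) st(1,2) by simp
  ultimately show ?case using st(4) I'(1) by blast
qed

lemma run_access:
  "legal_access 21 n decide (run decide (real_tree start) n xs i) (xs i)"
  "real (cost decide (real_tree start) n xs i) \<le> 170001 * 46 * lg (real n)"
proof -
  obtain T \<gamma> where T: "run decide (real_tree start) n xs i = real_tree T" "state_inv T \<gamma>" using run_invariant[of i] by blast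
  from access_step[OF T(2) xs[of i]] obtain k' \<gamma>' T' v out where st: "access decide n (real_tree T) (xs i) = Some (v, out)"
    "xs i \<in> fst ` set (vnodes v)" "nholes out = nholes v" "new_tree (real_tree T) v out = real_tree T'"
    "length (vnodes v) \<le> 170001 * 2 ^ k'" "state_inv T' \<gamma>'" "acc (xs i) \<gamma> (flip (rgl T)) \<gamma>' (rgl T') k'" by metis
  show "legal_access 21 n decide (run decide (real_tree start) n xs i) (xs i)"
    unfolding legal_access_def T(1) using st(1-4) real_ok[OF st(6)] by metis
  have "k' \<le> max kap top" using st(7) unfolding acc_def by blast
  then have "(2::real) ^ k' \<le> 2 ^ max kap top" by (rule power_increasing) simp
  also have "\<dots> \<le> 2 ^ kap + 2 ^ top" by (simp add: max_def)
  \<comment> \<open>\<open>46 = 22 * 2 + 2\<close>, from \<open>pow_kap\<close>,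
    \<open>lglg_le\<close> and \<open>pow_top\<close>.\<close>
  also have "\<dots> \<le> 46 * lg (real n)" using pow_kap pow_top lglg_le by linarith
  finally have "170001 * 2 ^ k' \<le> 170001 * 46 * lg (real n)" by simp
  moreover have "real (length (vnodes v)) \<le> real (170001 * 2 ^ k')" using st(5) by (rule of_nat_mono)
  ultimately show "real (cost decide (real_tree start) n xs i) \<le> 170001 * 46 * lg (real n)"
    using st(1) T(1) by (simp add: cost_def)
qed

lemma run_cost:
  "real (\<Sum>j<m. cost decide (real_tree start) n xs j) \<le> 170001 * 112 * (\<Sum>j<m. UB n xs j + lg (lg (real n)))"
proof -
  obtain T \<gamma> I where I: "\<forall>k. kap \<le> k \<and> k < top \<longrightarrow> amort k m (I k) (snd (rgl T k)) (S k (fst (rgl T k)) \<gamma>)"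
     "(\<Sum>j<m. cost decide (real_tree start) n xs j) \<le> 170001 * (m * 2 ^ kap + (\<Sum>k\<in>{kap..<top}. 2 ^ k * I k))"
    using run_invariant[of m] by blast
  \<comment> \<open>The doubling in \<open>amort_final\<close> turns \<open>14\<close> into
    \<open>28\<close>. The summand \<open>4 * m\<close> occurs at fewer than \<open>2 ^ kap\<close>
    levels and so merges into the term \<open>m * 2 ^ kap\<close>.\<close>
  have "2 ^ k * I k \<le> 28 * (2 ^ k * expensive_count k m) + 4 * m" if "k \<in> {kap..<top}" for k
    using amort_final[of k m "I k"] I(1) that kap(1) by (fastforce simp: Bd_def)
  then have "(\<Sum>k\<in>{kap..<top}. 2 ^ k * I k) \<le> (\<Sum>k\<in>{kap..<top}. 28 * (2 ^ k * expensive_count k m) + 4 * m)" by (rule sum_mono)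
  also have "\<dots> = 28 * (\<Sum>k\<in>{kap..<top}. 2 ^ k * expensive_count k m) + (top - kap) * (4 * m)"
    by (simp only: sum.distrib sum_distrib_left sum_constant card_atLeastLessThan of_nat_id)
  also have "\<dots> \<le> 28 * (\<Sum>k\<in>{kap..<top}. 2 ^ k * expensive_count k m) + 2 ^ kap * (4 * m)"
    using kap(2) by (intro add_left_mono mult_le_mono1) linarith
  finally have "m * 2 ^ kap + (\<Sum>k\<in>{kap..<top}. 2 ^ k * I k) \<le> 5 * (m * 2 ^ kap) + 28 * (\<Sum>k\<in>{kap..<top}. 2 ^ k * expensive_count k m)"
    by (simp add: algebra_simps)
  then have "(\<Sum>j<m. cost decide (real_tree start) n xs j) \<le> 170001 * (5 * (m * 2 ^ kap) + 28 * (\<Sum>k\<in>{kap..<top}. 2 ^ k * expensive_count k m))"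
    using I(2) by (meson mult_le_mono2 order_trans)
  then have "real (\<Sum>j<m. cost decide (real_tree start) n xs j) \<le>
      real (170001 * (5 * (m * 2 ^ kap) + 28 * (\<Sum>k\<in>{kap..<top}. 2 ^ k * expensive_count k m)))" by (rule of_nat_mono)
  also have "\<dots> = 170001 * (5 * (real m * 2 ^ kap) + 28 * (\<Sum>k\<in>{kap..<top}. 2 ^ k * real (expensive_count k m)))" by simp
  also have "\<dots> \<le> 170001 * (5 * (real m * (22 * lg (lg (real n)))) + 28 * (4 * (\<Sum>j<m. UB n xs j)))"
    using pow_kap sum_ex[of m] by (intro mult_left_mono add_mono) auto
  also have "\<dots> \<le> 170001 * (112 * (real m * lg (lg (real n))) + 112 * (\<Sum>j<m. UB n xs j))"
  proof -
    have "0 \<le> real m * lg (lg (real n))" using lg_ge1(2) by simp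
    then show ?thesis by simp
  qed
  also have "\<dots> = 170001 * 112 * (\<Sum>j<m. UB n xs j + lg (lg (real n)))" by (simp add: sum.distrib algebra_simps)
  finally show ?thesis .
qed

end

theorem theorem2:
  "\<exists>(c::nat) (C::real). C > 0 \<and>
     (\<forall>n::nat. n \<ge> 1 \<longrightarrow>
       (\<exists>(t0::node tree) (dec::decider). bst_on n t0 \<and> fields_ok c n t0 \<and>
          (\<forall>xs::nat \<Rightarrow> nat. (\<forall>i. xs i \<in> {1..n}) \<longrightarrow>
             (\<forall>i. legal_access c n dec (run dec t0 n xs i) (xs i)) \<and>
             (\<forall>i. real (cost dec t0 n xs i) \<le> C * lg (real n)) \<and>
             (\<forall>m. real (\<Sum>i<m. cost dec t0 n xs i)
                    \<le> C * (\<Sum>i<m. UB n xs i + lg (lg (real n)))))))"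
proof (intro exI[of _ "21::nat"] exI[of _ "170001 * 112 :: real"] conjI allI impI)
  fix n :: nat
  assume "1 \<le> n"
  then interpret sep n by unfold_locales
  show "\<exists>t0 dec. bst_on n t0 \<and> fields_ok 21 n t0 \<and> (\<forall>xs. (\<forall>i. xs i \<in> {1..n}) \<longrightarrow>
      (\<forall>i. legal_access 21 n dec (run dec t0 n xs i) (xs i)) \<and>
      (\<forall>i. real (cost dec t0 n xs i) \<le> 170001 * 112 * lg (real n)) \<and>
      (\<forall>m. real (\<Sum>i<m. cost dec t0 n xs i) \<le> 170001 * 112 * (\<Sum>i<m. UB n xs i + lg (lg (real n)))))"
  proof (rule exI[of _ "real_tree start"], rule exI[of _ decide], intro conjI allI impI)
    show "bst_on n (real_tree start)" "fields_ok 21 n (real_tree start)" using real_ok start(1) by blast+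
    fix xs :: "nat \<Rightarrow> nat" and i :: nat
    assume "\<forall>i. xs i \<in> {1..n}"
    then interpret accs n xs by unfold_locales blast
    show "legal_access 21 n decide (run decide (real_tree start) n xs i) (xs i)" by (rule run_access(1))
    show "real (cost decide (real_tree start) n xs i) \<le> 170001 * 112 * lg (real n)"
      using run_access(2)[of i] lg_ge1(1) by simp
    show "real (\<Sum>j<i. cost decide (real_tree start) n xs j) \<le> 170001 * 112 * (\<Sum>j<i. UB n xs j + lg (lg (real n)))"
      by (rule run_cost)
  qed
qed simp

end
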